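(* Let $\mathsf H$ be a bounded heart in a triangulated category $\mathsf D$, equipped with a surjective homomorphism $\lambda\colon K(\mathsf H)=K(\mathsf D)\to\Lambda$ onto a free abelian group of finite rank. Let $Z\colon\Lambda_{\mathbb R}\to\mathbb C$ be a stability function on $\mathsf H$ with the Harder–Narasimhan property, and let $Z^*\colon\mathbb C^*\to\Lambda_{\mathbb R}^*$, $w\mapsto w\circ Z$, be its dual. Then the phase diagram $\Phi_Z\colon\mathbb H^*\to\mathrm{Wide}(\mathsf H)$ factorises over the support $|\Delta(\mathsf H)|$ of the heart fan of $\mathsf H$: for all $w\in\mathbb H^*$ one has $Z^*(w)\in|\Delta(\mathsf H)|$ and $$\Phi_Z(w)=\Theta(Z^*(w))\cap\mathsf H .$$
   Context: $\Lambda_{\mathbb R}=\Lambda\otimes\mathbb R$, $\Lambda_{\mathbb R}^*=\operatorname{Hom}(\Lambda,\mathbb R)$; for an object $h$ write $v(h)=v(\lambda([h]))$ and $Z(h)=Z(\lambda([h]))$. A bounded heart is the heart of a bounded t-structure. Bounded hearts $\mathsf K$ of $\mathsf D$ have $K(\mathsf K)=K(\mathsf D)$ and are partially ordered by $\mathsf K\ge\mathsf H$ iff $\operatorname{Hom}_{\mathsf D}(\mathsf K[n],\mathsf H)=0$ for all $n>0$. The heart cone is $C(\mathsf K)=\{v\in\Lambda_{\mathbb R}^*\mid v(k)\ge0\ \forall k\in\mathsf K\}$; the heart fan $\Delta(\mathsf H)$ is the fan of all cones $C(\mathsf K)$ with $\mathsf H[1]\ge\mathsf K\ge\mathsf H$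 and their faces, so its support is $|\Delta(\mathsf H)|=\bigcup_{\mathsf H[1]\ge\mathsf K\ge\mathsf H}C(\mathsf K)$. Thick label map: $\Theta\colon|\Delta(\mathsf H)|\to\{\text{thick subcategories of }\mathsf D\}$, $\Theta(v)=\mathrm{thick}(\ker_{\mathsf K}(v))$ for any choice of heart $\mathsf H[1]\ge\mathsf K\ge\mathsf H$ with $v\in C(\mathsf K)$, where $\ker_{\mathsf K}(v)=\{k\in\mathsf K\mid v(k)=0\}$ and $\mathrm{thick}(S)$ is the smallest thick (triangulated, closed under summands) subcategory containing $S$; this is independent of the choice of $\mathsf K$. Stability functions: a stability function on $\mathsf H$ is an $\mathbb R$-linear map $Z\colon\Lambda_{\mathbb R}\to\mathbb C$ with $Z(h)\in\{me^{\pi i\phi}\mid \phi\in(0,1],m>0\}$ for all $0\ne h\in\mathsf H$; the phase $\phi(h)\in(0,1]$ of $h\neq 0$ is defined by $Z(h)=me^{\pi i\phi(h)}$, $m>0$. An object $h$ is $Z$-semistable if $\phi(h')\le\phi(h)$ for all non-zero subobjects $h'\hookrightarrow h$. $P(\phi)\subseteq\mathsf H$ is the full subcategory of $Z$-semistable objects of phase $\phi$ (together with $0$); it is a wide subcategory, i.e. closed under kernels, cokernels and extensions. $Z$ has the Harder–Narasimhan property if each $h\in\mathsf H$ has a finite chain $0=h_0\hookrightarrow h_1\hookrightarrow\dots\hookrightarrow h_n=h$ with $0\ne h_i/h_{i-1}\in P(\phi_i)$ and $\phi_1>\dots>\phi_n$. $\mathrm{Wide}(\mathsf H)$ is the set of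 wide subcategories of $\mathsf H$. Phase diagram: $\mathbb C^*=\operatorname{Hom}_{\mathbb R}(\mathbb C,\mathbb R)$ is the real dual and $\mathbb H^*=\{w\in\mathbb C^*\mid w(e^{\pi i\phi})=0,\ w(ie^{\pi i\phi})>0\text{ for some }\phi\in(0,1]\}$. For $w\in\mathbb H^*$, $\theta(w)\in(0,1]$ is determined by $e^{\pi i\theta(w)}\in\ker(w)$. The phase diagram is $\Phi_Z(w)=P(\theta(w))$. *)

theory Defs
  imports Complex_Main "HOL-Algebra.Free_Abelian_Groups"
begin

section \<open>Additive and triangulated categories\<close>

text \<open>
  The objects are the elements of the type \<^typ>\<open>'o\<close>, and \<open>Mor D X Y\<close> is the set of morphisms
  from \<open>X\<close> to \<open>Y\<close>.  Composition is in applicative order: \<open>g \<cdot> f\<close> is first \<open>f\<close>, then \<open>g\<close>.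
  \<open>tri D X Y Z f g h\<close> says that \<open>X \<rightarrow> Y \<rightarrow> Z \<rightarrow> X[1]\<close>, with maps \<open>f, g, h\<close>, is a distinguished triangle.
\<close>

record ('o, 'm) tcat =
  Mor :: "'o \<Rightarrow> 'o \<Rightarrow> 'm set"
  idm :: "'o \<Rightarrow> 'm"
  cmp :: "'m \<Rightarrow> 'm \<Rightarrow> 'm"  (infixl \<open>\<cdot>\<index>\<close> 70)
  madd :: "'m \<Rightarrow> 'm \<Rightarrow> 'm"
  mzero :: "'o \<Rightarrow> 'o \<Rightarrow> 'm"
  sh :: "'o \<Rightarrow> 'o"
  shm :: "'m \<Rightarrow> 'm"
  tri :: "'o \<Rightarrow> 'o \<Rightarrow> 'o \<Rightarrow> 'm \<Rightarrow> 'm \<Rightarrow> 'm \<Rightarrow> bool"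

definition Mor_group :: "('o, 'm) tcat \<Rightarrow> 'o \<Rightarrow> 'o \<Rightarrow> 'm monoid"
  where "Mor_group D X Y = \<lparr>carrier = Mor D X Y, monoid.mult = madd D, one = mzero D X Y\<rparr>"

definition iso_pair :: "('o, 'm) tcat \<Rightarrow> 'o \<Rightarrow> 'o \<Rightarrow> 'm \<Rightarrow> 'm \<Rightarrow> bool"
  where "iso_pair D X Y f g \<longleftrightarrow>
    f \<in> Mor D X Y \<and> g \<in> Mor D Y X \<and> g \<cdot>\<^bsub>D\<^esub> f = idm D X \<and> f \<cdot>\<^bsub>D\<^esub> g = idm D Y"

definition is_isom :: "('o, 'm) tcat \<Rightarrow> 'o \<Rightarrow> 'o \<Rightarrow> 'm \<Rightarrow> bool"
  where "is_isom D X Y f \<longleftrightarrow> (\<exists>g. iso_pair D X Y f g)"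

definition isomorphic :: "('o, 'm) tcat \<Rightarrow> 'o \<Rightarrow> 'o \<Rightarrow> bool"
  where "isomorphic D X Y \<longleftrightarrow> (\<exists>f. is_isom D X Y f)"

definition zero_object :: "('o, 'm) tcat \<Rightarrow> 'o \<Rightarrow> bool"
  where "zero_object D X \<longleftrightarrow>
    (\<forall>Y. Mor D X Y = {mzero D X Y} \<and> Mor D Y X = {mzero D Y X})"

definition biproduct :: "('o, 'm) tcat \<Rightarrow> 'o \<Rightarrow> 'o \<Rightarrow> 'o \<Rightarrow> bool"
  where "biproduct D X Y S \<longleftrightarrow>
    (\<exists>i \<in> Mor D X S. \<exists>j \<in> Mor D Y S. \<exists>p \<in> Mor D S X. \<exists>q \<in> Mor D S Y.
      p \<cdot>\<^bsub>D\<^esub> i = idm D X \<and> q \<cdot>\<^bsub>D\<^esub> j = idm D Y \<and>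
      q \<cdot>\<^bsub>D\<^esub> i = mzero D X Y \<and> p \<cdot>\<^bsub>D\<^esub> j = mzero D Y X \<and>
      madd D (i \<cdot>\<^bsub>D\<^esub> p) (j \<cdot>\<^bsub>D\<^esub> q) = idm D S)"

locale additive_category =
  fixes D :: "('o, 'm) tcat" (structure)
  assumes idm_in: "idm D X \<in> Mor D X X"
    and cmp_in: "\<lbrakk>f \<in> Mor D X Y; g \<in> Mor D Y Z\<rbrakk> \<Longrightarrow> g \<cdot> f \<in> Mor D X Z"
    and cmp_idm: "f \<in> Mor D X Y \<Longrightarrow> f \<cdot> idm D X = f"
    and idm_cmp: "f \<in> Mor D X Y \<Longrightarrow> idm D Y \<cdot> f = f"
    and cmp_assoc: "\<lbrakk>f \<in> Mor D X Y; g \<in> Mor D Y Z; h \<in> Mor D Z W\<rbrakk>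
          \<Longrightarrow> (h \<cdot> g) \<cdot> f = h \<cdot> (g \<cdot> f)"
    and Mor_comm_group: "comm_group (Mor_group D X Y)"
    and cmp_madd: "\<lbrakk>f \<in> Mor D X Y; f' \<in> Mor D X Y; g \<in> Mor D Y Z\<rbrakk>
          \<Longrightarrow> g \<cdot> madd D f f' = madd D (g \<cdot> f) (g \<cdot> f')"
    and madd_cmp: "\<lbrakk>f \<in> Mor D X Y; g \<in> Mor D Y Z; g' \<in> Mor D Y Z\<rbrakk>
          \<Longrightarrow> madd D g g' \<cdot> f = madd D (g \<cdot> f) (g' \<cdot> f)"
    and ex_zero_object: "\<exists>X. zero_object D X"
    and ex_biproduct: "\<exists>S. biproduct D X Y S"

text \<open>
  The shift is an additive autoequivalence, not necessarily a strict automorphism.  The axioms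
  TR1--TR4 are Verdier's.
\<close>

locale triangulated_category = additive_category D for D :: "('o, 'm) tcat" (structure) +
  assumes shm_idm: "shm D (idm D X) = idm D (sh D X)"
    and shm_cmp: "\<lbrakk>f \<in> Mor D X Y; g \<in> Mor D Y Z\<rbrakk> \<Longrightarrow> shm D (g \<cdot> f) = shm D g \<cdot> shm D f"
    and shm_madd: "\<lbrakk>f \<in> Mor D X Y; f' \<in> Mor D X Y\<rbrakk>
          \<Longrightarrow> shm D (madd D f f') = madd D (shm D f) (shm D f')"
    and shm_fully_faithful: "bij_betw (shm D) (Mor D X Y) (Mor D (sh D X) (sh D Y))"
    and sh_ess_surj: "\<exists>X. isomorphic D (sh D X) Y"
    and tri_Mor: "tri D X Y Z f g h
          \<Longrightarrow> f \<in> Mor D X Y \<and> g \<in> Mor D Y Z \<and> h \<in> Mor D Z (sh D X)"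
    and TR1_id: "zero_object D O'
          \<Longrightarrow> tri D X X O' (idm D X) (mzero D X O') (mzero D O' (sh D X))"
    and TR1_cone: "f \<in> Mor D X Y \<Longrightarrow> \<exists>Z g h. tri D X Y Z f g h"
    and TR1_iso: "\<lbrakk>tri D X Y Z f g h;
            f' \<in> Mor D X' Y'; g' \<in> Mor D Y' Z'; h' \<in> Mor D Z' (sh D X');
            is_isom D X X' a; is_isom D Y Y' b; is_isom D Z Z' c;
            b \<cdot> f = f' \<cdot> a; c \<cdot> g = g' \<cdot> b; shm D a \<cdot> h = h' \<cdot> c\<rbrakk>
          \<Longrightarrow> tri D X' Y' Z' f' g' h'"
    and TR2: "\<lbrakk>f \<in> Mor D X Y; g \<in> Mor D Y Z; h \<in> Mor D Z (sh D X)\<rbrakk>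
          \<Longrightarrow> tri D X Y Z f g h \<longleftrightarrow>
              tri D Y Z (sh D X) g h (inv\<^bsub>Mor_group D (sh D X) (sh D Y)\<^esub> (shm D f))"
    and TR3: "\<lbrakk>tri D X Y Z f g h; tri D X' Y' Z' f' g' h';
            a \<in> Mor D X X'; b \<in> Mor D Y Y'; b \<cdot> f = f' \<cdot> a\<rbrakk>
          \<Longrightarrow> \<exists>c \<in> Mor D Z Z'. c \<cdot> g = g' \<cdot> b \<and> shm D a \<cdot> h = h' \<cdot> c"
    and TR4: "\<lbrakk>tri D X Y A f a a'; tri D Y Z B g b b'; tri D X Z C (g \<cdot> f) c c'\<rbrakk>
          \<Longrightarrow> \<exists>u v. tri D A C B u v (shm D a \<cdot> b') \<and>
                u \<cdot> a = c \<cdot> g \<and> c' \<cdot> u = a' \<and> v \<cdot> c = b \<and> b' \<cdot> v = shm D f \<cdot> c'"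


section \<open>Bounded hearts and thick subcategories\<close>

text \<open>Full subcategories are represented by their sets of objects.\<close>

definition iso_closed :: "('o, 'm) tcat \<Rightarrow> 'o set \<Rightarrow> bool"
  where "iso_closed D S \<longleftrightarrow> (\<forall>X Y. X \<in> S \<longrightarrow> isomorphic D X Y \<longrightarrow> Y \<in> S)"

text \<open>
  \<open>shifted D S n\<close> is \<open>S[n]\<close>, closed under isomorphism.  As the shift need not be invertible on
  objects, for negative \<open>n\<close> the condition \<open>Y \<cong> X[n]\<close> is written \<open>Y[-n] \<cong> X\<close>.
\<close>

definition shifted :: "('o, 'm) tcat \<Rightarrow> 'o set \<Rightarrow> int \<Rightarrow> 'o set"
  where "shifted D S n =
    {Y. \<exists>X \<in> S. isomorphic D ((sh D ^^ nat (- n)) Y) ((sh D ^^ nat n) X)}"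

text \<open>
  In \<open>t_structure D U V\<close>, \<open>U\<close> is the aisle \<open>D\<^sup>\<le>\<^sup>0\<close> and \<open>V\<close> the coaisle \<open>D\<^sup>\<ge>\<^sup>0\<close>; hence \<open>V[-1]\<close>
  is \<open>D\<^sup>\<ge>\<^sup>1\<close>.
\<close>

definition t_structure :: "('o, 'm) tcat \<Rightarrow> 'o set \<Rightarrow> 'o set \<Rightarrow> bool"
  where "t_structure D U V \<longleftrightarrow>
    iso_closed D U \<and> iso_closed D V \<and>
    U \<subseteq> shifted D U (-1) \<and> shifted D V (-1) \<subseteq> V \<and>
    (\<forall>X \<in> U. \<forall>Y \<in> shifted D V (-1). Mor D X Y = {mzero D X Y}) \<and>
    (\<forall>X. \<exists>A \<in> U. \<exists>B \<in> shifted D V (-1). \<exists>f g h. tri D A X B f g h)"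

definition bounded_t_structure :: "('o, 'm) tcat \<Rightarrow> 'o set \<Rightarrow> 'o set \<Rightarrow> bool"
  where "bounded_t_structure D U V \<longleftrightarrow> t_structure D U V \<and>
    (\<forall>X. \<exists>n::nat. X \<in> shifted D U (- int n) \<and> X \<in> shifted D V (int n))"

definition bounded_heart :: "('o, 'm) tcat \<Rightarrow> 'o set \<Rightarrow> bool"
  where "bounded_heart D H \<longleftrightarrow> (\<exists>U V. bounded_t_structure D U V \<and> H = U \<inter> V)"

definition heart_ge :: "('o, 'm) tcat \<Rightarrow> 'o set \<Rightarrow> 'o set \<Rightarrow> bool"
  where "heart_ge D K H \<longleftrightarrow>
    (\<forall>n>0. \<forall>k \<in> K. \<forall>h \<in> H. Mor D ((sh D ^^ n) k) h = {mzero D ((sh D ^^ n) k) h})"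

definition intermediate_hearts :: "('o, 'm) tcat \<Rightarrow> 'o set \<Rightarrow> 'o set set"
  where "intermediate_hearts D H =
    {K. bounded_heart D K \<and> heart_ge D (shifted D H 1) K \<and> heart_ge D K H}"

definition thick_subcategory :: "('o, 'm) tcat \<Rightarrow> 'o set \<Rightarrow> bool"
  where "thick_subcategory D T \<longleftrightarrow>
    iso_closed D T \<and> (\<exists>X \<in> T. zero_object D X) \<and>
    (\<forall>X. sh D X \<in> T \<longleftrightarrow> X \<in> T) \<and>
    (\<forall>X Y Z f g h. tri D X Y Z f g h \<longrightarrow> X \<in> T \<longrightarrow> Y \<in> T \<longrightarrow> Z \<in> T) \<and>
    (\<forall>X Y S. biproduct D X Y S \<longrightarrow> S \<in> T \<longrightarrow> X \<in> T)"

definition thick :: "('o, 'm) tcat \<Rightarrow> 'o set \<Rightarrow> 'o set"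
  where "thick D S = \<Inter> {T. thick_subcategory D T \<and> S \<subseteq> T}"


section \<open>Wide subcategories of a heart\<close>

definition is_mono :: "('o, 'm) tcat \<Rightarrow> 'o set \<Rightarrow> 'o \<Rightarrow> 'o \<Rightarrow> 'm \<Rightarrow> bool"
  where "is_mono D H A B i \<longleftrightarrow> A \<in> H \<and> B \<in> H \<and> i \<in> Mor D A B \<and>
    (\<forall>T \<in> H. \<forall>s \<in> Mor D T A. \<forall>t \<in> Mor D T A. i \<cdot>\<^bsub>D\<^esub> s = i \<cdot>\<^bsub>D\<^esub> t \<longrightarrow> s = t)"

definition is_kernel :: "('o, 'm) tcat \<Rightarrow> 'o set \<Rightarrow> 'o \<Rightarrow> 'o \<Rightarrow> 'm \<Rightarrow> 'o \<Rightarrow> 'm \<Rightarrow> bool"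
  where "is_kernel D H A B f N i \<longleftrightarrow>
    A \<in> H \<and> B \<in> H \<and> N \<in> H \<and> f \<in> Mor D A B \<and> i \<in> Mor D N A \<and> f \<cdot>\<^bsub>D\<^esub> i = mzero D N B \<and>
    (\<forall>T \<in> H. \<forall>t \<in> Mor D T A. f \<cdot>\<^bsub>D\<^esub> t = mzero D T B \<longrightarrow> (\<exists>!u. u \<in> Mor D T N \<and> i \<cdot>\<^bsub>D\<^esub> u = t))"

definition is_cokernel :: "('o, 'm) tcat \<Rightarrow> 'o set \<Rightarrow> 'o \<Rightarrow> 'o \<Rightarrow> 'm \<Rightarrow> 'o \<Rightarrow> 'm \<Rightarrow> bool"
  where "is_cokernel D H A B f Q p \<longleftrightarrow>
    A \<in> H \<and> B \<in> H \<and> Q \<in> H \<and> f \<in> Mor D A B \<and> p \<in> Mor D B Q \<and> p \<cdot>\<^bsub>D\<^esub> f = mzero D A Q \<and>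
    (\<forall>T \<in> H. \<forall>t \<in> Mor D B T. t \<cdot>\<^bsub>D\<^esub> f = mzero D A T \<longrightarrow> (\<exists>!u. u \<in> Mor D Q T \<and> u \<cdot>\<^bsub>D\<^esub> p = t))"

definition short_exact :: "('o, 'm) tcat \<Rightarrow> 'o set \<Rightarrow> 'o \<Rightarrow> 'o \<Rightarrow> 'o \<Rightarrow> 'm \<Rightarrow> 'm \<Rightarrow> bool"
  where "short_exact D H A E B i p \<longleftrightarrow> is_kernel D H E B p A i \<and> is_cokernel D H A E i B p"

definition Wide :: "('o, 'm) tcat \<Rightarrow> 'o set \<Rightarrow> 'o set set"
  where "Wide D H = {W. W \<subseteq> H \<and> (\<exists>X \<in> W. zero_object D X) \<and>
    (\<forall>A B f N i. A \<in> W \<longrightarrow> B \<in> W \<longrightarrow> is_kernel D H A B f N i \<longrightarrow> N \<in> W) \<and>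
    (\<forall>A B f Q p. A \<in> W \<longrightarrow> B \<in> W \<longrightarrow> is_cokernel D H A B f Q p \<longrightarrow> Q \<in> W) \<and>
    (\<forall>A E B i p. A \<in> W \<longrightarrow> B \<in> W \<longrightarrow> short_exact D H A E B i p \<longrightarrow> E \<in> W)}"


section \<open>The Grothendieck group\<close>

definition K0_relations :: "('o, 'm) tcat \<Rightarrow> ('o \<Rightarrow>\<^sub>0 int) set"
  where "K0_relations D = generate (free_Abelian_group UNIV)
    {frag_of Y - frag_of X - frag_of Z | X Y Z f g h. tri D X Y Z f g h}"

definition K0 :: "('o, 'm) tcat \<Rightarrow> ('o \<Rightarrow>\<^sub>0 int) set monoid"
  where "K0 D = free_Abelian_group UNIV Mod K0_relations D"

definition K0_class :: "('o, 'm) tcat \<Rightarrow> 'o \<Rightarrow> ('o \<Rightarrow>\<^sub>0 int) set"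
  where "K0_class D X = K0_relations D #>\<^bsub>free_Abelian_group UNIV\<^esub> frag_of X"

definition additive_group :: "'l::ab_group_add monoid"
  where "additive_group = \<lparr>carrier = UNIV, monoid.mult = (+), one = 0\<rparr>"

definition free_of_finite_rank :: "'l::ab_group_add itself \<Rightarrow> bool"
  where "free_of_finite_rank _ \<longleftrightarrow>
    (\<exists>B::'l set. finite B \<and> free_Abelian_group B \<cong> (additive_group :: 'l monoid))"


section \<open>Extension of scalars to the reals\<close>

text \<open>
  For an abelian group \<open>\<Lambda>\<close> (a type \<^typ>\<open>'l\<close>), the type \<open>'l realification\<close> is \<open>\<Lambda> \<otimes> \<real>\<close>: the free
  abelian group on pairs \<open>(x, r)\<close> modulo biadditivity, with \<open>a \<cdot> (x \<otimes> r) = x \<otimes> (a r)\<close>.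
\<close>

definition tensor_relations :: "('l::ab_group_add \<times> real \<Rightarrow>\<^sub>0 int) set"
  where "tensor_relations = generate (free_Abelian_group UNIV)
    ({frag_of (x + y, r) - frag_of (x, r) - frag_of (y, r) | x y r. True} \<union>
     {frag_of (x, r + s) - frag_of (x, r) - frag_of (x, s) | x r s. True})"

definition tensor_eq :: "('l::ab_group_add \<times> real \<Rightarrow>\<^sub>0 int) \<Rightarrow> ('l \<times> real \<Rightarrow>\<^sub>0 int) \<Rightarrow> bool"
  where "tensor_eq p q \<longleftrightarrow> p - q \<in> tensor_relations"

lemma tensor_relations_zero: "0 \<in> tensor_relations"
  using generate.one[of "free_Abelian_group UNIV"] by (simp add: tensor_relations_def)

lemma tensor_relations_add:
  "p \<in> tensor_relations \<Longrightarrow> q \<in> tensor_relations \<Longrightarrow> p + q \<in> tensor_relations"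
  using generate.eng[of p "free_Abelian_group UNIV"] by (simp add: tensor_relations_def)

lemma tensor_relations_minus: "p \<in> tensor_relations \<Longrightarrow> - p \<in> tensor_relations"
  using group.generate_m_inv_closed[OF group_free_Abelian_group[of UNIV]]
  by (fastforce simp: tensor_relations_def)

lemma tensor_relations_diff:
  "p \<in> tensor_relations \<Longrightarrow> q \<in> tensor_relations \<Longrightarrow> p - q \<in> tensor_relations"
  using tensor_relations_add tensor_relations_minus by fastforce

lemma tensor_relations_left: "frag_of (x + y, r) - frag_of (x, r) - frag_of (y, r) \<in> tensor_relations"
  unfolding tensor_relations_def by (rule generate.incl) blast

lemma tensor_relations_right: "frag_of (x, r + s) - frag_of (x, r) - frag_of (x, s) \<in> tensor_relations"
  unfolding tensor_relations_def by (rule generate.incl) blast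

lemma equivp_tensor_eq: "equivp tensor_eq"
proof (rule equivpI)
  show "reflp tensor_eq"
    by (simp add: reflp_def tensor_eq_def tensor_relations_zero)
  show "symp tensor_eq"
    unfolding symp_def tensor_eq_def using tensor_relations_minus by fastforce
  show "transp tensor_eq"
    unfolding transp_def tensor_eq_def
  proof (intro allI impI, goal_cases)
    case (1 p q r)
    from tensor_relations_add[OF this] show ?case by simp
  qed
qed

quotient_type (overloaded) 'l realification = "'l::ab_group_add \<times> real \<Rightarrow>\<^sub>0 int" / tensor_eq
  by (rule equivp_tensor_eq)

definition frag_scale :: "real \<Rightarrow> ('l \<times> real \<Rightarrow>\<^sub>0 int) \<Rightarrow> ('l \<times> real \<Rightarrow>\<^sub>0 int)"
  where "frag_scale a = frag_extend (\<lambda>(x, r). frag_of (x, a * r))"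

lemma frag_scale_relations:
  assumes "p \<in> tensor_relations"
  shows "frag_scale a p \<in> tensor_relations"
proof -
  let ?G = "{frag_of (x + y, r) - frag_of (x, r) - frag_of (y, r) | x y r. True} \<union>
    {frag_of (x, r + s) - frag_of (x, r) - frag_of (x, s) | x r s. True}"
  have gen: "frag_scale a q \<in> tensor_relations" if "q \<in> ?G" for q :: "'a \<times> real \<Rightarrow>\<^sub>0 int"
    using that
    by (auto simp: frag_scale_def frag_extend_diff distrib_left
        intro: tensor_relations_left tensor_relations_right)
  have "p \<in> generate (free_Abelian_group UNIV) ?G"
    using assms by (simp only: tensor_relations_def)
  then show ?thesis
  proof (induction rule: generate.induct)
    case one
    then show ?case by (simp add: frag_scale_def tensor_relations_zero)
  next
    case (incl q)
    then show ?case by (rule gen)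
  next
    case (inv q)
    then show ?case
      using tensor_relations_minus[OF gen[OF inv]] by (simp add: frag_scale_def frag_extend_minus)
  next
    case (eng p q)
    then show ?case
      using tensor_relations_add by (fastforce simp: frag_scale_def frag_extend_add)
  qed
qed

lemma frag_scale_diff: "frag_scale a (p - q) = frag_scale a p - frag_scale a q"
  by (simp add: frag_scale_def frag_extend_diff)

lemma frag_scale_add: "frag_scale a (p + q) = frag_scale a p + frag_scale a q"
  by (simp add: frag_scale_def frag_extend_add)

lemma frag_scale_scale: "frag_scale a (frag_scale b p) = frag_scale (a * b) p"
  by (rule frag_induction[of p UNIV]) (auto simp: frag_scale_def frag_extend_diff mult.assoc)

lemma frag_scale_one: "frag_scale 1 p = p"
  by (rule frag_induction[of p UNIV]) (auto simp: frag_scale_def frag_extend_diff)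

lemma frag_scale_left: "frag_scale (a + b) p - (frag_scale a p + frag_scale b p) \<in> tensor_relations"
proof (rule frag_induction[of p UNIV])
  fix q r :: "'a \<times> real \<Rightarrow>\<^sub>0 int"
  assume "frag_scale (a + b) q - (frag_scale a q + frag_scale b q) \<in> tensor_relations"
    and "frag_scale (a + b) r - (frag_scale a r + frag_scale b r) \<in> tensor_relations"
  from tensor_relations_diff[OF this]
  show "frag_scale (a + b) (q - r) - (frag_scale a (q - r) + frag_scale b (q - r)) \<in> tensor_relations"
    by (simp add: frag_scale_diff algebra_simps)
next
  fix x :: "'a \<times> real"
  show "frag_scale (a + b) (frag_of x) - (frag_scale a (frag_of x) + frag_scale b (frag_of x))
    \<in> tensor_relations"
    using tensor_relations_right[of "fst x" "a * snd x" "b * snd x"]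
    by (cases x) (simp add: frag_scale_def diff_diff_eq distrib_right)
qed (auto simp: frag_scale_def tensor_relations_zero)

instantiation realification :: (ab_group_add) real_vector
begin

lift_definition zero_realification :: "'a realification" is 0 .

lift_definition plus_realification :: "'a realification \<Rightarrow> 'a realification \<Rightarrow> 'a realification" is "(+)"
  unfolding tensor_eq_def by (drule (1) tensor_relations_add) (simp add: algebra_simps)

lift_definition uminus_realification :: "'a realification \<Rightarrow> 'a realification" is uminus
  unfolding tensor_eq_def by (drule tensor_relations_minus) (simp add: algebra_simps)

lift_definition minus_realification :: "'a realification \<Rightarrow> 'a realification \<Rightarrow> 'a realification" is "(-)"
  unfolding tensor_eq_def by (drule (1) tensor_relations_diff) (simp add: algebra_simps)

lift_definition scaleR_realification :: "real \<Rightarrow> 'a realification \<Rightarrow> 'a realification" is frag_scale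
  unfolding tensor_eq_def by (drule frag_scale_relations) (simp add: frag_scale_diff)

instance
proof
  fix x y z :: "'a realification" and a b :: real
  show "x + y + z = x + (y + z)" "x + y = y + x" "0 + x = x" "- x + x = 0" "x - y = x + - y"
    by (transfer; simp add: tensor_eq_def tensor_relations_zero algebra_simps)+
  show "a *\<^sub>R (x + y) = a *\<^sub>R x + a *\<^sub>R y"
    by transfer (simp add: tensor_eq_def frag_scale_add tensor_relations_zero)
  show "(a + b) *\<^sub>R x = a *\<^sub>R x + b *\<^sub>R x"
    by transfer (simp add: tensor_eq_def frag_scale_left)
  show "a *\<^sub>R b *\<^sub>R x = (a * b) *\<^sub>R x"
    by transfer (simp add: tensor_eq_def frag_scale_scale tensor_relations_zero)
  show "1 *\<^sub>R x = x"
    by transfer (simp add: tensor_eq_def frag_scale_one tensor_relations_zero)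
qed

end

lift_definition tensor :: "'l::ab_group_add \<Rightarrow> real \<Rightarrow> 'l realification" is "\<lambda>x r. frag_of (x, r)" .


section \<open>The heart fan and the thick label map\<close>

text \<open>
  \<open>lam\<close> is the homomorphism \<open>K(D) \<rightarrow> \<Lambda>\<close>, and elements of \<open>\<Lambda>\<^sub>\<real>\<^sup>* = Hom(\<Lambda>, \<real>)\<close> are additive
  functions from \<^typ>\<open>'l\<close> to \<^typ>\<open>real\<close>.
\<close>

definition heart_cone ::
    "('o, 'm) tcat \<Rightarrow> (('o \<Rightarrow>\<^sub>0 int) set \<Rightarrow> 'l::ab_group_add) \<Rightarrow> 'o set \<Rightarrow> ('l \<Rightarrow> real) set"
  where "heart_cone D lam K = {v. additive v \<and> (\<forall>k \<in> K. v (lam (K0_class D k)) \<ge> 0)}"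

text \<open>The faces of the cones add nothing to the support of the fan.\<close>

definition heart_fan_support ::
    "('o, 'm) tcat \<Rightarrow> (('o \<Rightarrow>\<^sub>0 int) set \<Rightarrow> 'l::ab_group_add) \<Rightarrow> 'o set \<Rightarrow> ('l \<Rightarrow> real) set"
  where "heart_fan_support D lam H = (\<Union>K \<in> intermediate_hearts D H. heart_cone D lam K)"

definition heart_ker ::
    "('o, 'm) tcat \<Rightarrow> (('o \<Rightarrow>\<^sub>0 int) set \<Rightarrow> 'l::ab_group_add) \<Rightarrow> 'o set \<Rightarrow> ('l \<Rightarrow> real) \<Rightarrow> 'o set"
  where "heart_ker D lam K v = {k \<in> K. v (lam (K0_class D k)) = 0}"

text \<open>Well defined on the support: the value does not depend on the chosen heart.\<close>

definition thick_label ::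
    "('o, 'm) tcat \<Rightarrow> (('o \<Rightarrow>\<^sub>0 int) set \<Rightarrow> 'l::ab_group_add) \<Rightarrow> 'o set \<Rightarrow> ('l \<Rightarrow> real) \<Rightarrow> 'o set"
  where "thick_label D lam H v =
    thick D (heart_ker D lam (SOME K. K \<in> intermediate_hearts D H \<and> v \<in> heart_cone D lam K) v)"


section \<open>Stability functions and the phase diagram\<close>

definition central_charge ::
    "('o, 'm) tcat \<Rightarrow> (('o \<Rightarrow>\<^sub>0 int) set \<Rightarrow> 'l::ab_group_add) \<Rightarrow> ('l realification \<Rightarrow> complex) \<Rightarrow> 'o \<Rightarrow> complex"
  where "central_charge D lam Z h = Z (tensor (lam (K0_class D h)) 1)"

definition stability_function ::
    "('o, 'm) tcat \<Rightarrow> (('o \<Rightarrow>\<^sub>0 int) set \<Rightarrow> 'l::ab_group_add) \<Rightarrow> 'o set \<Rightarrow> ('l realification \<Rightarrow> complex) \<Rightarrow> bool"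
  where "stability_function D lam H Z \<longleftrightarrow> linear Z \<and>
    (\<forall>h \<in> H. \<not> zero_object D h \<longrightarrow>
      (\<exists>m \<phi>. m > 0 \<and> \<phi> \<in> {0<..1} \<and> central_charge D lam Z h = of_real m * cis (pi * \<phi>)))"

definition phase ::
    "('o, 'm) tcat \<Rightarrow> (('o \<Rightarrow>\<^sub>0 int) set \<Rightarrow> 'l::ab_group_add) \<Rightarrow> ('l realification \<Rightarrow> complex) \<Rightarrow> 'o \<Rightarrow> real"
  where "phase D lam Z h =
    (THE \<phi>. \<phi> \<in> {0<..1} \<and> (\<exists>m>0. central_charge D lam Z h = of_real m * cis (pi * \<phi>)))"

definition semistable ::
    "('o, 'm) tcat \<Rightarrow> (('o \<Rightarrow>\<^sub>0 int) set \<Rightarrow> 'l::ab_group_add) \<Rightarrow> 'o set \<Rightarrow> ('l realification \<Rightarrow> complex) \<Rightarrow> 'o \<Rightarrow> bool"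
  where "semistable D lam H Z h \<longleftrightarrow> h \<in> H \<and> \<not> zero_object D h \<and>
    (\<forall>h' i. is_mono D H h' h i \<longrightarrow> \<not> zero_object D h' \<longrightarrow> phase D lam Z h' \<le> phase D lam Z h)"

definition slice ::
    "('o, 'm) tcat \<Rightarrow> (('o \<Rightarrow>\<^sub>0 int) set \<Rightarrow> 'l::ab_group_add) \<Rightarrow> 'o set \<Rightarrow> ('l realification \<Rightarrow> complex) \<Rightarrow> real \<Rightarrow> 'o set"
  where "slice D lam H Z \<phi> =
    {h \<in> H. zero_object D h \<or> semistable D lam H Z h \<and> phase D lam Z h = \<phi>}"

text \<open>
  In the filtration \<open>0 = h\<^sub>0 \<hookrightarrow> \<dots> \<hookrightarrow> h\<^sub>n = h\<close> the quotient of the step \<open>h\<^sub>k \<hookrightarrow> h\<^sub>k\<^sub>+\<^sub>1\<close>, for \<open>k < n\<close>, is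
  \<open>qs k\<close>, of phase \<open>\<phi> k\<close>.
\<close>

definition HN_property ::
    "('o, 'm) tcat \<Rightarrow> (('o \<Rightarrow>\<^sub>0 int) set \<Rightarrow> 'l::ab_group_add) \<Rightarrow> 'o set \<Rightarrow> ('l realification \<Rightarrow> complex) \<Rightarrow> bool"
  where "HN_property D lam H Z \<longleftrightarrow> (\<forall>h \<in> H. \<exists>(n::nat) hs is qs ps \<phi>.
    zero_object D (hs 0) \<and> hs n = h \<and> (\<forall>k\<le>n. hs k \<in> H) \<and>
    (\<forall>k<n. is_mono D H (hs k) (hs (Suc k)) (is k) \<and>
           is_cokernel D H (hs k) (hs (Suc k)) (is k) (qs k) (ps k) \<and>
           \<not> zero_object D (qs k) \<and> qs k \<in> slice D lam H Z (\<phi> k)) \<and>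
    (\<forall>j k. j < k \<longrightarrow> k < n \<longrightarrow> \<phi> j > \<phi> k))"

definition upper_dual :: "(complex \<Rightarrow> real) set"
  where "upper_dual = {w. linear w \<and>
    (\<exists>\<phi> \<in> {0<..1}. w (cis (pi * \<phi>)) = 0 \<and> w (\<i> * cis (pi * \<phi>)) > 0)}"

definition theta :: "(complex \<Rightarrow> real) \<Rightarrow> real"
  where "theta w = (THE \<phi>. \<phi> \<in> {0<..1} \<and> w (cis (pi * \<phi>)) = 0)"

definition phase_diagram ::
    "('o, 'm) tcat \<Rightarrow> (('o \<Rightarrow>\<^sub>0 int) set \<Rightarrow> 'l::ab_group_add) \<Rightarrow> 'o set \<Rightarrow> ('l realification \<Rightarrow> complex) \<Rightarrow> (complex \<Rightarrow> real) \<Rightarrow> 'o set"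
  where "phase_diagram D lam H Z w = slice D lam H Z (theta w)"

text \<open>
  The dual \<open>w \<mapsto> w \<circ> Z\<close> of \<open>Z\<close>, where a linear functional on \<open>\<Lambda> \<otimes> \<real>\<close> is identified with its
  restriction along \<open>x \<mapsto> x \<otimes> 1\<close>, an element of \<open>Hom(\<Lambda>, \<real>)\<close>.
\<close>

definition dual_map :: "('l::ab_group_add realification \<Rightarrow> complex) \<Rightarrow> (complex \<Rightarrow> real) \<Rightarrow> 'l \<Rightarrow> real"
  where "dual_map Z w = (\<lambda>x. w (Z (tensor x 1)))"

end

theory Submission
  imports Defs
begin

text \<open>
  Let \<open>\<theta> = theta w\<close>.  Up to a positive factor, \<open>w \<circ> Z\<close> is the function \<open>height \<theta> = Im (e\<^sup>-\<^sup>i\<^sup>\<pi>\<^sup>\<theta> Z)\<close>,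
  whose sign on a nonzero object of \<open>H\<close> compares its phase with \<open>\<theta>\<close>.  Hence \<open>P(\<theta>)\<close> consists of the
  objects of height \<open>0\<close> all of whose subobjects have height \<open>\<le> 0\<close>.  Tilting \<open>H\<close> at the torsion pair
  cut out of the Harder--Narasimhan filtrations at phase \<open>\<theta>\<close> gives an intermediate heart on which
  \<open>w \<circ> Z\<close> is nonnegative, so \<open>w \<circ> Z\<close> lies in the support of the heart fan.

  For an arbitrary intermediate heart \<open>K\<close> with \<open>w \<circ> Z \<ge> 0\<close>, objects of \<open>K\<close> are extensions of objects
  of \<open>H \<inter> K\<close> by objects of \<open>H[1] \<inter> K\<close>, and objects of \<open>H\<close> are extensions of objects of
  \<open>H \<inter> K[-1]\<close> by objects of \<open>H \<inter> K\<close>.  By positivity this shows that \<open>P(\<theta>)\<close> and the kernel of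
  \<open>w \<circ> Z\<close> on \<open>K\<close> generate the same thick subcategory.  Finally a wide subcategory \<open>W\<close> of \<open>H\<close> satisfies
  \<open>thick W \<inter> H = W\<close>, because the objects of \<open>D\<close> with all cohomology in \<open>W\<close> form a thick subcategory.
\<close>

section \<open>Morphism groups\<close>

text \<open>The shift is only an autoequivalence, so a negative shift of an object exists only up to
  isomorphism, and a triangle can be rotated backwards only after its third vertex has been replaced
  by a shift. For this reason vertices are freely exchanged for isomorphic ones, maps of triangles
  are often left existential, and statements about \<open>S[n]\<close> are proved for one n and
  transported to the others.

  Kernels, cokernels and images in the heart come from truncated cones, and short exact sequences
  are triangles with vertices in H. Phases are traded for real functions that are additive on
  triangles; wideness and the comparison with K are proved for any such function.

  The obstacle in computing the thick closure of W is closure under extensions: an extension can put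
  the cohomological layers in the wrong order. Layers more than one degree apart commute because the
  connecting map vanishes. Neighbouring layers are joined by a morphism of W, whose kernel and
  cokernel lie again in W; this is where wideness enters.\<close>

context additive_category
begin

abbreviation neg :: "'o \<Rightarrow> 'o \<Rightarrow> 'm \<Rightarrow> 'm"
  where "neg X Y f \<equiv> inv\<^bsub>Mor_group D X Y\<^esub> f"

abbreviation orthogonal :: "'o \<Rightarrow> 'o \<Rightarrow> bool"
  where "orthogonal X Y \<equiv> Mor D X Y = {mzero D X Y}"

lemma Mor_group_sel [simp]:
  "carrier (Mor_group D X Y) = Mor D X Y" "monoid.mult (Mor_group D X Y) = madd D"
  "one (Mor_group D X Y) = mzero D X Y"
  by (auto simp: Mor_group_def)

lemma Mor_group_group: "group (Mor_group D X Y)"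
  using Mor_comm_group comm_group.axioms(2) by blast

lemma mzero_in [simp, intro]: "mzero D X Y \<in> Mor D X Y"
  using monoid.one_closed[OF group.is_monoid[OF Mor_group_group]] by simp

lemma neg_in [simp, intro]: "f \<in> Mor D X Y \<Longrightarrow> neg X Y f \<in> Mor D X Y"
  using group.inv_closed[OF Mor_group_group, of f X Y] by simp

lemma madd_in [simp, intro]: "f \<in> Mor D X Y \<Longrightarrow> g \<in> Mor D X Y \<Longrightarrow> madd D f g \<in> Mor D X Y"
  using monoid.m_closed[OF group.is_monoid[OF Mor_group_group], of f X Y g] by simp

lemma madd_zero [simp]:
  "f \<in> Mor D X Y \<Longrightarrow> madd D f (mzero D X Y) = f"
  "f \<in> Mor D X Y \<Longrightarrow> madd D (mzero D X Y) f = f"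
  using monoid.r_one[OF group.is_monoid[OF Mor_group_group], of f X Y]
    monoid.l_one[OF group.is_monoid[OF Mor_group_group], of f X Y] by auto

lemma madd_neg [simp]:
  "f \<in> Mor D X Y \<Longrightarrow> madd D f (neg X Y f) = mzero D X Y"
  "f \<in> Mor D X Y \<Longrightarrow> madd D (neg X Y f) f = mzero D X Y"
  using group.r_inv[OF Mor_group_group, of f X Y] group.l_inv[OF Mor_group_group, of f X Y] by auto

lemma neg_neg [simp]: "f \<in> Mor D X Y \<Longrightarrow> neg X Y (neg X Y f) = f"
  using group.inv_inv[OF Mor_group_group, of f X Y] by simp

lemma neg_mzero [simp]: "neg X Y (mzero D X Y) = mzero D X Y"
  using monoid.inv_one[OF group.is_monoid[OF Mor_group_group], of X Y] by simp

lemma neg_unique: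
  assumes "f \<in> Mor D X Y" "g \<in> Mor D X Y" "madd D g f = mzero D X Y"
  shows "neg X Y f = g"
  by (rule group.inv_equality[OF Mor_group_group]) (use assms in auto)

lemma madd_neg_eq_mzero:
  assumes "f \<in> Mor D X Y" "g \<in> Mor D X Y" "madd D f (neg X Y g) = mzero D X Y"
  shows "f = g"
  using neg_unique[OF neg_in[OF assms(2)] assms(1,3)] assms by simp

text \<open>The only idempotent of a group is its unit. By biadditivity this yields the absorption
  laws for zero morphisms and the value of the shift on them.\<close>

lemma mzero_unique:
  assumes "f \<in> Mor D X Y" "madd D f f = f"
  shows "f = mzero D X Y"
proof -
  interpret group "Mor_group D X Y" by (rule Mor_group_group)
  show ?thesis using l_cancel_one[of f f] assms by simp
qed

lemma cmp_mzero [simp]: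
  assumes "g \<in> Mor D Y Z" shows "g \<cdot> mzero D X Y = mzero D X Z"
proof (rule mzero_unique)
  show "g \<cdot> mzero D X Y \<in> Mor D X Z" using assms by (blast intro: cmp_in)
  show "madd D (g \<cdot> mzero D X Y) (g \<cdot> mzero D X Y) = g \<cdot> mzero D X Y"
    using cmp_madd[of "mzero D X Y" X Y "mzero D X Y" g Z] assms by simp
qed

lemma mzero_cmp [simp]:
  assumes "f \<in> Mor D X Y" shows "mzero D Y Z \<cdot> f = mzero D X Z"
proof (rule mzero_unique)
  show "mzero D Y Z \<cdot> f \<in> Mor D X Z" using assms by (blast intro: cmp_in)
  show "madd D (mzero D Y Z \<cdot> f) (mzero D Y Z \<cdot> f) = mzero D Y Z \<cdot> f"
    using madd_cmp[of f X Y "mzero D Y Z" Z "mzero D Y Z"] assms by simp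
qed

lemma cmp_neg:
  assumes "f \<in> Mor D X Y" "g \<in> Mor D Y Z" shows "g \<cdot> neg X Y f = neg X Z (g \<cdot> f)"
  using cmp_madd[of "neg X Y f" X Y f g Z] assms by (intro neg_unique[symmetric] cmp_in) (auto intro: cmp_in)

lemma neg_cmp:
  assumes "f \<in> Mor D X Y" "g \<in> Mor D Y Z" shows "neg Y Z g \<cdot> f = neg X Z (g \<cdot> f)"
  using madd_cmp[of f X Y "neg Y Z g" Z g] assms by (intro neg_unique[symmetric] cmp_in) (auto intro: cmp_in)

lemma orthogonalI: "(\<And>f. f \<in> Mor D X Y \<Longrightarrow> f = mzero D X Y) \<Longrightarrow> orthogonal X Y"
  by auto

lemma zero_object_iff: "zero_object D X \<longleftrightarrow> idm D X = mzero D X X"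
proof
  assume "zero_object D X" then show "idm D X = mzero D X X"
    using idm_in[of X] by (auto simp: zero_object_def)
next
  assume *: "idm D X = mzero D X X"
  show "zero_object D X"
    unfolding zero_object_def
  proof (intro allI conjI orthogonalI)
    fix Y f assume "f \<in> Mor D X Y" then show "f = mzero D X Y" using cmp_idm[of f X Y] * by simp
  next
    fix Y f assume "f \<in> Mor D Y X" then show "f = mzero D Y X" using idm_cmp[of f Y X] * by simp
  qed
qed

lemma zero_objectD:
  assumes "zero_object D X"
  shows "f \<in> Mor D X Y \<Longrightarrow> f = mzero D X Y" "f \<in> Mor D Y X \<Longrightarrow> f = mzero D Y X"
  using assms by (auto simp: zero_object_def)

section \<open>Isomorphisms and retracts\<close>

lemma is_isomI:
  "f \<in> Mor D X Y \<Longrightarrow> g \<in> Mor D Y X \<Longrightarrow> g \<cdot> f = idm D X \<Longrightarrow> f \<cdot> g = idm D Y \<Longrightarrow> is_isom D X Y f"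
  by (auto simp: is_isom_def iso_pair_def)

lemma is_isomE:
  assumes "is_isom D X Y f"
  obtains g where "f \<in> Mor D X Y" "g \<in> Mor D Y X" "g \<cdot> f = idm D X" "f \<cdot> g = idm D Y"
  using assms by (auto simp: is_isom_def iso_pair_def)

lemma is_isom_idm: "is_isom D X X (idm D X)"
  using cmp_idm[OF idm_in] by (intro is_isomI[of _ _ _ "idm D X"]) (simp_all add: idm_in)

lemma is_isom_neg_idm: "is_isom D X X (neg X X (idm D X))"
  using idm_in[of X] cmp_idm[OF idm_in, of X] idm_cmp[OF neg_in[OF idm_in], of X]
    neg_cmp[OF neg_in[OF idm_in] idm_in, of X]
  by (intro is_isomI[of _ _ _ "neg X X (idm D X)"]) simp_all

text \<open>Summands in the sense of \<open>biproduct\<close> are retracts. A retract needs no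
  complement, so it passes through orthogonality, truncation and shifts without one being
  constructed.\<close>

definition retract :: "'o \<Rightarrow> 'o \<Rightarrow> bool"
  where "retract X Y \<longleftrightarrow> (\<exists>i\<in>Mor D X Y. \<exists>p\<in>Mor D Y X. p \<cdot> i = idm D X)"

lemma isomorphic_refl [simp]: "isomorphic D X X"
  using is_isom_idm by (auto simp: isomorphic_def)

lemma isomorphic_sym: "isomorphic D X Y \<Longrightarrow> isomorphic D Y X"
  by (auto simp: isomorphic_def is_isom_def iso_pair_def)

lemma sandwich_idm:
  assumes "f \<in> Mor D X Y" "g \<in> Mor D Y X" "a \<in> Mor D Y Z" "b \<in> Mor D Z Y"
    "g \<cdot> f = idm D X" "b \<cdot> a = idm D Y"
  shows "(g \<cdot> b) \<cdot> (a \<cdot> f) = idm D X"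
proof -
  have "(g \<cdot> b) \<cdot> (a \<cdot> f) = g \<cdot> ((b \<cdot> a) \<cdot> f)"
    using cmp_assoc[OF cmp_in[OF assms(1,3)] assms(4,2)] cmp_assoc[OF assms(1,3,4)] by simp
  then show ?thesis using assms by (simp add: idm_cmp)
qed

lemma isomorphic_trans:
  assumes "isomorphic D X Y" "isomorphic D Y Z" shows "isomorphic D X Z"
proof -
  obtain f g where f: "f \<in> Mor D X Y" "g \<in> Mor D Y X" "g \<cdot> f = idm D X" "f \<cdot> g = idm D Y"
    using assms(1) by (auto simp: isomorphic_def elim: is_isomE)
  obtain a b where a: "a \<in> Mor D Y Z" "b \<in> Mor D Z Y" "b \<cdot> a = idm D Y" "a \<cdot> b = idm D Z"
    using assms(2) by (auto simp: isomorphic_def elim: is_isomE)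
  have "is_isom D X Z (a \<cdot> f)"
    by (rule is_isomI[of _ _ _ "g \<cdot> b"]) (use f a in \<open>auto intro: cmp_in sandwich_idm\<close>)
  then show ?thesis by (auto simp: isomorphic_def)
qed

lemma isomorphic_retract: "isomorphic D X Y \<Longrightarrow> retract X Y"
  by (auto simp: isomorphic_def retract_def is_isom_def iso_pair_def)

lemma biproduct_retract: "biproduct D X Y S \<Longrightarrow> retract X S"
  by (auto simp: biproduct_def retract_def)

text \<open>Inserting the identity p i factors any morphism into or out of X through a morphism into
  or out of Y.\<close>

lemma retract_orthogonal:
  assumes "retract X Y"
  shows "orthogonal T Y \<Longrightarrow> orthogonal T X" "orthogonal Y T \<Longrightarrow> orthogonal X T"
proof -
  obtain i p where ip: "i \<in> Mor D X Y" "p \<in> Mor D Y X" "p \<cdot> i = idm D X"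
    using assms by (auto simp: retract_def)
  show "orthogonal T X" if "orthogonal T Y"
  proof (rule orthogonalI)
    fix f assume f: "f \<in> Mor D T X"
    have "f = p \<cdot> (i \<cdot> f)" using cmp_assoc[OF f ip(1,2)] idm_cmp[OF f] ip(3) by simp
    also have "i \<cdot> f = mzero D T Y" using that cmp_in[OF f ip(1)] by simp
    finally show "f = mzero D T X" using ip by simp
  qed
  show "orthogonal X T" if "orthogonal Y T"
  proof (rule orthogonalI)
    fix f assume f: "f \<in> Mor D X T"
    have "f = (f \<cdot> p) \<cdot> i" using cmp_assoc[OF ip(1,2) f] cmp_idm[OF f] ip(3) by simp
    also have "f \<cdot> p = mzero D Y T" using that cmp_in[OF ip(2) f] by simp
    finally show "f = mzero D X T" using ip by simp
  qed
qed

lemma isomorphic_orthogonal: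
  "isomorphic D X Y \<Longrightarrow> orthogonal T Y \<Longrightarrow> orthogonal T X"
  "isomorphic D X Y \<Longrightarrow> orthogonal Y T \<Longrightarrow> orthogonal X T"
  by (fact retract_orthogonal[OF isomorphic_retract])+

lemma orthogonal_self: "orthogonal X X \<Longrightarrow> zero_object D X"
  using idm_in[of X] by (auto simp: zero_object_iff)

lemma zero_object_retract:
  assumes "zero_object D Y" "retract X Y" shows "zero_object D X"
proof (rule orthogonal_self)
  have "orthogonal X Y" using assms(1) by (simp add: zero_object_def)
  then show "orthogonal X X" by (rule retract_orthogonal(1)[OF assms(2)])
qed

lemma zero_object_isomorphic: "zero_object D Y \<Longrightarrow> isomorphic D X Y \<Longrightarrow> zero_object D X"
  by (rule zero_object_retract[OF _ isomorphic_retract])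

lemma zero_objects_isomorphic:
  assumes "zero_object D X" "zero_object D Y" shows "isomorphic D X Y"
proof -
  have "is_isom D X Y (mzero D X Y)"
    by (rule is_isomI[of _ _ _ "mzero D Y X"]) (use assms in \<open>auto simp: zero_object_iff\<close>)
  then show ?thesis by (auto simp: isomorphic_def)
qed

end

section \<open>Distinguished triangles\<close>

context triangulated_category
begin

lemma shm_in [simp, intro]: "f \<in> Mor D X Y \<Longrightarrow> shm D f \<in> Mor D (sh D X) (sh D Y)"
  using shm_fully_faithful[of X Y] by (auto simp: bij_betw_def)

lemma shm_inj: "f \<in> Mor D X Y \<Longrightarrow> g \<in> Mor D X Y \<Longrightarrow> shm D f = shm D g \<Longrightarrow> f = g"
  using shm_fully_faithful[of X Y] by (auto simp: bij_betw_def dest: inj_onD)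

lemma shm_full:
  assumes "g \<in> Mor D (sh D X) (sh D Y)"
  obtains f where "f \<in> Mor D X Y" "g = shm D f"
proof -
  have "g \<in> shm D ` Mor D X Y" using assms shm_fully_faithful[of X Y] by (simp add: bij_betw_def)
  then show thesis using that by auto
qed

lemma shm_mzero [simp]: "shm D (mzero D X Y) = mzero D (sh D X) (sh D Y)"
proof (rule mzero_unique)
  show "madd D (shm D (mzero D X Y)) (shm D (mzero D X Y)) = shm D (mzero D X Y)"
    using shm_madd[of "mzero D X Y" X Y "mzero D X Y"] by simp
qed simp

lemma shm_neg: "f \<in> Mor D X Y \<Longrightarrow> shm D (neg X Y f) = neg (sh D X) (sh D Y) (shm D f)"
  using shm_madd[of "neg X Y f" X Y f] by (intro neg_unique[symmetric]) simp_all

lemma shm_eq_mzero: "f \<in> Mor D X Y \<Longrightarrow> shm D f = mzero D (sh D X) (sh D Y) \<Longrightarrow> f = mzero D X Y"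
  by (rule shm_inj[of _ X Y]) simp_all

lemma sh_zero_object [simp]: "zero_object D (sh D X) \<longleftrightarrow> zero_object D X"
  using shm_inj[OF idm_in mzero_in, of X] by (auto simp: zero_object_iff simp flip: shm_idm shm_mzero)

lemma sh_orthogonal: "orthogonal (sh D X) (sh D Y) \<longleftrightarrow> orthogonal X Y"
proof
  assume *: "orthogonal (sh D X) (sh D Y)"
  show "orthogonal X Y"
  proof (rule orthogonalI)
    fix f assume f: "f \<in> Mor D X Y"
    from shm_in[OF this] have "shm D f = mzero D (sh D X) (sh D Y)" using * by simp
    then show "f = mzero D X Y" by (rule shm_eq_mzero[OF f])
  qed
next
  assume *: "orthogonal X Y"
  show "orthogonal (sh D X) (sh D Y)"
    by (rule orthogonalI, erule shm_full) (use * in simp)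
qed

lemma sh_isomorphic: "isomorphic D (sh D X) (sh D Y) \<longleftrightarrow> isomorphic D X Y"
proof
  assume "isomorphic D (sh D X) (sh D Y)"
  then obtain f' g' where f': "f' \<in> Mor D (sh D X) (sh D Y)" "g' \<in> Mor D (sh D Y) (sh D X)"
    "g' \<cdot> f' = idm D (sh D X)" "f' \<cdot> g' = idm D (sh D Y)"
    by (auto simp: isomorphic_def elim: is_isomE)
  obtain f where f: "f \<in> Mor D X Y" "f' = shm D f" using f'(1) by (rule shm_full)
  obtain g where g: "g \<in> Mor D Y X" "g' = shm D g" using f'(2) by (rule shm_full)
  have "g \<cdot> f = idm D X"
    by (rule shm_inj[OF cmp_in[OF f(1) g(1)] idm_in]) (use f' f(2) g(2) shm_cmp[OF f(1) g(1)] in \<open>simp add: shm_idm\<close>)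
  moreover have "f \<cdot> g = idm D Y"
    by (rule shm_inj[OF cmp_in[OF g(1) f(1)] idm_in]) (use f' f(2) g(2) shm_cmp[OF g(1) f(1)] in \<open>simp add: shm_idm\<close>)
  ultimately show "isomorphic D X Y"
    using f g by (auto simp: isomorphic_def intro: is_isomI)
next
  assume "isomorphic D X Y"
  then obtain f g where f: "f \<in> Mor D X Y" "g \<in> Mor D Y X" "g \<cdot> f = idm D X" "f \<cdot> g = idm D Y"
    by (auto simp: isomorphic_def elim: is_isomE)
  have "is_isom D (sh D X) (sh D Y) (shm D f)"
    by (rule is_isomI[of _ _ _ "shm D g"])
      (use f in \<open>simp_all add: shm_idm flip: shm_cmp[OF f(1,2)] shm_cmp[OF f(2,1)]\<close>)
  then show "isomorphic D (sh D X) (sh D Y)" by (auto simp: isomorphic_def)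
qed

lemmas tri_in =
  tri_Mor[THEN conjunct1] tri_Mor[THEN conjunct2, THEN conjunct1] tri_Mor[THEN conjunct2, THEN conjunct2]

lemma tri_rotate:
  "tri D X Y Z f g h \<Longrightarrow> tri D Y Z (sh D X) g h (neg (sh D X) (sh D Y) (shm D f))"
  using tri_Mor[of X Y Z f g h] TR2[of f X Y g Z h] by blast

lemma tri_rotate_back:
  assumes "f \<in> Mor D X Y" "tri D Y Z (sh D X) g h (neg (sh D X) (sh D Y) (shm D f))"
  shows "tri D X Y Z f g h"
  using tri_Mor[OF assms(2)] TR2[of f X Y g Z h] assms by blast

text \<open>This is \<open>TR1_iso\<close> with identities at the other two vertices. The maps that
  change are left existential.\<close>

lemma tri_isomorphic1:
  assumes t: "tri D X Y Z f g h" and "isomorphic D X X'"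
  shows "\<exists>f' h'. tri D X' Y Z f' g h'"
proof -
  note m = tri_in[OF t]
  note i = idm_cmp[OF m(1)] idm_cmp[OF m(2)] idm_cmp[OF m(3)]
    cmp_idm[OF m(1)] cmp_idm[OF m(2)] cmp_idm[OF m(3)]
  obtain a b where a: "a \<in> Mor D X X'" "b \<in> Mor D X' X" "b \<cdot> a = idm D X" "a \<cdot> b = idm D X'"
    using assms(2) by (auto simp: isomorphic_def elim: is_isomE)
  have "tri D X' Y Z (f \<cdot> b) g (shm D a \<cdot> h)"
  proof (rule TR1_iso[OF t])
    show "idm D Y \<cdot> f = (f \<cdot> b) \<cdot> a"
      using m a cmp_assoc[OF a(1,2), of f Y] by (simp add: i)
    show "idm D Z \<cdot> g = g \<cdot> idm D Y" using m by (simp add: i)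
    show "shm D a \<cdot> h = (shm D a \<cdot> h) \<cdot> idm D Z"
      using cmp_idm[OF cmp_in[OF m(3) shm_in[OF a(1)]]] by simp
  qed (use m a in \<open>auto intro: cmp_in[of _ _ _ _ Y] cmp_in is_isom_idm is_isomI\<close>)
  then show ?thesis by blast
qed

lemma tri_isomorphic2:
  assumes t: "tri D X Y Z f g h" and "isomorphic D Y Y'"
  shows "\<exists>f' g'. tri D X Y' Z f' g' h"
proof -
  note m = tri_in[OF t]
  note i = idm_cmp[OF m(1)] idm_cmp[OF m(2)] idm_cmp[OF m(3)]
    cmp_idm[OF m(1)] cmp_idm[OF m(2)] cmp_idm[OF m(3)]
  obtain a b where a: "a \<in> Mor D Y Y'" "b \<in> Mor D Y' Y" "b \<cdot> a = idm D Y" "a \<cdot> b = idm D Y'"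
    using assms(2) by (auto simp: isomorphic_def elim: is_isomE)
  have "tri D X Y' Z (a \<cdot> f) (g \<cdot> b) h"
  proof (rule TR1_iso[OF t])
    show "a \<cdot> f = (a \<cdot> f) \<cdot> idm D X"
      using cmp_idm[OF cmp_in[OF m(1) a(1)]] by simp
    show "idm D Z \<cdot> g = (g \<cdot> b) \<cdot> a"
      using m a cmp_assoc[OF a(1,2), of g Z] by (simp add: i)
    show "shm D (idm D X) \<cdot> h = h \<cdot> idm D Z"
      using m by (simp add: shm_idm i)
  qed (use m a in \<open>auto intro: cmp_in[of _ _ _ _ Y] cmp_in is_isom_idm is_isomI\<close>)
  then show ?thesis by blast
qed

lemma tri_isomorphic3:
  assumes t: "tri D X Y Z f g h" and "isomorphic D Z Z'"
  shows "\<exists>g' h'. tri D X Y Z' f g' h'"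
proof -
  note m = tri_in[OF t]
  note i = idm_cmp[OF m(1)] idm_cmp[OF m(2)] idm_cmp[OF m(3)]
    cmp_idm[OF m(1)] cmp_idm[OF m(2)] cmp_idm[OF m(3)]
  obtain a b where a: "a \<in> Mor D Z Z'" "b \<in> Mor D Z' Z" "b \<cdot> a = idm D Z" "a \<cdot> b = idm D Z'"
    using assms(2) by (auto simp: isomorphic_def elim: is_isomE)
  have "tri D X Y Z' f (a \<cdot> g) (h \<cdot> b)"
  proof (rule TR1_iso[OF t])
    show "idm D Y \<cdot> f = f \<cdot> idm D X" using m by (simp add: i)
    show "a \<cdot> g = (a \<cdot> g) \<cdot> idm D Y"
      using cmp_idm[OF cmp_in[OF m(2) a(1)]] by simp
    show "shm D (idm D X) \<cdot> h = (h \<cdot> b) \<cdot> a"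
      using m a cmp_assoc[OF a(1,2), of h "sh D X"] by (simp add: shm_idm i)
  qed (use m a in \<open>auto intro: cmp_in[of _ _ _ _ Y] cmp_in is_isom_idm is_isomI\<close>)
  then show ?thesis by blast
qed

text \<open>The automorphism (-id, id, id) of the vertices flips the first and third maps together.
  It repairs signs left by repeated rotation.\<close>

lemma tri_neg:
  assumes t: "tri D X Y Z f g h"
  shows "tri D X Y Z (neg X Y f) g (neg Z (sh D X) h)"
proof -
  note m = tri_in[OF t]
  note i = idm_cmp[OF m(1)] idm_cmp[OF m(2)] idm_cmp[OF m(3)]
    cmp_idm[OF m(1)] cmp_idm[OF m(2)] cmp_idm[OF m(3)]
  show ?thesis
  proof (rule TR1_iso[OF t])
    show "is_isom D X X (neg X X (idm D X))" by (rule is_isom_neg_idm)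
    show "idm D Y \<cdot> f = neg X Y f \<cdot> neg X X (idm D X)"
      using m cmp_neg[OF idm_in neg_in[OF m(1)]] cmp_idm[OF neg_in[OF m(1)]] by (simp add: i)
    show "idm D Z \<cdot> g = g \<cdot> idm D Y" using m by (simp add: i)
    show "shm D (neg X X (idm D X)) \<cdot> h = neg Z (sh D X) h \<cdot> idm D Z"
      using m neg_cmp[of h Z "sh D X" "idm D (sh D X)" "sh D X"] cmp_idm[OF neg_in, of h Z "sh D X"]
      by (simp add: shm_neg[OF idm_in] shm_idm idm_cmp idm_in)
  qed (use m in \<open>auto intro: is_isom_idm\<close>)
qed

text \<open>TR3 compares the triangle X -> X -> 0 with the given one, and the composite then factors
  through the zero object.\<close>

lemma tri_comp_zero:
  assumes t: "tri D X Y Z f g h"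
  shows "g \<cdot> f = mzero D X Z"
proof -
  note m = tri_in[OF t]
  obtain O' where O: "zero_object D O'" using ex_zero_object by blast
  obtain c where "c \<in> Mor D O' Z" "c \<cdot> mzero D X O' = g \<cdot> f"
    using TR3[OF TR1_id[OF O, of X] t, of "idm D X" f] m by (auto simp: idm_in)
  then show ?thesis by simp
qed

text \<open>The cone of g is isomorphic to some X[1] by essential surjectivity, and a backward
  rotation then puts g in second place.\<close>

lemma tri_fiber:
  assumes g: "g \<in> Mor D Y Z"
  shows "\<exists>X f h. tri D X Y Z f g h"
proof -
  obtain C a b where "tri D Y Z C g a b" using TR1_cone[OF g] by blast
  moreover obtain X where "isomorphic D C (sh D X)"
    using sh_ess_surj[of C] isomorphic_sym by blast
  ultimately obtain a' b' where t: "tri D Y Z (sh D X) g a' b'" using tri_isomorphic3 by blast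
  obtain f where f: "f \<in> Mor D X Y" "neg (sh D X) (sh D Y) b' = shm D f"
    using tri_in[OF t] by (meson neg_in shm_full)
  have "b' = neg (sh D X) (sh D Y) (shm D f)"
    using tri_in[OF t] by (simp flip: f(2))
  then show ?thesis using t tri_rotate_back[OF f(1)] by blast
qed

lemma tri_zero_left:
  assumes "zero_object D O'" shows "tri D O' T T (mzero D O' T) (idm D T) (mzero D T (sh D O'))"
proof (rule tri_rotate_back)
  show "tri D T T (sh D O') (idm D T) (mzero D T (sh D O')) (neg (sh D O') (sh D T) (shm D (mzero D O' T)))"
    using TR1_id[of "sh D O'" T] assms by simp
qed simp

text \<open>Exactness of Hom(T, -) at Y. TR3 supplies only the third map of a morphism of triangles,
  so T -> T -> 0 and the given triangle are both rotated until the wanted T -> X appears, shifted,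
  in third place; fullness of the shift brings it back.\<close>

lemma tri_lift:
  assumes t: "tri D X Y Z f g h" and u: "u \<in> Mor D T Y" "g \<cdot> u = mzero D T Z"
  shows "\<exists>s\<in>Mor D T X. f \<cdot> s = u"
proof -
  note m = tri_in[OF t]
  obtain O' where O: "zero_object D O'" using ex_zero_object by blast
  have eq: "mzero D O' Z \<cdot> mzero D T O' = g \<cdot> u" using u mzero_cmp[of "mzero D T O'" T O' Z] by simp
  obtain c where c: "c \<in> Mor D (sh D T) (sh D X)"
    "shm D u \<cdot> neg (sh D T) (sh D T) (shm D (idm D T)) = neg (sh D X) (sh D Y) (shm D f) \<cdot> c"
    using TR3[OF tri_rotate[OF TR1_id[OF O, of T]] tri_rotate[OF t] u(1) mzero_in eq] by blast
  obtain s where s: "s \<in> Mor D T X" "c = shm D s" using c(1) by (rule shm_full)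
  have "neg (sh D T) (sh D Y) (shm D u) = neg (sh D T) (sh D Y) (shm D (f \<cdot> s))"
    using c(2) m s(1) u(1) cmp_neg[OF shm_in[OF idm_in] shm_in[OF u(1)]]
      neg_cmp[OF shm_in[OF s(1)], of "shm D f" "sh D Y"]
      shm_cmp[OF s(1), of f Y] shm_cmp[OF idm_in u(1)]
    by (simp add: s(2) cmp_idm)
  then have "neg (sh D T) (sh D Y) (neg (sh D T) (sh D Y) (shm D u))
    = neg (sh D T) (sh D Y) (neg (sh D T) (sh D Y) (shm D (f \<cdot> s)))" by simp
  then have "shm D u = shm D (f \<cdot> s)"
    using shm_in[OF u(1)] shm_in[OF cmp_in[OF s(1), of f Y]] m by simp
  then have "f \<cdot> s = u"
    using shm_inj[OF u(1) cmp_in[OF s(1), of f Y]] m by simp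
  then show ?thesis using s by blast
qed

text \<open>Dual to \<open>tri_lift\<close>; comparison with 0 -> T -> T puts the wanted map in
  third place without rotating.\<close>

lemma tri_extend:
  assumes t: "tri D X Y Z f g h" and u: "u \<in> Mor D Y T" "u \<cdot> f = mzero D X T"
  shows "\<exists>s\<in>Mor D Z T. s \<cdot> g = u"
proof -
  note m = tri_in[OF t]
  obtain O' where O: "zero_object D O'" using ex_zero_object by blast
  have eq: "u \<cdot> f = mzero D O' T \<cdot> mzero D X O'" by (rule trans[OF u(2) mzero_cmp[OF mzero_in, symmetric]])
  obtain c where "c \<in> Mor D Z T" "c \<cdot> g = idm D T \<cdot> u"
    using TR3[OF t tri_zero_left[OF O, of T] mzero_in u(1) eq] by blast
  then show ?thesis using u by (auto simp: idm_cmp)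
qed

text \<open>If f d = 0, then d[1] factors through h by a map T[1] -> Z, and there is no nonzero
  one.\<close>

lemma tri_lift_unique:
  assumes t: "tri D X Y Z f g h" and d: "d \<in> Mor D T X" "f \<cdot> d = mzero D T Y"
    and orth: "orthogonal (sh D T) Z"
  shows "d = mzero D T X"
proof -
  note m = tri_in[OF t]
  have "neg (sh D X) (sh D Y) (shm D f) \<cdot> shm D d = mzero D (sh D T) (sh D Y)"
    using neg_cmp[OF shm_in[OF d(1)] shm_in[OF m(1)]] shm_cmp[OF d(1) m(1), symmetric] d by simp
  then obtain s where s: "s \<in> Mor D (sh D T) Z" "h \<cdot> s = shm D d"
    using tri_lift[OF tri_rotate[OF tri_rotate[OF t]] shm_in[OF d(1)]] by blast
  have "shm D d = mzero D (sh D T) (sh D X)" using s orth m by simp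
  then show ?thesis by (rule shm_eq_mzero[OF d(1)])
qed

lemma tri_extend_unique:
  assumes t: "tri D X Y Z f g h" and d: "d \<in> Mor D Z T" "d \<cdot> g = mzero D Y T"
    and orth: "orthogonal (sh D X) T"
  shows "d = mzero D Z T"
proof -
  obtain s where "s \<in> Mor D (sh D X) T" "s \<cdot> h = d"
    using tri_extend[OF tri_rotate[OF t] d] by blast
  then show ?thesis using orth tri_in[OF t] by simp
qed

lemma tri_orthogonal_left:
  assumes t: "tri D X Y Z f g h" and o: "orthogonal X T" "orthogonal Z T"
  shows "orthogonal Y T"
proof (rule orthogonalI)
  fix u assume u: "u \<in> Mor D Y T"
  have "u \<cdot> f = mzero D X T" using o cmp_in[of f X Y u T] u tri_in[OF t] by simp
  from tri_extend[OF t u this] obtain s where "s \<in> Mor D Z T" "s \<cdot> g = u" by blast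
  then show "u = mzero D Y T" using o tri_in[OF t] by simp
qed

lemma tri_orthogonal_right:
  assumes t: "tri D X Y Z f g h" and o: "orthogonal T X" "orthogonal T Z"
  shows "orthogonal T Y"
proof (rule orthogonalI)
  fix u assume u: "u \<in> Mor D T Y"
  have "g \<cdot> u = mzero D T Z" using o cmp_in[of u T Y g Z] u tri_in[OF t] by simp
  from tri_lift[OF t u this] obtain s where "s \<in> Mor D T X" "f \<cdot> s = u" by blast
  then show "u = mzero D T Y" using o tri_in[OF t] by simp
qed

lemma tri_retract_left:
  assumes t: "tri D X Y Z f (mzero D Y Z) h"
  shows "retract Y X"
proof -
  obtain s where "s \<in> Mor D Y X" "f \<cdot> s = idm D Y"
    using tri_lift[OF t idm_in mzero_cmp[OF idm_in]] by blast
  then show ?thesis using tri_in[OF t] by (auto simp: retract_def)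
qed

lemma tri_retract_right:
  assumes t: "tri D X Y Z (mzero D X Y) g h"
  shows "retract Y Z"
proof -
  obtain s where "s \<in> Mor D Z Y" "s \<cdot> g = idm D Y"
    using tri_extend[OF t idm_in cmp_mzero[OF idm_in]] by blast
  then show ?thesis using tri_in[OF t] by (auto simp: retract_def)
qed

lemma idm_diff:
  assumes f: "f \<in> Mor D X X" and g: "g \<in> Mor D X Y" "g \<cdot> f = g"
  shows "g \<cdot> madd D f (neg X X (idm D X)) = mzero D X Y"
  using cmp_madd[OF f neg_in[OF idm_in] g(1)] cmp_neg[OF idm_in g(1)] cmp_idm[OF g(1)] g by simp

lemma idm_diff':
  assumes f: "f \<in> Mor D X X" and g: "g \<in> Mor D Y X" "f \<cdot> g = g"
  shows "madd D f (neg X X (idm D X)) \<cdot> g = mzero D Y X"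
  using madd_cmp[OF g(1) f neg_in[OF idm_in]] neg_cmp[OF g(1) idm_in] idm_cmp[OF g(1)] g by simp

text \<open>Apply \<open>tri_lift_unique\<close> to d - id. Uniqueness of this kind makes truncation
  compatible with retracts.\<close>

lemma tri_lift_idm:
  assumes t: "tri D X Y Z f g h" and d: "d \<in> Mor D X X" "f \<cdot> d = f"
    and orth: "orthogonal (sh D X) Z"
  shows "d = idm D X"
  by (rule madd_neg_eq_mzero[OF d(1) idm_in],
      rule tri_lift_unique[OF t madd_in[OF d(1) neg_in[OF idm_in]] idm_diff[OF d(1) _ d(2)] orth])
     (use tri_in[OF t] in simp)

lemma tri_extend_idm:
  assumes t: "tri D X Y Z f g h" and d: "d \<in> Mor D Z Z" "d \<cdot> g = g"
    and orth: "orthogonal (sh D X) Z"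
  shows "d = idm D Z"
  by (rule madd_neg_eq_mzero[OF d(1) idm_in],
      rule tri_extend_unique[OF t madd_in[OF d(1) neg_in[OF idm_in]] idm_diff'[OF d(1) _ d(2)] orth])
     (use tri_in[OF t] in simp)

lemma tri_third_zero:
  assumes t: "tri D X Y Z f g h" and Z: "zero_object D Z"
  shows "isomorphic D X Y"
proof -
  note m = tri_in[OF t]
  have "g = mzero D Y Z" using zero_objectD(2)[OF Z] m by blast
  then obtain u where u: "u \<in> Mor D Y X" "f \<cdot> u = idm D Y"
    using tri_lift[OF t idm_in] by (auto simp: idm_in)
  have "f \<cdot> (u \<cdot> f) = f" using cmp_assoc[of f X Y u X f Y] m u by (simp add: idm_cmp)
  moreover have "orthogonal (sh D X) Z" using Z by (simp add: zero_object_def)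
  ultimately have "u \<cdot> f = idm D X" using m u tri_lift_idm[OF t] by (blast intro: cmp_in)
  then show ?thesis using m u by (auto simp: isomorphic_def intro: is_isomI)
qed

lemma tri_first_zero:
  assumes t: "tri D X Y Z f g h" and X: "zero_object D X"
  shows "isomorphic D Y Z"
proof -
  note m = tri_in[OF t]
  have "f = mzero D X Y" using zero_objectD(1)[OF X] m by blast
  then obtain u where u: "u \<in> Mor D Z Y" "u \<cdot> g = idm D Y"
    using tri_extend[OF t idm_in] by (auto simp: idm_in)
  have "(g \<cdot> u) \<cdot> g = g" using cmp_assoc[of g Y Z u Y g Z] m u by (simp add: cmp_idm)
  moreover have "orthogonal (sh D X) Z" using X sh_zero_object[of X] unfolding zero_object_def by blast
  ultimately have "g \<cdot> u = idm D Z" using m u tri_extend_idm[OF t] by (blast intro: cmp_in)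
  then show ?thesis using m u by (auto simp: isomorphic_def intro: is_isomI)
qed

lemma tri_sh:
  assumes "tri D X Y Z f g h"
  shows "\<exists>f' g' h'. tri D (sh D X) (sh D Y) (sh D Z) f' g' h'"
  using tri_rotate[OF tri_rotate[OF tri_rotate[OF assms]]] by blast

text \<open>Fullness writes every map as minus a shift, so three backward rotations apply. The first
  map is returned explicitly because \<open>heart_factor\<close> uses it to factor a given
  morphism.\<close>

lemma tri_unsh:
  assumes t: "tri D (sh D X) (sh D Y) (sh D Z) f g h"
  obtains e g' h' where "e \<in> Mor D X Y" "f = shm D e" "tri D X Y Z e g' h'"
proof -
  note m = tri_in[OF t]
  have neg_full: "\<exists>k\<in>Mor D A B. u = neg (sh D A) (sh D B) (shm D k)"
    if u: "u \<in> Mor D (sh D A) (sh D B)" for A B u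
  proof -
    obtain k where k: "k \<in> Mor D A B" "neg (sh D A) (sh D B) u = shm D k"
      by (rule shm_full[OF neg_in[OF u]])
    then show ?thesis using neg_neg[OF u] by auto
  qed
  obtain c where c: "c \<in> Mor D Z (sh D X)" "h = neg (sh D Z) (sh D (sh D X)) (shm D c)"
    using neg_full m by blast
  obtain d where d: "d \<in> Mor D Y Z" "g = neg (sh D Y) (sh D Z) (shm D d)"
    using neg_full m by blast
  obtain e where e: "e \<in> Mor D X Y" "f = neg (sh D X) (sh D Y) (shm D e)"
    using neg_full m by blast
  have "tri D Z (sh D X) (sh D Y) c f g" using tri_rotate_back[OF c(1)] t c(2) by blast
  then have "tri D Y Z (sh D X) d c f" using tri_rotate_back[OF d(1)] d(2) by blast
  then have "tri D X Y Z e d c" using tri_rotate_back[OF e(1)] e(2) by blast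
  \<comment> \<open>The rotations return e, whereas f is the shift of -e.\<close>
  then have "tri D X Y Z (neg X Y e) d (neg Z (sh D X) c)" by (rule tri_neg)
  moreover have "f = shm D (neg X Y e)" using e by (simp add: shm_neg)
  ultimately show thesis using that[of "neg X Y e"] e by blast
qed

text \<open>The octahedral axiom for a section \<open>s\<close> of \<open>g\<close> identifies the cone of \<open>s\<close> with \<open>X\<close>.\<close>

lemma tri_split_swap:
  assumes t: "tri D X Y Z f g (mzero D Z (sh D X))"
  shows "\<exists>f' g' h'. tri D Z Y X f' g' h'"
proof -
  note m = tri_in[OF t]
  \<comment> \<open>The connecting map is zero, so the identity of Z lifts along g.\<close>
  obtain s where s: "s \<in> Mor D Z Y" "g \<cdot> s = idm D Z"
    using tri_lift[OF tri_rotate[OF t] idm_in mzero_cmp[OF idm_in]] by blast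
  obtain C a b where C: "tri D Z Y C s a b" using TR1_cone[OF s(1)] by blast
  obtain O' where O: "zero_object D O'" using ex_zero_object by blast
  have "tri D Z Z O' (g \<cdot> s) (mzero D Z O') (mzero D O' (sh D Z))"
    using TR1_id[OF O, of Z] s by simp
  from TR4[OF C tri_rotate[OF t] this]
  obtain u v w where "tri D C O' (sh D X) u v w" by blast
  from tri_first_zero[OF tri_rotate[OF this] O] have "isomorphic D C X"
    using isomorphic_sym sh_isomorphic by blast
  then show ?thesis using tri_isomorphic3[OF C] by blast
qed

end

section \<open>Extensions and shifts of full subcategories\<close>

context triangulated_category
begin

text \<open>The product of full subcategories of Beilinson, Bernstein and Deligne. Its associativity
  absorbs the octahedra, so filtration arguments become inclusions of products.\<close>

definition star :: "'o set \<Rightarrow> 'o set \<Rightarrow> 'o set"  (infixr \<open>\<star>\<close> 70)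
  where "S \<star> T = {Y. \<exists>X\<in>S. \<exists>Z\<in>T. \<exists>f g h. tri D X Y Z f g h}"

abbreviation shifted_set :: "'o set \<Rightarrow> int \<Rightarrow> 'o set"  (\<open>_\<langle>_\<rangle>\<close> [1000, 0] 1000)
  where "S\<langle>n\<rangle> \<equiv> shifted D S n"

definition orth :: "'o set \<Rightarrow> 'o set \<Rightarrow> bool"
  where "orth S T \<longleftrightarrow> (\<forall>X\<in>S. \<forall>Y\<in>T. orthogonal X Y)"

abbreviation zeros :: "'o set"
  where "zeros \<equiv> Collect (zero_object D)"

lemma iso_closedD: "iso_closed D S \<Longrightarrow> X \<in> S \<Longrightarrow> isomorphic D X Y \<Longrightarrow> Y \<in> S"
  unfolding iso_closed_def by blast

lemma starI: "tri D X Y Z f g h \<Longrightarrow> X \<in> S \<Longrightarrow> Z \<in> T \<Longrightarrow> Y \<in> S \<star> T"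
  unfolding star_def by blast

lemma starE:
  assumes "Y \<in> S \<star> T" obtains X Z f g h where "X \<in> S" "Z \<in> T" "tri D X Y Z f g h"
  using assms by (auto simp: star_def)

lemma star_mono: "S \<subseteq> S' \<Longrightarrow> T \<subseteq> T' \<Longrightarrow> S \<star> T \<subseteq> S' \<star> T'"
  unfolding star_def by blast

lemma iso_closed_star: "iso_closed D (S \<star> T)"
  unfolding iso_closed_def
proof (intro allI impI)
  fix X Y assume "X \<in> S \<star> T" "isomorphic D X Y"
  then obtain a b f g h where "a \<in> S" "b \<in> T" "tri D a X b f g h" by (elim starE)
  with \<open>isomorphic D X Y\<close> show "Y \<in> S \<star> T" using tri_isomorphic2[of a X b f g h Y] starI by blast
qed

text \<open>Essential surjectivity provides Q with Q[1] isomorphic to Z, which makes the third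
  vertex a shift.\<close>

lemma tri_unrotate:
  assumes "tri D X Y Z f g h"
  shows "\<exists>Q e h'. isomorphic D (sh D Q) Z \<and> tri D Q X Y e f h'"
proof -
  obtain Q where Q: "isomorphic D (sh D Q) Z" using sh_ess_surj by blast
  obtain g' h' where t: "tri D X Y (sh D Q) f g' h'"
    using tri_isomorphic3[OF assms isomorphic_sym[OF Q]] by blast
  obtain e where e: "e \<in> Mor D Q X" "neg (sh D Q) (sh D X) h' = shm D e"
    using shm_full[OF neg_in[OF tri_in(3)[OF t]]] by blast
  have "h' = neg (sh D Q) (sh D X) (shm D e)"
    using neg_neg[OF tri_in(3)[OF t]] by (simp add: e(2))
  with t have "tri D Q X Y e f g'" by (intro tri_rotate_back[OF e(1)]) simp
  then show ?thesis using Q by blast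
qed

text \<open>Each inclusion is an octahedron: on s -> M -> X for the first, on X -> M -> r for the
  second.\<close>

lemma star_assoc: "(S \<star> T) \<star> R = S \<star> (T \<star> R)"
proof (intro equalityI subsetI)
  fix X assume "X \<in> (S \<star> T) \<star> R"
  then obtain s t r M f g h f' g' h' where m: "s \<in> S" "t \<in> T" "r \<in> R"
    and t1: "tri D s M t f g h" and t2: "tri D M X r f' g' h'"
    by (elim starE) blast
  have "f' \<cdot> f \<in> Mor D s X" using tri_in[OF t1] tri_in[OF t2] by (blast intro: cmp_in)
  then obtain C c c' where t3: "tri D s X C (f' \<cdot> f) c c'" using TR1_cone by blast
  from TR4[OF t1 t2 t3] obtain u v w where "tri D t C r u v w" by blast
  then show "X \<in> S \<star> (T \<star> R)" using t3 m by (blast intro: starI)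
next
  fix X assume "X \<in> S \<star> (T \<star> R)"
  then obtain s t r M f g h f' g' h' where m: "s \<in> S" "t \<in> T" "r \<in> R"
    and t1: "tri D t M r f g h" and t2: "tri D s X M f' g' h'"
    by (elim starE) blast
  have "g \<cdot> g' \<in> Mor D X r" using tri_in[OF t1] tri_in[OF t2] by (blast intro: cmp_in)
  then obtain C c c' where t3: "tri D C X r c (g \<cdot> g') c'" using tri_fiber by blast
  \<comment> \<open>The three cones are s[1], t[1] and C[1], so the resulting triangle has to be
    shifted back.\<close>
  from TR4[OF tri_rotate[OF t2] tri_rotate[OF t1] tri_rotate[OF t3]]
  obtain u v w where "tri D (sh D s) (sh D C) (sh D t) u v w" by blast
  then obtain e u v where "tri D s C t e u v" by (rule tri_unsh)
  then show "X \<in> (S \<star> T) \<star> R" using t3 m by (blast intro: starI)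
qed

lemma zeros_star:
  assumes S: "iso_closed D S" shows "zeros \<star> S = S"
proof (intro equalityI subsetI)
  fix X assume "X \<in> zeros \<star> S"
  then obtain a b f g h where ab: "zero_object D a" "b \<in> S" "tri D a X b f g h"
    by (elim starE) simp
  show "X \<in> S" by (rule iso_closedD[OF S ab(2) isomorphic_sym[OF tri_first_zero[OF ab(3,1)]]])
next
  fix X assume "X \<in> S"
  obtain O' where O: "zero_object D O'" using ex_zero_object by blast
  show "X \<in> zeros \<star> S" by (rule starI[OF tri_zero_left[OF O]]) (use O \<open>X \<in> S\<close> in simp_all)
qed

lemma star_zeros:
  assumes S: "iso_closed D S" shows "S \<star> zeros = S"
proof (intro equalityI subsetI)
  fix X assume "X \<in> S \<star> zeros"
  then obtain a b f g h where ab: "a \<in> S" "zero_object D b" "tri D a X b f g h"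
    by (elim starE) simp
  show "X \<in> S" by (rule iso_closedD[OF S ab(1) tri_third_zero[OF ab(3,2)]])
next
  fix X assume "X \<in> S"
  obtain O' where O: "zero_object D O'" using ex_zero_object by blast
  show "X \<in> S \<star> zeros" by (rule starI[OF TR1_id[OF O]]) (use O \<open>X \<in> S\<close> in simp_all)
qed

lemma iso_closed_zeros: "iso_closed D zeros"
  unfolding iso_closed_def using isomorphic_sym zero_object_isomorphic by blast

lemma orthD: "orth S T \<Longrightarrow> X \<in> S \<Longrightarrow> Y \<in> T \<Longrightarrow> orthogonal X Y"
  by (simp add: orth_def)

lemma orth_mono: "orth S T \<Longrightarrow> S' \<subseteq> S \<Longrightarrow> T' \<subseteq> T \<Longrightarrow> orth S' T'"
  by (meson orth_def subsetD)

lemma orth_star_left: "orth S R \<Longrightarrow> orth T R \<Longrightarrow> orth (S \<star> T) R"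
  unfolding orth_def by (meson starE tri_orthogonal_left)

lemma orth_star_right: "orth R S \<Longrightarrow> orth R T \<Longrightarrow> orth R (S \<star> T)"
  unfolding orth_def by (meson starE tri_orthogonal_right)

section \<open>Transport along the shift\<close>

lemma sh_funpow_isomorphic:
  "isomorphic D ((sh D ^^ n) X) ((sh D ^^ n) Y) \<longleftrightarrow> isomorphic D X Y"
  by (induction n) (simp_all add: sh_isomorphic)

lemma sh_funpow_orthogonal:
  "orthogonal ((sh D ^^ n) X) ((sh D ^^ n) Y) \<longleftrightarrow> orthogonal X Y"
  by (induction n) (simp_all add: sh_orthogonal)

definition shift_family :: "(int \<Rightarrow> 'o set) \<Rightarrow> bool"
  where "shift_family A \<longleftrightarrow> (\<forall>n. iso_closed D (A n)) \<and> (\<forall>n X. sh D X \<in> A (n + 1) \<longleftrightarrow> X \<in> A n)"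

lemma shift_family_iso_closed: "shift_family A \<Longrightarrow> iso_closed D (A n)"
  by (simp add: shift_family_def)

lemma shift_family_sh: "shift_family A \<Longrightarrow> sh D X \<in> A (n + 1) \<longleftrightarrow> X \<in> A n"
  by (simp add: shift_family_def)

lemma shift_family_unsh:
  assumes "shift_family A" "Y \<in> A (n + 1)"
  obtains X where "isomorphic D Y (sh D X)" "X \<in> A n"
proof -
  obtain X where X: "isomorphic D Y (sh D X)" using sh_ess_surj isomorphic_sym by blast
  then have "sh D X \<in> A (n + 1)" using assms iso_closedD shift_family_iso_closed by blast
  then show thesis using X assms(1) that by (simp add: shift_family_sh)
qed

lemma shift_family_induct:
  assumes "P (m::int)" "\<And>n. P n \<longleftrightarrow> P (n + 1)" shows "P n"
proof (induction n rule: int_induct[where k = m])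
  case (step1 i) then show ?case using assms(2) by blast
next
  case (step2 i) then show ?case using assms(2)[of "i - 1"] by simp
qed (fact assms(1))

lemma shift_family_subset:
  assumes A: "shift_family A" and B: "shift_family B" and "A m \<subseteq> B m"
  shows "A n \<subseteq> B n"
  using assms(3)
proof (rule shift_family_induct)
  fix n
  show "A n \<subseteq> B n \<longleftrightarrow> A (n + 1) \<subseteq> B (n + 1)"
  proof (intro iffI subsetI)
    fix X assume AB: "A n \<subseteq> B n" and "X \<in> A (n + 1)"
    then obtain Y where Y: "isomorphic D X (sh D Y)" "Y \<in> A n" using shift_family_unsh A by blast
    then have "sh D Y \<in> B (n + 1)" using AB B by (auto simp: shift_family_sh)
    then show "X \<in> B (n + 1)"
      by (rule iso_closedD[OF shift_family_iso_closed[OF B] _ isomorphic_sym[OF Y(1)]])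
  next
    fix X assume "A (n + 1) \<subseteq> B (n + 1)" "X \<in> A n"
    then show "X \<in> B n" using shift_family_sh[OF A, of X n] shift_family_sh[OF B, of X n] by blast
  qed
qed

lemma shift_family_eq:
  assumes "shift_family A" "shift_family B" "A m = B m" shows "A n = B n"
  using shift_family_subset[of A B m n] shift_family_subset[of B A m n] assms by blast

lemma shift_family_orth:
  assumes A: "shift_family A" and B: "shift_family B" and "orth (A m) (B m)"
  shows "orth (A n) (B n)"
  using assms(3)
proof (rule shift_family_induct)
  fix n
  show "orth (A n) (B n) \<longleftrightarrow> orth (A (n + 1)) (B (n + 1))"
  proof
    assume *: "orth (A n) (B n)"
    show "orth (A (n + 1)) (B (n + 1))"
      unfolding orth_def
    proof (intro ballI)
      fix X Y assume "X \<in> A (n + 1)" "Y \<in> B (n + 1)"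
      then obtain X' Y' where X': "isomorphic D X (sh D X')" "X' \<in> A n"
        and Y': "isomorphic D Y (sh D Y')" "Y' \<in> B n"
        using shift_family_unsh A B by metis
      then have "orthogonal (sh D X') (sh D Y')" using orthD[OF *] by (simp add: sh_orthogonal)
      then have "orthogonal X (sh D Y')" by (rule isomorphic_orthogonal(2)[OF X'(1)])
      then show "orthogonal X Y" by (rule isomorphic_orthogonal(1)[OF Y'(1)])
    qed
  next
    assume *: "orth (A (n + 1)) (B (n + 1))"
    show "orth (A n) (B n)"
      unfolding orth_def
    proof (intro ballI)
      fix X Y assume "X \<in> A n" "Y \<in> B n"
      then have "orthogonal (sh D X) (sh D Y)" using orthD[OF *] A B by (simp add: shift_family_sh)
      then show "orthogonal X Y" by (simp add: sh_orthogonal)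
    qed
  qed
qed

lemma shifted_0 [simp]: "iso_closed D S \<Longrightarrow> S\<langle>0\<rangle> = S"
  unfolding shifted_def by (auto intro: isomorphic_refl dest: isomorphic_sym iso_closedD)

lemma iso_closed_shifted: "iso_closed D (S\<langle>n\<rangle>)"
  unfolding iso_closed_def shifted_def
proof (intro allI impI CollectI, elim CollectE bexE)
  fix X Y s assume "isomorphic D X Y" "s \<in> S" "isomorphic D ((sh D ^^ nat (- n)) X) ((sh D ^^ nat n) s)"
  then show "\<exists>s\<in>S. isomorphic D ((sh D ^^ nat (- n)) Y) ((sh D ^^ nat n) s)"
    using isomorphic_trans[OF isomorphic_sym] sh_funpow_isomorphic[of "nat (- n)" X Y] by blast
qed

lemma shift_family_shifted: "shift_family (\<lambda>n. S\<langle>n + k\<rangle>)"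
proof -
  \<comment> \<open>For m >= 0 the extra shift cancels by full faithfulness; for m < 0 it is
    absorbed by the power of the shift applied to the member in \<open>shifted_def\<close>.\<close>
  have "sh D X \<in> S\<langle>m + 1\<rangle> \<longleftrightarrow> X \<in> S\<langle>m\<rangle>" for m X
  proof (cases "m \<ge> 0")
    case True
    then show ?thesis by (simp add: shifted_def nat_add_distrib sh_isomorphic)
  next
    case False
    then have "nat (- m) = Suc (nat (- (m + 1)))" "nat (m + 1) = 0" "nat m = 0" by auto
    then show ?thesis by (simp add: shifted_def funpow_swap1)
  qed
  then have "sh D X \<in> S\<langle>n + 1 + k\<rangle> \<longleftrightarrow> X \<in> S\<langle>n + k\<rangle>" for n X
    using add.commute[of k 1] by (metis add.assoc)
  then show ?thesis by (simp add: shift_family_def iso_closed_shifted)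
qed

lemma shift_family_shifted0: "shift_family (shifted D S)"
  using shift_family_shifted[of S 0] by simp

lemma sh_shifted: "sh D X \<in> S\<langle>n + 1\<rangle> \<longleftrightarrow> X \<in> S\<langle>n\<rangle>"
  by (rule shift_family_sh[OF shift_family_shifted0])

lemma sh_shifted1: "iso_closed D S \<Longrightarrow> sh D X \<in> S\<langle>1\<rangle> \<longleftrightarrow> X \<in> S"
  using sh_shifted[of X S 0] by simp

lemma shifted_minus1: "iso_closed D S \<Longrightarrow> X \<in> S\<langle>-1\<rangle> \<longleftrightarrow> sh D X \<in> S"
  using sh_shifted[of X S "-1"] by simp

lemma shift_family_Int: "shift_family A \<Longrightarrow> shift_family B \<Longrightarrow> shift_family (\<lambda>n. A n \<inter> B n)"
  unfolding shift_family_def iso_closed_def by blast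

lemma shift_family_zeros: "shift_family (\<lambda>n. zeros)"
  by (simp add: shift_family_def iso_closed_zeros)

lemma shift_family_star:
  assumes A: "shift_family A" and B: "shift_family B"
  shows "shift_family (\<lambda>n. A n \<star> B n)"
  unfolding shift_family_def
proof (intro conjI allI iso_closed_star iffI)
  fix n X assume "X \<in> A n \<star> B n"
  then obtain a b f g h where ab: "a \<in> A n" "b \<in> B n" "tri D a X b f g h" by (rule starE)
  obtain f g h where "tri D (sh D a) (sh D X) (sh D b) f g h" using tri_sh[OF ab(3)] by blast
  then show "sh D X \<in> A (n + 1) \<star> B (n + 1)"
    using ab shift_family_sh[OF A] shift_family_sh[OF B] by (blast intro: starI)
next
  fix n X assume "sh D X \<in> A (n + 1) \<star> B (n + 1)"
  then obtain a b f g h where ab: "a \<in> A (n + 1)" "b \<in> B (n + 1)" "tri D a (sh D X) b f g h"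
    by (rule starE)
  obtain a' where a': "isomorphic D a (sh D a')" "a' \<in> A n" using shift_family_unsh[OF A ab(1)] .
  obtain b' where b': "isomorphic D b (sh D b')" "b' \<in> B n" using shift_family_unsh[OF B ab(2)] .
  obtain f g h where "tri D (sh D a') (sh D X) (sh D b') f g h"
    using tri_isomorphic1[OF ab(3) a'(1)] tri_isomorphic3[OF _ b'(1)] by blast
  then show "X \<in> A n \<star> B n" by (rule tri_unsh) (use a' b' in \<open>blast intro: starI\<close>)
qed

lemma shifted_Int:
  assumes "iso_closed D S" "iso_closed D T" shows "(S \<inter> T)\<langle>n\<rangle> = S\<langle>n\<rangle> \<inter> T\<langle>n\<rangle>"
proof (rule shift_family_eq[where m = 0 and A = "shifted D (S \<inter> T)"])
  show "(S \<inter> T)\<langle>0\<rangle> = S\<langle>0\<rangle> \<inter> T\<langle>0\<rangle>"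
    using assms by (subst shifted_0) (auto simp: iso_closed_def)
qed (intro shift_family_Int shift_family_shifted0)+

lemma shifted_star:
  assumes "iso_closed D S" "iso_closed D T" shows "(S \<star> T)\<langle>n\<rangle> = S\<langle>n\<rangle> \<star> T\<langle>n\<rangle>"
  by (rule shift_family_eq[where m = 0 and A = "shifted D (S \<star> T)"])
    (use assms in \<open>simp_all add: iso_closed_star shift_family_star shift_family_shifted0\<close>)

lemma shifted_shifted: "S\<langle>m\<rangle>\<langle>n\<rangle> = S\<langle>n + m\<rangle>"
  by (rule shift_family_eq[where m = 0 and A = "shifted D (S\<langle>m\<rangle>)"])
    (simp_all add: iso_closed_shifted shift_family_shifted shift_family_shifted0)

lemma shifted_mono: "S \<subseteq> T \<Longrightarrow> S\<langle>n\<rangle> \<subseteq> T\<langle>n\<rangle>"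
  unfolding shifted_def by blast

lemma orth_shifted:
  assumes "orth (S\<langle>m\<rangle>) (T\<langle>k\<rangle>)" shows "orth (S\<langle>m + n\<rangle>) (T\<langle>k + n\<rangle>)"
proof -
  have "orth (S\<langle>n + m\<rangle>) (T\<langle>n + k\<rangle>)"
    by (rule shift_family_orth[OF shift_family_shifted shift_family_shifted, where m = 0])
      (use assms in simp)
  then show ?thesis by (simp add: add.commute)
qed

lemma sh_funpow_shifted: "(sh D ^^ n) X \<in> S\<langle>int n + m\<rangle> \<longleftrightarrow> X \<in> S\<langle>m\<rangle>"
proof (induction n)
  case (Suc n)
  then show ?case using sh_shifted[of "(sh D ^^ n) X" S "int n + m"] by (simp add: algebra_simps)
qed simp

end

section \<open>Bounded t-structures\<close>

context additive_category
begin

section \<open>Kernels and cokernels relative to a full subcategory\<close>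

lemma is_kernel_mono:
  assumes "is_kernel D H A B f N i" shows "is_mono D H N A i"
  unfolding is_mono_def
proof (intro conjI ballI impI)
  have i: "i \<in> Mor D N A" "f \<in> Mor D A B" "f \<cdot> i = mzero D N B"
    using assms by (auto simp: is_kernel_def)
  fix T s t assume T: "T \<in> H" "s \<in> Mor D T N" "t \<in> Mor D T N" "i \<cdot> s = i \<cdot> t"
  have "f \<cdot> (i \<cdot> s) = mzero D T B" using cmp_assoc[OF T(2) i(1,2)] i T by simp
  then have "\<exists>!u. u \<in> Mor D T N \<and> i \<cdot> u = i \<cdot> s"
    using assms T cmp_in[OF T(2) i(1)] by (simp add: is_kernel_def)
  then show "s = t" using T by metis
qed (use assms in \<open>auto simp: is_kernel_def\<close>)

lemma kernels_isomorphic: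
  assumes k: "is_kernel D H A B f N i" and k': "is_kernel D H A B f N' i'"
  shows "isomorphic D N N'"
proof -
  have i: "i \<in> Mor D N A" "N \<in> H" and i': "i' \<in> Mor D N' A" "N' \<in> H"
    using k k' by (auto simp: is_kernel_def)
  obtain u where u: "u \<in> Mor D N N'" "i' \<cdot> u = i" using k k' unfolding is_kernel_def by metis
  obtain u' where u': "u' \<in> Mor D N' N" "i \<cdot> u' = i'" using k k' unfolding is_kernel_def by metis
  have "u' \<cdot> u = idm D N"
    using is_kernel_mono[OF k] cmp_assoc[OF u(1) u'(1) i(1)] cmp_idm[OF i(1)] i u u'
      cmp_in[OF u(1) u'(1)] idm_in by (simp add: is_mono_def)
  moreover have "u \<cdot> u' = idm D N'"
    using is_kernel_mono[OF k'] cmp_assoc[OF u'(1) u(1) i'(1)] cmp_idm[OF i'(1)] i' u u'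
      cmp_in[OF u'(1) u(1)] idm_in by (simp add: is_mono_def)
  ultimately show ?thesis using u u' is_isomI unfolding isomorphic_def by blast
qed

lemma is_cokernel_epi:
  assumes "is_cokernel D H A B f Q p" "T \<in> H" "s \<in> Mor D Q T" "t \<in> Mor D Q T" "s \<cdot> p = t \<cdot> p"
  shows "s = t"
proof -
  have p: "p \<in> Mor D B Q" "f \<in> Mor D A B" "p \<cdot> f = mzero D A Q"
    using assms by (auto simp: is_cokernel_def)
  have "(s \<cdot> p) \<cdot> f = mzero D A T" using cmp_assoc[OF p(2,1) assms(3)] p assms(3) by simp
  then have "\<exists>!u. u \<in> Mor D Q T \<and> u \<cdot> p = s \<cdot> p"
    using assms cmp_in[OF p(1) assms(3)] by (simp add: is_cokernel_def)
  then show "s = t" using assms by metis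
qed

lemma cokernels_isomorphic:
  assumes k: "is_cokernel D H A B f Q p" and k': "is_cokernel D H A B f Q' p'"
  shows "isomorphic D Q Q'"
proof -
  have p: "p \<in> Mor D B Q" "Q \<in> H" and p': "p' \<in> Mor D B Q'" "Q' \<in> H"
    using k k' by (auto simp: is_cokernel_def)
  obtain u where u: "u \<in> Mor D Q Q'" "u \<cdot> p = p'" using k k' unfolding is_cokernel_def by metis
  obtain u' where u': "u' \<in> Mor D Q' Q" "u' \<cdot> p' = p" using k k' unfolding is_cokernel_def by metis
  have "u' \<cdot> u = idm D Q"
    by (rule is_cokernel_epi[OF k p(2) cmp_in[OF u(1) u'(1)] idm_in])
      (use cmp_assoc[OF p(1) u(1) u'(1)] idm_cmp[OF p(1)] u u' in simp)
  moreover have "u \<cdot> u' = idm D Q'"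
    by (rule is_cokernel_epi[OF k' p'(2) cmp_in[OF u'(1) u(1)] idm_in])
      (use cmp_assoc[OF p'(1) u'(1) u(1)] idm_cmp[OF p'(1)] u u' in simp)
  ultimately show ?thesis using u u' is_isomI unfolding isomorphic_def by blast
qed

end

locale bounded_t_category = triangulated_category D for D :: "('o, 'm) tcat" (structure) +
  fixes U V H :: "'o set"
  assumes bounded_t: "bounded_t_structure D U V"
    and heart: "H = U \<inter> V"
begin

section \<open>Aisles, coaisles and truncation\<close>

lemma iso_closed_UV: "iso_closed D U" "iso_closed D V"
  using bounded_t by (auto simp: bounded_t_structure_def t_structure_def)

lemma U_antimono: assumes "n \<le> m" shows "U\<langle>m\<rangle> \<subseteq> U\<langle>n\<rangle>"
proof -
  have "U\<langle>k + 1\<rangle> \<subseteq> U\<langle>k\<rangle>" for k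
    by (rule shift_family_subset[OF shift_family_shifted shift_family_shifted0, where m = "-1"])
      (use bounded_t iso_closed_UV in \<open>simp add: bounded_t_structure_def t_structure_def\<close>)
  then have "U\<langle>n + int k\<rangle> \<subseteq> U\<langle>n\<rangle>" for k
  proof (induction k)
    case (Suc k)
    from \<open>U\<langle>n + int k + 1\<rangle> \<subseteq> U\<langle>n + int k\<rangle>\<close> Suc show ?case by (simp add: algebra_simps)
  qed simp
  from this[of "nat (m - n)"] show ?thesis using assms by simp
qed

lemma V_mono: assumes "n \<le> m" shows "V\<langle>n\<rangle> \<subseteq> V\<langle>m\<rangle>"
proof -
  have "V\<langle>k\<rangle> \<subseteq> V\<langle>k + 1\<rangle>" for k
    by (rule shift_family_subset[OF shift_family_shifted0 shift_family_shifted, where m = "-1"])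
      (use bounded_t iso_closed_UV in \<open>simp add: bounded_t_structure_def t_structure_def\<close>)
  then have "V\<langle>n\<rangle> \<subseteq> V\<langle>n + int k\<rangle>" for k
  proof (induction k)
    case (Suc k)
    from \<open>V\<langle>n + int k\<rangle> \<subseteq> V\<langle>n + int k + 1\<rangle>\<close> Suc show ?case by (simp add: algebra_simps)
  qed simp
  from this[of "nat (m - n)"] show ?thesis using assms by simp
qed

lemma orth_UV: assumes "m < n" shows "orth (U\<langle>n\<rangle>) (V\<langle>m\<rangle>)"
proof -
  have "orth (U\<langle>0\<rangle>) (V\<langle>-1\<rangle>)"
    using bounded_t iso_closed_UV by (simp add: bounded_t_structure_def t_structure_def orth_def)
  from orth_shifted[OF this, of n] show ?thesis
    by (rule orth_mono) (use assms V_mono[of m "n - 1"] in simp_all)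
qed

lemma orthogonal_UV: "X \<in> U\<langle>n\<rangle> \<Longrightarrow> Y \<in> V\<langle>m\<rangle> \<Longrightarrow> m < n \<Longrightarrow> orthogonal X Y"
  using orthD[OF orth_UV] by blast

text \<open>The axiom is the case n = 0; equality with the constant family of all objects carries it
  to every n.\<close>

lemma truncation: "X \<in> U\<langle>n\<rangle> \<star> V\<langle>n - 1\<rangle>"
proof -
  have "U\<langle>0\<rangle> \<star> V\<langle>0 + -1\<rangle> = UNIV"
    using bounded_t iso_closed_UV
    by (fastforce simp: bounded_t_structure_def t_structure_def star_def)
  from shift_family_eq[OF shift_family_star[OF shift_family_shifted0 shift_family_shifted] _ this, of n]
  show ?thesis by (simp add: shift_family_def iso_closed_def)
qed

lemma truncationE:
  assumes "m = n - 1"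
  obtains a b f g h where "a \<in> U\<langle>n\<rangle>" "b \<in> V\<langle>m\<rangle>" "tri D a X b f g h"
  using truncation[of X n] assms by (elim starE) simp

lemma bounded: "\<exists>n::nat. X \<in> U\<langle>- int n\<rangle> \<and> X \<in> V\<langle>int n\<rangle>"
  using bounded_t by (simp add: bounded_t_structure_def)

text \<open>In the truncation triangle of X the map X -> b vanishes, and uniqueness of extensions
  then kills the identity of b. With \<open>V_I\<close> this describes aisle and coaisle by
  orthogonality, from which closure under extensions and retracts follows.\<close>

lemma U_I:
  assumes "\<And>Y. Y \<in> V\<langle>n - 1\<rangle> \<Longrightarrow> orthogonal X Y" shows "X \<in> U\<langle>n\<rangle>"
proof -
  obtain a b f g h where t: "a \<in> U\<langle>n\<rangle>" "b \<in> V\<langle>n - 1\<rangle>" "tri D a X b f g h" by (rule truncationE[OF refl])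
  have "idm D b \<cdot> g = mzero D X b"
    using assms[OF t(2)] tri_in(2)[OF t(3)] idm_cmp[OF tri_in(2)[OF t(3)]] by simp
  moreover have "sh D a \<in> U\<langle>n\<rangle>" using t(1) U_antimono[of n "n + 1"] sh_shifted by auto
  ultimately have "zero_object D b"
    using tri_extend_unique[OF t(3) idm_in _ orthogonal_UV[OF _ t(2)]] by (simp add: zero_object_iff)
  from tri_third_zero[OF t(3) this] show ?thesis by (rule iso_closedD[OF iso_closed_shifted t(1)])
qed

lemma V_I:
  assumes "\<And>Y. Y \<in> U\<langle>n + 1\<rangle> \<Longrightarrow> orthogonal Y X" shows "X \<in> V\<langle>n\<rangle>"
proof -
  obtain a b f g h where t: "a \<in> U\<langle>n + 1\<rangle>" "b \<in> V\<langle>n\<rangle>" "tri D a X b f g h"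
    by (rule truncationE[of n "n + 1"]) simp
  have "f \<cdot> idm D a = mzero D a X"
    using assms[OF t(1)] tri_in(1)[OF t(3)] cmp_idm[OF tri_in(1)[OF t(3)]] by simp
  moreover have "U\<langle>n + 1 + 1\<rangle> \<subseteq> U\<langle>n + 1\<rangle>" by (rule U_antimono) simp
  then have "sh D a \<in> U\<langle>n + 1\<rangle>" using t(1) sh_shifted by blast
  ultimately have "zero_object D a"
    using tri_lift_unique[OF t(3) idm_in _ orthogonal_UV[OF _ t(2)]] by (simp add: zero_object_iff)
  from isomorphic_sym[OF tri_first_zero[OF t(3) this]] show ?thesis
    by (rule iso_closedD[OF iso_closed_shifted t(2)])
qed

lemma U_star: "U\<langle>n\<rangle> \<star> U\<langle>n\<rangle> \<subseteq> U\<langle>n\<rangle>"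
  by (intro subsetI U_I orthD[OF orth_star_left[OF orth_UV orth_UV]]) auto

lemma V_star: "V\<langle>n\<rangle> \<star> V\<langle>n\<rangle> \<subseteq> V\<langle>n\<rangle>"
  by (intro subsetI V_I orthD[OF orth_star_right[OF orth_UV orth_UV]]) auto

lemma U_ext: "tri D a X b f g h \<Longrightarrow> a \<in> U\<langle>n\<rangle> \<Longrightarrow> b \<in> U\<langle>n\<rangle> \<Longrightarrow> X \<in> U\<langle>n\<rangle>"
  using U_star starI by blast

lemma V_ext: "tri D a X b f g h \<Longrightarrow> a \<in> V\<langle>n\<rangle> \<Longrightarrow> b \<in> V\<langle>n\<rangle> \<Longrightarrow> X \<in> V\<langle>n\<rangle>"
  using V_star starI by blast

lemma U_retract: "retract X Y \<Longrightarrow> Y \<in> U\<langle>n\<rangle> \<Longrightarrow> X \<in> U\<langle>n\<rangle>"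
  by (rule U_I, erule retract_orthogonal(2), erule orthogonal_UV) auto

lemma V_retract: "retract X Y \<Longrightarrow> Y \<in> V\<langle>n\<rangle> \<Longrightarrow> X \<in> V\<langle>n\<rangle>"
  by (rule V_I, erule retract_orthogonal(1), erule orthogonal_UV) auto

lemma U_zero: "zero_object D X \<Longrightarrow> X \<in> U\<langle>n\<rangle>"
  by (rule U_I) (simp add: zero_object_def)

lemma V_zero: "zero_object D X \<Longrightarrow> X \<in> V\<langle>n\<rangle>"
  by (rule V_I) (simp add: zero_object_def)

text \<open>After rotation b lies between X and a[1], and a[1] is in
  \<open>U\<langle>m + 1\<rangle>\<close>; the bound on n puts that inside
  \<open>U\<langle>n\<rangle>\<close>.\<close>

lemma U_cone:
  assumes t: "tri D a X b f g h" and "X \<in> U\<langle>n\<rangle>" "a \<in> U\<langle>m\<rangle>" "n \<le> m + 1"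
  shows "b \<in> U\<langle>n\<rangle>"
proof -
  have "sh D a \<in> U\<langle>n\<rangle>" using assms U_antimono[of n "m + 1"] sh_shifted by auto
  then show ?thesis using U_ext[OF tri_rotate[OF t]] assms by blast
qed

lemma V_fiber:
  assumes t: "tri D a X b f g h" and "X \<in> V\<langle>n\<rangle>" "b \<in> V\<langle>m\<rangle>" "m \<le> n + 1"
  shows "a \<in> V\<langle>n\<rangle>"
proof -
  obtain Q e h' where Q: "isomorphic D (sh D Q) b" "tri D Q a X e f h'"
    using tri_unrotate[OF t] by blast
  have "b \<in> V\<langle>n + 1\<rangle>" using assms V_mono[of m "n + 1"] by auto
  then have "sh D Q \<in> V\<langle>n + 1\<rangle>" by (rule iso_closedD[OF iso_closed_shifted _ isomorphic_sym[OF Q(1)]])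
  then show ?thesis using V_ext[OF Q(2)] assms sh_shifted by blast
qed

lemma heart_shifted: "H\<langle>n\<rangle> = U\<langle>n\<rangle> \<inter> V\<langle>n\<rangle>"
  unfolding heart by (rule shifted_Int[OF iso_closed_UV])

lemma iso_closed_H: "iso_closed D H"
  using iso_closed_UV unfolding heart iso_closed_def by blast

lemma H_iff: "X \<in> H \<longleftrightarrow> X \<in> U\<langle>0\<rangle> \<and> X \<in> V\<langle>0\<rangle>"
  using heart_shifted[of 0] iso_closed_H by simp

lemma H_ext: "tri D a X b f g h \<Longrightarrow> a \<in> H \<Longrightarrow> b \<in> H \<Longrightarrow> X \<in> H"
  unfolding H_iff using U_ext V_ext by blast

lemma H_retract: "retract X Y \<Longrightarrow> Y \<in> H \<Longrightarrow> X \<in> H"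
  unfolding H_iff using U_retract V_retract by blast

lemma H_zero: "zero_object D X \<Longrightarrow> X \<in> H"
  unfolding H_iff using U_zero V_zero by blast

text \<open>Truncation peels off the highest shift of the heart that occurs in X, and boundedness
  ends the process. Taking for S an orthogonal class or another aisle reduces a statement about
  aisles to one about hearts.\<close>

lemma aisle_generated:
  assumes S: "zeros \<subseteq> S" "S \<star> S \<subseteq> S" and HS: "\<And>n. n \<ge> n0 \<Longrightarrow> H\<langle>n\<rangle> \<subseteq> S"
  shows "U\<langle>n0\<rangle> \<subseteq> S"
proof
  \<comment> \<open>The number k counts the shifts n0, ..., n0 + k - 1 that may still occur; for k =
    0 the object is orthogonal to itself, hence zero.\<close>
  have *: "X \<in> S" if "X \<in> U\<langle>n0\<rangle>" "X \<in> V\<langle>n0 + int k - 1\<rangle>" for k X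
    using that
  proof (induction k arbitrary: X)
    case 0
    then show ?case using S orthogonal_self[OF orthogonal_UV] by fastforce
  next
    case (Suc k)
    obtain a b f g h where t: "a \<in> U\<langle>n0 + int k\<rangle>" "b \<in> V\<langle>n0 + int k - 1\<rangle>" "tri D a X b f g h"
      by (rule truncationE[OF refl])
    have X: "X \<in> V\<langle>n0 + int k\<rangle>" using Suc.prems by (simp add: algebra_simps)
    have "a \<in> V\<langle>n0 + int k\<rangle>" by (rule V_fiber[OF t(3) X t(2)]) simp
    then have "a \<in> S" using t HS[of "n0 + int k"] by (auto simp: heart_shifted)
    moreover have "b \<in> U\<langle>n0\<rangle>" by (rule U_cone[OF t(3) Suc.prems(1) t(1)]) simp
    then have "b \<in> S" using Suc.IH t by blast
    ultimately show ?case using S starI[OF t(3)] by blast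
  qed
  fix X assume X: "X \<in> U\<langle>n0\<rangle>"
  obtain n :: nat where "X \<in> V\<langle>int n\<rangle>" using bounded by blast
  then have "X \<in> V\<langle>n0 + int (nat (int n + 1 - n0)) - 1\<rangle>"
    using V_mono[of "int n" "n0 + int (nat (int n + 1 - n0)) - 1"] by auto
  with X show "X \<in> S" by (rule *)
qed

lemma coaisle_generated:
  assumes S: "zeros \<subseteq> S" "S \<star> S \<subseteq> S" and HS: "\<And>n. n \<le> n0 \<Longrightarrow> H\<langle>n\<rangle> \<subseteq> S"
  shows "V\<langle>n0\<rangle> \<subseteq> S"
proof
  have *: "X \<in> S" if "X \<in> V\<langle>n0\<rangle>" "X \<in> U\<langle>n0 - int k + 1\<rangle>" for k X
    using that
  proof (induction k arbitrary: X)
    case 0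
    then show ?case using S orthogonal_self[OF orthogonal_UV, of X "n0 + 1" n0] by auto
  next
    case (Suc k)
    obtain a b f g h where t: "a \<in> U\<langle>n0 - int k + 1\<rangle>" "b \<in> V\<langle>n0 - int k\<rangle>" "tri D a X b f g h"
      by (rule truncationE[of "n0 - int k" "n0 - int k + 1"]) simp
    have X: "X \<in> U\<langle>n0 - int k\<rangle>" using Suc.prems by (simp add: algebra_simps)
    have "b \<in> U\<langle>n0 - int k\<rangle>" by (rule U_cone[OF t(3) X t(1)]) simp
    then have "b \<in> S" using t HS[of "n0 - int k"] by (auto simp: heart_shifted)
    moreover have "a \<in> V\<langle>n0\<rangle>" by (rule V_fiber[OF t(3) Suc.prems(1) t(2)]) simp
    then have "a \<in> S" using Suc.IH t by blast
    ultimately show ?case using S starI[OF t(3)] by blast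
  qed
  fix X assume X: "X \<in> V\<langle>n0\<rangle>"
  obtain n :: nat where "X \<in> U\<langle>- int n\<rangle>" using bounded by blast
  then have "X \<in> U\<langle>n0 - int (nat (int n + 1 + n0)) + 1\<rangle>"
    using U_antimono[of "n0 - int (nat (int n + 1 + n0)) + 1" "- int n"] by auto
  with X show "X \<in> S" by (rule *)
qed

section \<open>The heart as an abelian category\<close>

text \<open>There are no nonzero maps from H[1] to H, so T[1] -> b vanishes and the first map of the
  triangle is left cancellable on the heart.\<close>

lemma heart_mono:
  assumes "tri D a X b f g h" "T \<in> H" "b \<in> H" "d \<in> Mor D T a" "f \<cdot> d = mzero D T X"
  shows "d = mzero D T a"
proof -
  have "sh D T \<in> U\<langle>1\<rangle>" using assms(2) sh_shifted[of T U 0] by (simp add: H_iff)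
  then have "orthogonal (sh D T) b" using assms(3) orthogonal_UV[of _ 1 _ 0] by (simp add: H_iff)
  with assms show ?thesis using tri_lift_unique by blast
qed

lemma heart_epi:
  assumes "tri D a X b f g h" "T \<in> H" "a \<in> H" "d \<in> Mor D b T" "d \<cdot> g = mzero D X T"
  shows "d = mzero D b T"
proof -
  have "sh D a \<in> U\<langle>1\<rangle>" using assms(3) sh_shifted[of a U 0] by (simp add: H_iff)
  then have "orthogonal (sh D a) T" using assms(2) orthogonal_UV[of _ 1 _ 0] by (simp add: H_iff)
  with assms show ?thesis using tri_extend_unique by blast
qed

text \<open>Truncating the cone of \<open>f\<close> gives \<open>k[1] \<rightarrow> cone f \<rightarrow> c\<close>; the octahedral axiom for
  \<open>B \<rightarrow> cone f \<rightarrow> c\<close> then produces the image \<open>I\<close>.\<close>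

lemma heart_factor:
  assumes A: "A \<in> H" and B: "B \<in> H" and f: "f \<in> Mor D A B"
  obtains k I c i e x m p y j C c' where "k \<in> H" "I \<in> H" "c \<in> H"
    "tri D k A I i e x" "tri D I B c m p y" "f = m \<cdot> e" "C \<in> {sh D k} \<star> {c}" "tri D A B C f j c'"
proof -
  obtain C g h where tC: "tri D A B C f g h" using TR1_cone[OF f] by blast
  obtain a c j p b where t: "a \<in> U\<langle>1\<rangle>" "c \<in> V\<langle>0\<rangle>" "tri D a C c j p b"
    by (rule truncationE[of 0 1]) simp
  obtain k where k: "isomorphic D a (sh D k)" "k \<in> U\<langle>0\<rangle>"
    using shift_family_unsh[OF shift_family_shifted0, of a U 0] t(1) by auto
  obtain j b where tk: "tri D (sh D k) C c j p b" using tri_isomorphic1[OF t(3) k(1)] by blast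
  have shk: "sh D k \<in> U\<langle>1\<rangle>" using sh_shifted[of k U 0] k by simp
  have "C \<in> U\<langle>0\<rangle>" by (rule U_cone[OF tC]) (use A B in \<open>auto simp: H_iff\<close>)
  then have "c \<in> U\<langle>0\<rangle>" by (rule U_cone[OF tk _ shk]) simp
  with t have c: "c \<in> H" by (simp add: H_iff)
  have "sh D A \<in> V\<langle>1\<rangle>" "B \<in> V\<langle>1\<rangle>"
    using A B sh_shifted[of A V 0] V_mono[of 0 1] by (auto simp: H_iff)
  then have "C \<in> V\<langle>1\<rangle>" using V_ext[OF tri_rotate[OF tC]] by blast
  then have "sh D k \<in> V\<langle>1\<rangle>" by (rule V_fiber[OF tk _ t(2)]) simp
  then have kH: "k \<in> H" using k sh_shifted[of k V 0] by (simp add: H_iff)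
  have pg: "p \<cdot> g \<in> Mor D B c" using tri_in(2)[OF tC] tri_in(2)[OF tk] by (rule cmp_in)
  obtain I m y where tI: "tri D I B c m (p \<cdot> g) y" using tri_fiber[OF pg] by blast
  from TR4[OF tri_rotate[OF tC] tri_rotate[OF tk] tri_rotate[OF tI]]
  obtain u v w where uv: "tri D (sh D A) (sh D I) (sh D (sh D k)) u v w"
    "neg (sh D I) (sh D B) (shm D m) \<cdot> u = neg (sh D A) (sh D B) (shm D f)" by blast
  obtain e g' h' where e: "e \<in> Mor D A I" "u = shm D e" "tri D A I (sh D k) e g' h'"
    using uv(1) by (rule tri_unsh)
  have m: "m \<in> Mor D I B" using tri_in[OF tI] by blast
  have "neg (sh D A) (sh D B) (shm D (m \<cdot> e)) = neg (sh D A) (sh D B) (shm D f)"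
    using uv(2) neg_cmp[OF shm_in[OF e(1)] shm_in[OF m]] shm_cmp[OF e(1) m] e(2) by simp
  then have "neg (sh D A) (sh D B) (neg (sh D A) (sh D B) (shm D (m \<cdot> e)))
    = neg (sh D A) (sh D B) (neg (sh D A) (sh D B) (shm D f))" by simp
  then have "shm D (m \<cdot> e) = shm D f"
    using neg_neg[OF shm_in[OF f]] neg_neg[OF shm_in[OF cmp_in[OF e(1) m]]] by simp
  then have fme: "f = m \<cdot> e" using shm_inj[OF cmp_in[OF e(1) m] f] by simp
  \<comment> \<open>The cone of e is k[1]. A backward rotation replaces k by an isomorphic Q, which
    serves as the kernel from here on.\<close>
  obtain Q i x where Q: "isomorphic D (sh D Q) (sh D k)" "tri D Q A I i e x"
    using tri_unrotate[OF e(3)] by blast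
  have Qk: "isomorphic D k Q" using Q(1) sh_isomorphic isomorphic_sym by blast
  have QH: "Q \<in> H" by (rule iso_closedD[OF iso_closed_H kH Qk])
  have "I \<in> U\<langle>0\<rangle>" by (rule U_cone[OF Q(2), of _ 0]) (use A QH in \<open>auto simp: H_iff\<close>)
  moreover have "I \<in> V\<langle>0\<rangle>" by (rule V_fiber[OF tI, of _ 0]) (use B c in \<open>auto simp: H_iff\<close>)
  ultimately have "I \<in> H" by (simp add: H_iff)
  \<comment> \<open>The shape of the cone is kept in the conclusion because \<open>wide_swap\<close>
    reads its cohomology from it.\<close>
  moreover obtain j' b' where "tri D (sh D Q) C c j' p b'"
    using tri_isomorphic1[OF tk isomorphic_sym[OF Q(1)]] by blast
  then have "C \<in> {sh D Q} \<star> {c}" by (blast intro: starI)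
  ultimately show thesis using that[OF QH _ c Q(2) tI fme _ tC] by blast
qed

text \<open>As m is left cancellable on H, a morphism killed by m e is already killed by e and lifts
  along i; the lift is unique because i is left cancellable as well.\<close>

lemma factor_kernel:
  assumes t: "tri D k A I i e x" "tri D I B c m p y"
    and H: "A \<in> H" "B \<in> H" "k \<in> H" "I \<in> H" "c \<in> H"
  shows "is_kernel D H A B (m \<cdot> e) k i"
  unfolding is_kernel_def
proof (intro conjI ballI impI)
  note in1 = tri_in[OF t(1)] and in2 = tri_in[OF t(2)]
  show "m \<cdot> e \<in> Mor D A B" using in1 in2 by (blast intro: cmp_in)
  show "(m \<cdot> e) \<cdot> i = mzero D k B"
    using cmp_assoc[OF in1(1,2) in2(1)] tri_comp_zero[OF t(1)] in2 by simp
  fix T s assume T: "T \<in> H" "s \<in> Mor D T A" "(m \<cdot> e) \<cdot> s = mzero D T B"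
  have "m \<cdot> (e \<cdot> s) = mzero D T B" using T cmp_assoc[OF T(2) in1(2) in2(1)] by simp
  then have "e \<cdot> s = mzero D T I"
    using heart_mono[OF t(2) T(1) H(5)] cmp_in[OF T(2) in1(2)] by blast
  then obtain u where u: "u \<in> Mor D T k" "i \<cdot> u = s" using tri_lift[OF t(1) T(2)] by blast
  show "\<exists>!u. u \<in> Mor D T k \<and> i \<cdot> u = s"
  proof (rule ex1I[of _ u], use u in simp)
    fix u' assume u': "u' \<in> Mor D T k \<and> i \<cdot> u' = s"
    have "i \<cdot> madd D u' (neg T k u) = mzero D T A"
      using cmp_madd[of u' T k "neg T k u" i A] cmp_neg[OF u(1) in1(1)] u u' in1
        madd_neg(1)[OF cmp_in[OF u(1) in1(1)]] by simp
    then have "madd D u' (neg T k u) = mzero D T k"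
      using heart_mono[OF t(1) T(1) H(4)] u u' by blast
    then show "u' = u" using madd_neg_eq_mzero u u' by blast
  qed
qed (use H tri_in[OF t(1)] in auto)

text \<open>As e is right cancellable, a morphism that kills m e kills m and extends along p,
  uniquely since p is right cancellable.\<close>

lemma factor_cokernel:
  assumes t: "tri D k A I i e x" "tri D I B c m p y"
    and H: "A \<in> H" "B \<in> H" "k \<in> H" "I \<in> H" "c \<in> H"
  shows "is_cokernel D H A B (m \<cdot> e) c p"
  unfolding is_cokernel_def
proof (intro conjI ballI impI)
  note in1 = tri_in[OF t(1)] and in2 = tri_in[OF t(2)]
  show "m \<cdot> e \<in> Mor D A B" using in1 in2 by (blast intro: cmp_in)
  show "p \<cdot> (m \<cdot> e) = mzero D A c"
    using cmp_assoc[OF in1(2) in2(1,2)] tri_comp_zero[OF t(2)] in1 by simp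
  fix T s assume T: "T \<in> H" "s \<in> Mor D B T" "s \<cdot> (m \<cdot> e) = mzero D A T"
  have "(s \<cdot> m) \<cdot> e = mzero D A T" using T cmp_assoc[OF in1(2) in2(1) T(2)] by simp
  then have "s \<cdot> m = mzero D I T"
    using heart_epi[OF t(1) T(1) H(3)] cmp_in[OF in2(1) T(2)] by blast
  then obtain u where u: "u \<in> Mor D c T" "u \<cdot> p = s" using tri_extend[OF t(2) T(2)] by blast
  show "\<exists>!u. u \<in> Mor D c T \<and> u \<cdot> p = s"
  proof (rule ex1I[of _ u], use u in simp)
    fix u' assume u': "u' \<in> Mor D c T \<and> u' \<cdot> p = s"
    have "madd D u' (neg c T u) \<cdot> p = mzero D B T"
      using madd_cmp[of p B c u' T "neg c T u"] neg_cmp[OF in2(2) u(1)] u u' in2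
        madd_neg(1)[OF cmp_in[OF in2(2) u(1)]] by simp
    then have "madd D u' (neg c T u) = mzero D c T"
      using heart_epi[OF t(2) T(1) H(4)] u u' by blast
    then show "u' = u" using madd_neg_eq_mzero u u' by blast
  qed
qed (use H tri_in[OF t(2)] in auto)

lemma tri_is_mono:
  assumes t: "tri D A B c i p x" and H: "A \<in> H" "B \<in> H" "c \<in> H"
  shows "is_mono D H A B i"
proof -
  obtain O' where O: "zero_object D O'" using ex_zero_object by blast
  \<comment> \<open>The map p is factored as itself followed by the identity, whose cokernel is a
    zero object.\<close>
  have "is_kernel D H B c (idm D c \<cdot> p) A i"
    by (rule factor_kernel[OF t TR1_id[OF O]]) (use H H_zero[OF O] in auto)
  then show ?thesis by (rule is_kernel_mono)
qed

text \<open>The monomorphism kills j, so j = 0; but j is left cancellable on H, so the identity of k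
  is zero.\<close>

lemma mono_kernel_zero:
  assumes i: "is_mono D H A B (m \<cdot> e)" and t: "tri D k A I j e x" "tri D I B c m p y"
    and H: "k \<in> H" "I \<in> H" "c \<in> H"
  shows "zero_object D k"
proof -
  have AB: "A \<in> H" "B \<in> H" using i by (auto simp: is_mono_def)
  have k: "is_kernel D H A B (m \<cdot> e) k j" by (rule factor_kernel[OF t AB H])
  have j: "j \<in> Mor D k A" and me: "m \<cdot> e \<in> Mor D A B" "(m \<cdot> e) \<cdot> j = mzero D k B"
    using k by (auto simp: is_kernel_def)
  have "(m \<cdot> e) \<cdot> j = (m \<cdot> e) \<cdot> mzero D k A" using me by simp
  then have "j = mzero D k A" using i j H mzero_in unfolding is_mono_def by blast
  then have "j \<cdot> idm D k = mzero D k A" using cmp_idm[OF j] by simp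
  then have "idm D k = mzero D k k" by (rule heart_mono[OF t(1) H(1,2) idm_in])
  then show ?thesis by (simp add: zero_object_iff)
qed

text \<open>The kernel vanishes, so A is isomorphic to the image and inherits its triangle. The new
  map A -> B is not tied to i: the applications look only at the vertices.\<close>

lemma mono_tri:
  assumes "is_mono D H A B i"
  obtains c f g h where "c \<in> H" "tri D A B c f g h"
proof -
  have AB: "A \<in> H" "B \<in> H" "i \<in> Mor D A B" using assms by (auto simp: is_mono_def)
  obtain k I c j e x m p y where f: "k \<in> H" "I \<in> H" "c \<in> H"
    "tri D k A I j e x" "tri D I B c m p y" "i = m \<cdot> e" using heart_factor[OF AB] by metis
  have "zero_object D k" using mono_kernel_zero[OF _ f(4,5,1,2,3)] assms f(6) by simp
  from isomorphic_sym[OF tri_first_zero[OF f(4) this]] tri_isomorphic1[OF f(5)] f(3) that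
  show thesis by blast
qed

lemma mono_cokernel_tri:
  assumes i: "is_mono D H A B i" and q: "is_cokernel D H A B i Q q"
  obtains f g h where "tri D A B Q f g h"
proof -
  have AB: "A \<in> H" "B \<in> H" "i \<in> Mor D A B" using assms by (auto simp: is_mono_def)
  obtain k I c j e x m p y where f: "k \<in> H" "I \<in> H" "c \<in> H"
    "tri D k A I j e x" "tri D I B c m p y" "i = m \<cdot> e" using heart_factor[OF AB] by metis
  have "zero_object D k" using mono_kernel_zero[OF _ f(4,5,1,2,3)] i f(6) by simp
  then obtain u v where t: "tri D A B c u p v"
    using isomorphic_sym[OF tri_first_zero[OF f(4)]] tri_isomorphic1[OF f(5)] by blast
  have "is_cokernel D H A B i c p" using factor_cokernel[OF f(4,5) AB(1,2) f(1-3)] f(6) by simp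
  from cokernels_isomorphic[OF this q] tri_isomorphic3[OF t] that show thesis by blast
qed

end

section \<open>Thick subcategories generated by wide subcategories\<close>

context triangulated_category
begin

lemma retract_trans:
  assumes "retract X Y" "retract Y Z" shows "retract X Z"
proof -
  obtain f g where f: "f \<in> Mor D X Y" "g \<in> Mor D Y X" "g \<cdot> f = idm D X"
    using assms(1) by (auto simp: retract_def)
  obtain a b where a: "a \<in> Mor D Y Z" "b \<in> Mor D Z Y" "b \<cdot> a = idm D Y"
    using assms(2) by (auto simp: retract_def)
  show ?thesis
    using sandwich_idm[OF f(1,2) a(1,2) f(3) a(3)] cmp_in[OF f(1) a(1)] cmp_in[OF a(2) f(2)]
    unfolding retract_def by blast
qed

lemma sh_retract: "retract (sh D X) (sh D Y) \<longleftrightarrow> retract X Y"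
proof
  assume "retract (sh D X) (sh D Y)"
  then obtain f' g' where f': "f' \<in> Mor D (sh D X) (sh D Y)" "g' \<in> Mor D (sh D Y) (sh D X)"
    "g' \<cdot> f' = idm D (sh D X)"
    by (auto simp: retract_def)
  obtain f where f: "f \<in> Mor D X Y" "f' = shm D f" using f'(1) by (rule shm_full)
  obtain g where g: "g \<in> Mor D Y X" "g' = shm D g" using f'(2) by (rule shm_full)
  have "g \<cdot> f = idm D X"
    by (rule shm_inj[OF cmp_in[OF f(1) g(1)] idm_in]) (use f' f(2) g(2) shm_cmp[OF f(1) g(1)] in \<open>simp add: shm_idm\<close>)
  then show "retract X Y" using f g by (auto simp: retract_def)
next
  assume "retract X Y"
  then obtain f g where f: "f \<in> Mor D X Y" "g \<in> Mor D Y X" "g \<cdot> f = idm D X"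
    by (auto simp: retract_def)
  then have "shm D g \<cdot> shm D f = idm D (sh D X)" by (simp add: shm_idm flip: shm_cmp[OF f(1,2)])
  then show "retract (sh D X) (sh D Y)" using f unfolding retract_def by blast
qed

text \<open>In the octahedron on f followed by the identity of Y one of the three cones is zero,
  which makes the other two isomorphic without a five lemma for triangles.\<close>

lemma cones_isomorphic:
  assumes t: "tri D X Y Z f g h" and t': "tri D X Y Z' f g' h'"
  shows "isomorphic D Z Z'"
proof -
  obtain O' where O: "zero_object D O'" using ex_zero_object by blast
  have "tri D X Y Z' (idm D Y \<cdot> f) g' h'" using t' idm_cmp[OF tri_in(1)[OF t]] by simp
  from TR4[OF t TR1_id[OF O] this] obtain u v w where "tri D Z Z' O' u v w" by blast
  then show ?thesis using O by (rule tri_third_zero)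
qed

end

context bounded_t_category
begin

lemma tri_short_exact:
  assumes t: "tri D A E B i p x" and H: "A \<in> H" "E \<in> H" "B \<in> H"
  shows "short_exact D H A E B i p"
proof -
  obtain O' where O: "zero_object D O'" using ex_zero_object by blast
  have "is_kernel D H E B (idm D B \<cdot> p) A i"
    by (rule factor_kernel[OF t TR1_id[OF O]]) (use H H_zero[OF O] in auto)
  moreover have "is_cokernel D H A E (i \<cdot> idm D A) B p"
    by (rule factor_cokernel[OF tri_zero_left[OF O] t]) (use H H_zero[OF O] in auto)
  ultimately show ?thesis
    using idm_cmp[OF tri_in(2)[OF t]] cmp_idm[OF tri_in(1)[OF t]] by (simp add: short_exact_def)
qed

lemma short_exact_tri:
  assumes "short_exact D H A E B i p"
  obtains f g h where "tri D A E B f g h"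
  using assms is_kernel_mono mono_cokernel_tri unfolding short_exact_def by blast

context
  fixes W assumes W: "W \<in> Wide D H"
begin

lemma wide_subset: "W \<subseteq> H"
  using W by (auto simp: Wide_def)

lemma wide_kernel: "is_kernel D H A B f N i \<Longrightarrow> A \<in> W \<Longrightarrow> B \<in> W \<Longrightarrow> N \<in> W"
  using W unfolding Wide_def by blast

lemma wide_cokernel: "is_cokernel D H A B f Q p \<Longrightarrow> A \<in> W \<Longrightarrow> B \<in> W \<Longrightarrow> Q \<in> W"
  using W unfolding Wide_def by blast

text \<open>Closure under summands is not among the conditions of \<open>Wide\<close>. It follows
  because X is the kernel of i p - id on A; closure under isomorphism follows in turn.\<close>

lemma wide_retract:
  assumes r: "retract X A" and A: "A \<in> W" shows "X \<in> W"
proof -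
  obtain i p where ip: "i \<in> Mor D X A" "p \<in> Mor D A X" "p \<cdot> i = idm D X"
    using r by (auto simp: retract_def)
  have AH: "A \<in> H" using A wide_subset by blast
  have XH: "X \<in> H" using H_retract[OF r AH] .
  have e: "i \<cdot> p \<in> Mor D A A" using ip by (blast intro: cmp_in)
  let ?q = "madd D (i \<cdot> p) (neg A A (idm D A))"
  have q: "?q \<in> Mor D A A" using e idm_in by simp
  have qcmp: "?q \<cdot> t = madd D (i \<cdot> (p \<cdot> t)) (neg T A t)" if t: "t \<in> Mor D T A" for T t
    using madd_cmp[OF t e neg_in[OF idm_in]] neg_cmp[OF t idm_in] idm_cmp[OF t]
      cmp_assoc[OF t ip(2,1)] by simp
  have "is_kernel D H A A ?q X i"
    unfolding is_kernel_def
  proof (intro conjI ballI impI)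
    show "?q \<cdot> i = mzero D X A" using qcmp[OF ip(1)] ip cmp_idm[OF ip(1)] by simp
    fix T t assume T: "T \<in> H" "t \<in> Mor D T A" "?q \<cdot> t = mzero D T A"
    have ipt: "i \<cdot> (p \<cdot> t) = t"
      by (rule madd_neg_eq_mzero) (use T qcmp[OF T(2)] ip in \<open>auto intro: cmp_in\<close>)
    show "\<exists>!u. u \<in> Mor D T X \<and> i \<cdot> u = t"
    proof (rule ex1I[of _ "p \<cdot> t"])
      show "p \<cdot> t \<in> Mor D T X \<and> i \<cdot> (p \<cdot> t) = t" using ipt T ip by (blast intro: cmp_in)
      fix u assume "u \<in> Mor D T X \<and> i \<cdot> u = t"
      then show "u = p \<cdot> t"
        using cmp_assoc[of u T X i A p X] ip idm_cmp[of u T X] by auto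
    qed
  qed (use AH XH q ip in auto)
  then show ?thesis using wide_kernel A by blast
qed

lemma wide_iso_closed: "iso_closed D W"
  unfolding iso_closed_def using wide_retract isomorphic_retract isomorphic_sym by blast

lemma wide_zero: "zero_object D X \<Longrightarrow> X \<in> W"
  using W wide_iso_closed zero_objects_isomorphic unfolding Wide_def iso_closed_def by blast

lemma wide_star: "W \<star> W \<subseteq> W"
proof
  fix E assume "E \<in> W \<star> W"
  then obtain A B i p x where t: "A \<in> W" "B \<in> W" "tri D A E B i p x" by (rule starE)
  then have "short_exact D H A E B i p"
    using tri_short_exact H_ext wide_subset by blast
  then show "E \<in> W" using W t unfolding Wide_def by blast
qed

lemma wide_star_shifted: "W\<langle>n\<rangle> \<star> W\<langle>n\<rangle> \<subseteq> W\<langle>n\<rangle>"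
  using shifted_mono[OF wide_star, of n] shifted_star[OF wide_iso_closed wide_iso_closed, of n] by simp

text \<open>Writing B as Q[1] makes Y the cone of a morphism Q -> A of W. That cone is built from
  the shifted kernel, in W[1], and the cokernel, in W, now in the opposite order.\<close>

lemma wide_swap: "W \<star> W\<langle>1\<rangle> \<subseteq> W\<langle>1\<rangle> \<star> W"
proof
  fix Y assume "Y \<in> W \<star> W\<langle>1\<rangle>"
  then obtain A B f g h where t: "A \<in> W" "B \<in> W\<langle>1\<rangle>" "tri D A Y B f g h" by (rule starE)
  obtain Q e h' where Q: "isomorphic D (sh D Q) B" "tri D Q A Y e f h'"
    using tri_unrotate[OF t(3)] by blast
  have "sh D Q \<in> W\<langle>1\<rangle>" by (rule iso_closedD[OF iso_closed_shifted t(2) isomorphic_sym[OF Q(1)]])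
  then have QW: "Q \<in> W" by (simp add: sh_shifted1 wide_iso_closed)
  have QA: "Q \<in> H" "A \<in> H" using QW t(1) wide_subset by auto
  obtain k I c i e' x m p y j C c' where fac: "k \<in> H" "I \<in> H" "c \<in> H" "tri D k Q I i e' x"
    "tri D I A c m p y" "e = m \<cdot> e'" "C \<in> {sh D k} \<star> {c}" "tri D Q A C e j c'"
    using heart_factor[OF QA tri_in(1)[OF Q(2)]] by metis
  have "k \<in> W" "c \<in> W"
    using factor_kernel[OF fac(4,5) QA fac(1-3)] factor_cokernel[OF fac(4,5) QA fac(1-3)]
      wide_kernel wide_cokernel QW t(1) by blast+
  then have "C \<in> W\<langle>1\<rangle> \<star> W"
    using fac(7) star_mono[of "{sh D k}" "W\<langle>1\<rangle>" "{c}" W] sh_shifted1[OF wide_iso_closed] by auto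
  then show "Y \<in> W\<langle>1\<rangle> \<star> W"
    by (rule iso_closedD[OF iso_closed_star _ cones_isomorphic[OF fac(8) Q(2)]])
qed

lemma wide_swap_shifted: "W\<langle>n - 1\<rangle> \<star> W\<langle>n\<rangle> \<subseteq> W\<langle>n\<rangle> \<star> W\<langle>n - 1\<rangle>"
  using shifted_mono[OF wide_swap, of "n - 1"]
  by (simp add: shifted_star iso_closed_shifted wide_iso_closed shifted_shifted)

lemma wide_retract_shifted: "retract X Y \<Longrightarrow> Y \<in> W\<langle>n\<rangle> \<Longrightarrow> X \<in> W\<langle>n\<rangle>"
proof -
  have "\<forall>X Y. retract X Y \<longrightarrow> Y \<in> W\<langle>n\<rangle> \<longrightarrow> X \<in> W\<langle>n\<rangle>"
  proof (rule shift_family_induct[where m = 0])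
    show "\<forall>X Y. retract X Y \<longrightarrow> Y \<in> W\<langle>0\<rangle> \<longrightarrow> X \<in> W\<langle>0\<rangle>"
      using wide_retract wide_iso_closed by simp
    fix n
    show "(\<forall>X Y. retract X Y \<longrightarrow> Y \<in> W\<langle>n\<rangle> \<longrightarrow> X \<in> W\<langle>n\<rangle>)
      \<longleftrightarrow> (\<forall>X Y. retract X Y \<longrightarrow> Y \<in> W\<langle>n + 1\<rangle> \<longrightarrow> X \<in> W\<langle>n + 1\<rangle>)"
    proof (intro iffI allI impI)
      fix X Y assume *: "\<forall>X Y. retract X Y \<longrightarrow> Y \<in> W\<langle>n\<rangle> \<longrightarrow> X \<in> W\<langle>n\<rangle>"
        and XY: "retract X Y" "Y \<in> W\<langle>n + 1\<rangle>"
      obtain Y' where Y': "isomorphic D Y (sh D Y')" "Y' \<in> W\<langle>n\<rangle>"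
        using shift_family_unsh[OF shift_family_shifted0 XY(2)] .
      obtain X' where X': "isomorphic D X (sh D X')" using sh_ess_surj isomorphic_sym by blast
      have "retract (sh D X') (sh D Y')"
        by (rule retract_trans[OF isomorphic_retract[OF isomorphic_sym[OF X']]
            retract_trans[OF XY(1) isomorphic_retract[OF Y'(1)]]])
      then have "sh D X' \<in> W\<langle>n + 1\<rangle>" using * Y' by (auto simp: sh_retract sh_shifted)
      then show "X \<in> W\<langle>n + 1\<rangle>"
        by (rule iso_closedD[OF iso_closed_shifted _ isomorphic_sym[OF X']])
    next
      fix X Y assume *: "\<forall>X Y. retract X Y \<longrightarrow> Y \<in> W\<langle>n + 1\<rangle> \<longrightarrow> X \<in> W\<langle>n + 1\<rangle>"
        and XY: "retract X Y" "Y \<in> W\<langle>n\<rangle>"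
      then show "X \<in> W\<langle>n\<rangle>" using sh_retract sh_shifted by blast
    qed
  qed
  then show "retract X Y \<Longrightarrow> Y \<in> W\<langle>n\<rangle> \<Longrightarrow> X \<in> W\<langle>n\<rangle>" by blast
qed

end

text \<open>Objects with \<open>i\<close>-th cohomology in \<open>W\<close> for all \<open>i\<close>, concentrated in the \<open>m\<close> degrees
  \<open>-n, \<dots>, -n + m - 1\<close>.\<close>

primrec tower :: "'o set \<Rightarrow> nat \<Rightarrow> int \<Rightarrow> 'o set"
  where
    "tower W 0 n = zeros"
  | "tower W (Suc m) n = W\<langle>n\<rangle> \<star> tower W m (n - 1)"

lemma shift_family_tower: "shift_family (tower W m)"
proof (induction m)
  case 0 then show ?case using shift_family_zeros by (simp add: shift_family_def)
next
  case (Suc m)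
  have "shift_family (\<lambda>n. tower W m (n - 1))"
    using Suc unfolding shift_family_def by (metis add_diff_eq diff_add_eq)
  from shift_family_star[OF shift_family_shifted0 this]
  show ?case by (simp add: shift_family_def)
qed

text \<open>The maps i and p induce maps between the truncations, because nothing maps from
  \<open>U\<langle>n\<rangle>\<close> to \<open>V\<langle>n - 1\<rangle>\<close>. The composites are
  identities by the uniqueness of such induced maps.\<close>

lemma truncation_retract:
  assumes r: "retract X Y"
    and X: "a \<in> U\<langle>n\<rangle>" "b \<in> V\<langle>n - 1\<rangle>" "tri D a X b f g h"
    and Y: "a' \<in> U\<langle>n\<rangle>" "b' \<in> V\<langle>n - 1\<rangle>" "tri D a' Y b' f' g' h'"
  shows "retract a a'" "retract b b'"
proof -
  obtain i p where ip: "i \<in> Mor D X Y" "p \<in> Mor D Y X" "p \<cdot> i = idm D X"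
    using r by (auto simp: retract_def)
  note fX = tri_in[OF X(3)] and fY = tri_in[OF Y(3)]
  have sha: "sh D a \<in> U\<langle>n\<rangle>" using X(1) U_antimono[of n "n + 1"] sh_shifted by auto
  have o: "orthogonal a b'" "orthogonal a' b" "orthogonal (sh D a) b"
    using orthogonal_UV[OF X(1) Y(2)] orthogonal_UV[OF Y(1) X(2)] orthogonal_UV[OF sha X(2)] by auto
  have "g' \<cdot> (i \<cdot> f) = mzero D a b'"
    using o cmp_in[OF cmp_in[OF fX(1) ip(1)] fY(2)] by blast
  then obtain s where s: "s \<in> Mor D a a'" "f' \<cdot> s = i \<cdot> f"
    using tri_lift[OF Y(3) cmp_in[OF fX(1) ip(1)]] by blast
  have "g \<cdot> (p \<cdot> f') = mzero D a' b"
    using o cmp_in[OF cmp_in[OF fY(1) ip(2)] fX(2)] by blast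
  then obtain t where t: "t \<in> Mor D a' a" "f \<cdot> t = p \<cdot> f'"
    using tri_lift[OF X(3) cmp_in[OF fY(1) ip(2)]] by blast
  have "f \<cdot> (t \<cdot> s) = (f \<cdot> t) \<cdot> s" using cmp_assoc[OF s(1) t(1) fX(1)] by simp
  also have "\<dots> = p \<cdot> (i \<cdot> f)" using cmp_assoc[OF s(1) fY(1) ip(2)] s t by simp
  also have "\<dots> = f" using cmp_assoc[OF fX(1) ip(1,2)] ip idm_cmp[OF fX(1)] by simp
  finally have "t \<cdot> s = idm D a" by (rule tri_lift_idm[OF X(3) cmp_in[OF s(1) t(1)] _ o(3)])
  then show "retract a a'" using s t by (auto simp: retract_def)
  have "(g' \<cdot> i) \<cdot> f = mzero D a b'"
    using o cmp_in[OF fX(1) cmp_in[OF ip(1) fY(2)]] by blast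
  then obtain s where s: "s \<in> Mor D b b'" "s \<cdot> g = g' \<cdot> i"
    using tri_extend[OF X(3) cmp_in[OF ip(1) fY(2)]] by blast
  have "(g \<cdot> p) \<cdot> f' = mzero D a' b"
    using o cmp_in[OF fY(1) cmp_in[OF ip(2) fX(2)]] by blast
  then obtain t where t: "t \<in> Mor D b' b" "t \<cdot> g' = g \<cdot> p"
    using tri_extend[OF Y(3) cmp_in[OF ip(2) fX(2)]] by blast
  have "(t \<cdot> s) \<cdot> g = (t \<cdot> g') \<cdot> i"
    using cmp_assoc[OF fX(2) s(1) t(1)] cmp_assoc[OF ip(1) fY(2) t(1)] s by simp
  also have "\<dots> = g" using cmp_assoc[OF ip(1,2) fX(2)] t ip cmp_idm[OF fX(2)] by simp
  finally have "t \<cdot> s = idm D b" by (rule tri_extend_idm[OF X(3) cmp_in[OF s(1) t(1)] _ o(3)])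
  then show "retract b b'" using s t by (auto simp: retract_def)
qed

context
  fixes W assumes W: "W \<in> Wide D H"
begin

lemma wide_shifted_UV: "W\<langle>n\<rangle> \<subseteq> U\<langle>n\<rangle>" "W\<langle>n\<rangle> \<subseteq> V\<langle>n\<rangle>"
  using shifted_mono[OF wide_subset[OF W], of n] by (auto simp: heart_shifted)

lemma zeros_wide_shifted: "zeros \<subseteq> W\<langle>n\<rangle>"
  by (rule shift_family_subset[OF shift_family_zeros shift_family_shifted0, where m = 0])
    (use wide_zero[OF W] wide_iso_closed[OF W] in auto)

lemma tower_V: "tower W m n \<subseteq> V\<langle>n\<rangle>"
proof (induction m arbitrary: n)
  case 0 then show ?case using V_zero by auto
next
  case (Suc m)
  have "tower W m (n - 1) \<subseteq> V\<langle>n\<rangle>" by (rule order_trans[OF Suc V_mono]) simp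
  from order_trans[OF star_mono[OF wide_shifted_UV(2) this] V_star] show ?case by simp
qed

lemma tower_iso_closed: "iso_closed D (tower W m n)"
  by (rule shift_family_iso_closed[OF shift_family_tower])

text \<open>Zero layers are added on the right, where the shifts are lower;
  \<open>tower_mono2\<close> adds them on the left.\<close>

lemma tower_mono1: "tower W m n \<subseteq> tower W (m + k) n"
proof (induction m arbitrary: n)
  case 0
  have "zeros \<subseteq> tower W k n" for n
  proof (induction k arbitrary: n)
    case (Suc k)
    then show ?case
      using star_mono[OF zeros_wide_shifted[of n] Suc[of "n - 1"]] zeros_star[OF iso_closed_zeros] by simp
  qed simp
  then show ?case by simp
next
  case (Suc m) show ?case using star_mono[OF order_refl Suc] by simp
qed

lemma tower_mono2: "tower W m n \<subseteq> tower W (m + k) (n + int k)"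
proof (induction k)
  case (Suc k)
  have "tower W (m + k) (n + int k) = zeros \<star> tower W (m + k) (n + int k)"
    using zeros_star[OF tower_iso_closed] by simp
  also have "\<dots> \<subseteq> tower W (m + Suc k) (n + int (Suc k))"
    using star_mono[OF zeros_wide_shifted[of "n + int k + 1"] order_refl] by (simp add: algebra_simps)
  finally show ?case using Suc by blast
qed simp

text \<open>Both towers are raised to the larger leading shift N and then lengthened to a common
  length. Closure of each tower under extensions thereby gives closure of their union.\<close>

lemma tower_directed: "\<exists>m'' n''. tower W m n \<union> tower W m' n' \<subseteq> tower W m'' n''"
proof -
  define N where "N = max n n'"
  have "tower W m n \<subseteq> tower W (m + nat (N - n)) N"
    using tower_mono2[of m n "nat (N - n)"] by (simp add: N_def)
  also have "\<dots> \<subseteq> tower W (m + nat (N - n) + (m' + nat (N - n'))) N"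
    by (rule tower_mono1)
  finally have 1: "tower W m n \<subseteq> tower W (m + nat (N - n) + (m' + nat (N - n'))) N" .
  have "tower W m' n' \<subseteq> tower W (m' + nat (N - n')) N"
    using tower_mono2[of m' n' "nat (N - n')"] by (simp add: N_def)
  also have "\<dots> \<subseteq> tower W (m' + nat (N - n') + (m + nat (N - n))) N"
    by (rule tower_mono1)
  finally have "tower W m' n' \<subseteq> tower W (m + nat (N - n) + (m' + nat (N - n'))) N"
    by (simp add: add.commute)
  with 1 show ?thesis by blast
qed

text \<open>There are no nonzero maps from \<open>W[n]\<close> to objects in lower shifts, except to
  \<open>W[n - 1][1]\<close>, where \<open>wide_swap\<close> applies.\<close>

lemma tower_swap: "tower W m (n - 1) \<star> W\<langle>n\<rangle> \<subseteq> W\<langle>n\<rangle> \<star> tower W m (n - 1)"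
proof (cases m)
  case 0
  then show ?thesis by (simp add: zeros_star star_zeros iso_closed_shifted)
next
  case (Suc m')
  let ?T = "tower W m' (n - 1 - 1)"
  have "?T \<star> W\<langle>n\<rangle> \<subseteq> W\<langle>n\<rangle> \<star> ?T"
  proof
    fix X assume "X \<in> ?T \<star> W\<langle>n\<rangle>"
    then obtain a b f g h where t: "a \<in> ?T" "b \<in> W\<langle>n\<rangle>" "tri D a X b f g h" by (rule starE)
    have "a \<in> V\<langle>n - 1 - 1\<rangle>" using t tower_V by blast
    then have "sh D a \<in> V\<langle>n - 1\<rangle>" using sh_shifted[of a V "n - 1 - 1"] by simp
    moreover have "b \<in> U\<langle>n\<rangle>" using t wide_shifted_UV by blast
    ultimately have "orthogonal b (sh D a)" using orthogonal_UV by simp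
    \<comment> \<open>The triangle splits, so its outer vertices may change places.\<close>
    then have "h = mzero D b (sh D a)" using tri_in(3)[OF t(3)] by simp
    then obtain f g h where "tri D b X a f g h" using tri_split_swap t(3) by blast
    then show "X \<in> W\<langle>n\<rangle> \<star> ?T" by (rule starI[OF _ t(2,1)])
  qed
  \<comment> \<open>Only the layer \<open>W\<langle>n - 1\<rangle>\<close> is left to pass; there
    the connecting map need not vanish.\<close>
  then have "W\<langle>n - 1\<rangle> \<star> (?T \<star> W\<langle>n\<rangle>) \<subseteq> (W\<langle>n - 1\<rangle> \<star> W\<langle>n\<rangle>) \<star> ?T"
    unfolding star_assoc by (rule star_mono[OF order_refl])
  also have "\<dots> \<subseteq> (W\<langle>n\<rangle> \<star> W\<langle>n - 1\<rangle>) \<star> ?T"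
    by (rule star_mono[OF wide_swap_shifted[OF W] order_refl])
  finally show ?thesis by (simp add: Suc star_assoc)
qed

text \<open>The leading layer of the second tower is moved left past the tail of the first and
  merged with the equal layer there; the two tails are merged by induction.\<close>

lemma tower_star: "tower W m n \<star> tower W m n \<subseteq> tower W m n"
proof (induction m arbitrary: n)
  case 0 then show ?case by (simp add: zeros_star iso_closed_zeros)
next
  case (Suc m)
  let ?T = "tower W m (n - 1)"
  have "tower W (Suc m) n \<star> tower W (Suc m) n = W\<langle>n\<rangle> \<star> ((?T \<star> W\<langle>n\<rangle>) \<star> ?T)"
    by (simp add: star_assoc)
  also have "\<dots> \<subseteq> W\<langle>n\<rangle> \<star> ((W\<langle>n\<rangle> \<star> ?T) \<star> ?T)"
    by (intro star_mono tower_swap order_refl)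
  also have "\<dots> = (W\<langle>n\<rangle> \<star> W\<langle>n\<rangle>) \<star> (?T \<star> ?T)" by (simp add: star_assoc)
  also have "\<dots> \<subseteq> W\<langle>n\<rangle> \<star> ?T" by (intro star_mono wide_star_shifted[OF W] Suc)
  finally show ?case by simp
qed

text \<open>The leading layer of Y and the rest are its truncations at n, so truncating X gives
  retracts of both, and W is closed under retracts.\<close>

lemma tower_retract: "retract X Y \<Longrightarrow> Y \<in> tower W m n \<Longrightarrow> X \<in> tower W m n"
proof (induction m arbitrary: n X Y)
  case 0 then show ?case using zero_object_retract by simp
next
  case (Suc m)
  obtain a' b' f' g' h' where Y: "a' \<in> W\<langle>n\<rangle>" "b' \<in> tower W m (n - 1)" "tri D a' Y b' f' g' h'"
    using Suc.prems by (auto elim: starE)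
  have UV: "a' \<in> U\<langle>n\<rangle>" "b' \<in> V\<langle>n - 1\<rangle>" using Y wide_shifted_UV tower_V by blast+
  obtain a b f g h where X: "a \<in> U\<langle>n\<rangle>" "b \<in> V\<langle>n - 1\<rangle>" "tri D a X b f g h"
    by (rule truncationE[OF refl])
  note r = truncation_retract[OF Suc.prems(1) X UV Y(3)]
  have "a \<in> W\<langle>n\<rangle>" "b \<in> tower W m (n - 1)"
    using r Y wide_retract_shifted[OF W] Suc.IH by auto
  then show ?case using starI[OF X(3)] by simp
qed

lemma thick_towers: "thick_subcategory D {X. \<exists>m n. X \<in> tower W m n}" (is "thick_subcategory D ?T")
  unfolding thick_subcategory_def iso_closed_def mem_Collect_eq
proof (intro conjI allI impI)
  show "\<exists>m n. Y \<in> tower W m n" if "\<exists>m n. X \<in> tower W m n" "isomorphic D X Y" for X Y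
    using that iso_closedD[OF tower_iso_closed] by meson
  obtain O' where O: "zero_object D O'" using ex_zero_object by blast
  then have "O' \<in> tower W 0 0" by simp
  then show "\<exists>X\<in>?T. zero_object D X" using O by (intro bexI[of _ O'] CollectI exI)
  show sh: "(\<exists>m n. sh D X \<in> tower W m n) \<longleftrightarrow> (\<exists>m n. X \<in> tower W m n)" for X
  proof
    assume "\<exists>m n. sh D X \<in> tower W m n"
    then obtain m n where "sh D X \<in> tower W m (n - 1 + 1)" by auto
    then show "\<exists>m n. X \<in> tower W m n" unfolding shift_family_sh[OF shift_family_tower] by (intro exI)
  next
    assume "\<exists>m n. X \<in> tower W m n"
    then obtain m n where "sh D X \<in> tower W m (n + 1)"
      by (auto simp: shift_family_sh[OF shift_family_tower])
    then show "\<exists>m n. sh D X \<in> tower W m n" by (intro exI)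
  qed
  show "\<exists>m n. Z \<in> tower W m n"
    if t: "tri D X Y Z f g h" and XY: "\<exists>m n. X \<in> tower W m n" "\<exists>m n. Y \<in> tower W m n" for X Y Z f g h
  proof -
    obtain m n where m: "Y \<in> tower W m n" using XY by blast
    obtain m' n' where m': "sh D X \<in> tower W m' n'" using XY sh[of X] by blast
    obtain M N where "tower W m n \<union> tower W m' n' \<subseteq> tower W M N" using tower_directed by blast
    then have "Y \<in> tower W M N" "sh D X \<in> tower W M N" using m m' by auto
    \<comment> \<open>After rotation Z lies between Y and X[1].\<close>
    from subsetD[OF tower_star starI[OF tri_rotate[OF t] this]] show ?thesis by (intro exI)
  qed
  show "\<exists>m n. X \<in> tower W m n" if "biproduct D X Y S" "\<exists>m n. S \<in> tower W m n" for X Y S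
    using that tower_retract[OF biproduct_retract] by meson
qed

text \<open>If n > 0, the leading layer maps to X by zero, so X is a retract of the rest and
  induction applies. Otherwise X maps to the rest by zero and is a retract of the leading layer in
  \<open>W\<langle>n\<rangle>\<close>; this is W for n = 0 and forces X = 0 for n < 0.\<close>

lemma heart_tower: "X \<in> H \<Longrightarrow> X \<in> tower W m n \<Longrightarrow> X \<in> W"
proof (induction m arbitrary: n)
  case 0 then show ?case using wide_zero[OF W] by simp
next
  case (Suc m)
  obtain a b f g h where t: "a \<in> W\<langle>n\<rangle>" "b \<in> tower W m (n - 1)" "tri D a X b f g h"
    using Suc.prems by (auto elim: starE)
  have UV: "a \<in> U\<langle>n\<rangle>" "b \<in> V\<langle>n - 1\<rangle>" using t wide_shifted_UV tower_V by blast+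
  have X: "X \<in> U\<langle>0\<rangle>" "X \<in> V\<langle>0\<rangle>" using Suc.prems by (auto simp: H_iff)
  show "X \<in> W"
  proof (cases "n > 0")
    case True
    then have "f = mzero D a X" using orthogonal_UV[OF UV(1) X(2)] tri_in(1)[OF t(3)] by simp
    then have "retract X b" using tri_retract_right t(3) by simp
    then have "X \<in> tower W m (n - 1)" using tower_retract t(2) by blast
    then show ?thesis by (rule Suc.IH[OF Suc.prems(1)])
  next
    case False
    then have "g = mzero D X b" using orthogonal_UV[OF X(1) UV(2)] tri_in(2)[OF t(3)] by simp
    then have "retract X a" using tri_retract_left t(3) by simp
    then have XW: "X \<in> W\<langle>n\<rangle>" using wide_retract_shifted[OF W] t by blast
    show ?thesis
    proof (cases "n = 0")
      case True then show ?thesis using XW wide_iso_closed[OF W] by simp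
    next
      case nz: False
      have "X \<in> V\<langle>n\<rangle>" using XW wide_shifted_UV(2) by blast
      then have "orthogonal X X" using orthogonal_UV[OF X(1)] nz False by simp
      then show ?thesis using orthogonal_self wide_zero[OF W] by blast
    qed
  qed
qed

lemma thick_wide_Int_heart: "thick D W \<inter> H = W"
proof
  have "W = tower W 1 0" using star_zeros[OF wide_iso_closed[OF W]] wide_iso_closed[OF W] by simp
  then have "W \<subseteq> {X. \<exists>m n. X \<in> tower W m n}" by blast
  then have "thick D W \<subseteq> {X. \<exists>m n. X \<in> tower W m n}"
    unfolding thick_def using thick_towers by (intro Inter_lower CollectI conjI)
  then show "thick D W \<inter> H \<subseteq> W" using heart_tower by blast
  show "W \<subseteq> thick D W \<inter> H" using wide_subset[OF W] by (auto simp: thick_def)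
qed

end

end

section \<open>Objects of slope zero\<close>

context additive_category
begin

lemma is_mono_comp:
  assumes "is_mono D H A B f" "is_mono D H B C g" shows "is_mono D H A C (g \<cdot> f)"
  unfolding is_mono_def
proof (intro conjI ballI impI)
  have fg: "f \<in> Mor D A B" "g \<in> Mor D B C" using assms by (auto simp: is_mono_def)
  then show "g \<cdot> f \<in> Mor D A C" by (rule cmp_in)
  fix T s t assume T: "T \<in> H" "s \<in> Mor D T A" "t \<in> Mor D T A" "(g \<cdot> f) \<cdot> s = (g \<cdot> f) \<cdot> t"
  then have "g \<cdot> (f \<cdot> s) = g \<cdot> (f \<cdot> t)" using cmp_assoc fg by metis
  then have "f \<cdot> s = f \<cdot> t"
    using assms(2) T cmp_in[OF _ fg(1)] unfolding is_mono_def by blast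
  then show "s = t" using assms(1) T unfolding is_mono_def by blast
qed (use assms in \<open>auto simp: is_mono_def\<close>)

lemma is_mono_cancel:
  assumes gf: "is_mono D H A C (g \<cdot> f)" and f: "f \<in> Mor D A B" and g: "g \<in> Mor D B C" and B: "B \<in> H"
  shows "is_mono D H A B f"
  unfolding is_mono_def
proof (intro conjI ballI impI)
  fix T s t assume T: "T \<in> H" "s \<in> Mor D T A" "t \<in> Mor D T A" "f \<cdot> s = f \<cdot> t"
  then have "(g \<cdot> f) \<cdot> s = (g \<cdot> f) \<cdot> t" using cmp_assoc[OF _ f g] by simp
  then show "s = t" using gf T unfolding is_mono_def by blast
qed (use gf f B in \<open>auto simp: is_mono_def\<close>)

end

section \<open>Additive functions on objects\<close>

context triangulated_category
begin

text \<open>These are the real functions on objects that factor through a homomorphism from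
  K(D).\<close>

definition tri_additive :: "('o \<Rightarrow> real) \<Rightarrow> bool"
  where "tri_additive v \<longleftrightarrow> (\<forall>X Y Z f g h. tri D X Y Z f g h \<longrightarrow> v Y = v X + v Z)"

lemma tri_additiveD: "tri_additive v \<Longrightarrow> tri D X Y Z f g h \<Longrightarrow> v Y = v X + v Z"
  unfolding tri_additive_def by blast

lemma additive_zero: "tri_additive v \<Longrightarrow> zero_object D X \<Longrightarrow> v X = 0"
  using tri_additiveD[OF _ TR1_id, of v X X] by simp

lemma additive_iso:
  assumes "tri_additive v" "isomorphic D X Y" shows "v X = v Y"
proof -
  obtain O' where O: "zero_object D O'" using ex_zero_object by blast
  obtain f g h where "tri D X Y O' f g h" using tri_isomorphic2[OF TR1_id[OF O] assms(2)] by blast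
  then show ?thesis using tri_additiveD[OF assms(1)] additive_zero[OF assms(1) O] by fastforce
qed

lemma additive_sh:
  assumes "tri_additive v" shows "v (sh D X) = - v X"
proof -
  obtain O' where O: "zero_object D O'" using ex_zero_object by blast
  show ?thesis
    using tri_additiveD[OF assms tri_rotate[OF TR1_id[OF O, of X]]] additive_zero[OF assms O] by simp
qed

lemma shifted_unsh_funpow: "Y \<in> S\<langle>int n + m\<rangle> \<Longrightarrow> \<exists>X\<in>S\<langle>m\<rangle>. isomorphic D Y ((sh D ^^ n) X)"
proof (induction n arbitrary: Y)
  case 0 then show ?case by (auto intro: bexI[of _ Y])
next
  case (Suc n)
  then have "Y \<in> S\<langle>int n + m + 1\<rangle>" by (simp add: algebra_simps)
  then obtain Y' where Y': "isomorphic D Y (sh D Y')" "Y' \<in> S\<langle>int n + m\<rangle>"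
    using shift_family_unsh[OF shift_family_shifted0] by blast
  then obtain X where X: "X \<in> S\<langle>m\<rangle>" "isomorphic D Y' ((sh D ^^ n) X)" using Suc.IH by blast
  have "isomorphic D Y ((sh D ^^ Suc n) X)"
    using isomorphic_trans[OF Y'(1)] X(2) by (simp add: sh_isomorphic)
  then show ?case using X by blast
qed

lemma thick_in_iff:
  assumes T: "thick_subcategory D T"
  shows "isomorphic D X Y \<Longrightarrow> X \<in> T \<Longrightarrow> Y \<in> T" "sh D X \<in> T \<longleftrightarrow> X \<in> T"
  using T unfolding thick_subcategory_def iso_closed_def by blast+

text \<open>Thick subcategories are required to contain third vertices. Two rotations make Y[1] the
  third vertex after Z and X[1].\<close>

lemma thick_ext:
  assumes T: "thick_subcategory D T" and t: "tri D X Y Z f g h" and XZ: "X \<in> T" "Z \<in> T"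
  shows "Y \<in> T"
proof -
  have "sh D X \<in> T" using thick_in_iff(2)[OF T] XZ by blast
  with tri_rotate[OF tri_rotate[OF t]] XZ have "sh D Y \<in> T"
    using T unfolding thick_subcategory_def by blast
  then show ?thesis using thick_in_iff(2)[OF T] by blast
qed

lemma thick_subset: "(\<And>T. thick_subcategory D T \<Longrightarrow> S' \<subseteq> T \<Longrightarrow> S \<subseteq> T) \<Longrightarrow> thick D S \<subseteq> thick D S'"
  unfolding thick_def by blast

end

context bounded_t_category
begin

text \<open>Associativity of \<open>\<star>\<close> exhibits the quotient of A by a as an extension
  of I by b, which stays in the heart.\<close>

lemma subobject_trans:
  assumes "tri D a k b f g h" "tri D k A I f' g' h'" "b \<in> H" "I \<in> H"
  obtains r f g h where "r \<in> H" "tri D a A r f g h"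
proof -
  have "A \<in> ({a} \<star> {b}) \<star> {I}" using assms by (blast intro: starI)
  then have "A \<in> {a} \<star> ({b} \<star> {I})" by (simp add: star_assoc)
  then obtain r f g h where r: "r \<in> {b} \<star> {I}" "tri D a A r f g h" by (rule starE) blast
  have "r \<in> H" using r(1) assms(3,4) H_ext by (auto elim!: starE)
  then show thesis using r(2) that by blast
qed

lemma quotient_trans:
  assumes "tri D a c b f g h" "tri D I B c f' g' h'" "a \<in> H" "I \<in> H"
  obtains r f g h where "r \<in> H" "tri D r B b f g h"
proof -
  have "B \<in> {I} \<star> ({a} \<star> {b})" using assms by (blast intro: starI)
  then have "B \<in> ({I} \<star> {a}) \<star> {b}" by (simp add: star_assoc)
  then obtain r f g h where r: "r \<in> {I} \<star> {a}" "tri D r B b f g h" by (rule starE) blast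
  have "r \<in> H" using r(1) assms(3,4) H_ext by (auto elim!: starE)
  then show thesis using r(2) that by blast
qed

text \<open>King's semistability with respect to v. Subobjects are encoded by triangles with all
  vertices in H, so that v can be evaluated on them directly.\<close>

definition slope_zero :: "('o \<Rightarrow> real) \<Rightarrow> 'o set"
  where "slope_zero v = {h \<in> H. v h = 0 \<and>
    (\<forall>a\<in>H. \<forall>b\<in>H. \<forall>f g k. tri D a h b f g k \<longrightarrow> v a \<le> 0)}"

context
  fixes v assumes v: "tri_additive v"
begin

lemma slope_zeroD:
  assumes "X \<in> slope_zero v"
  shows "X \<in> H" "v X = 0" "tri D a X b f g h \<Longrightarrow> a \<in> H \<Longrightarrow> b \<in> H \<Longrightarrow> v a \<le> 0"
    "tri D a X b f g h \<Longrightarrow> a \<in> H \<Longrightarrow> b \<in> H \<Longrightarrow> 0 \<le> v b"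
proof -
  show "X \<in> H" and 0: "v X = 0" and 1: "tri D a X b f g h \<Longrightarrow> a \<in> H \<Longrightarrow> b \<in> H \<Longrightarrow> v a \<le> 0"
    using assms unfolding slope_zero_def by blast+
  show "0 \<le> v b" if "tri D a X b f g h" "a \<in> H" "b \<in> H"
    using 0 1[OF that] tri_additiveD[OF v that(1)] by simp
qed

lemma slope_zeroI:
  assumes "X \<in> H" "v X = 0"
    "\<And>a b f g h. a \<in> H \<Longrightarrow> b \<in> H \<Longrightarrow> tri D a X b f g h \<Longrightarrow> v a \<le> 0"
  shows "X \<in> slope_zero v"
  unfolding slope_zero_def using assms by blast

lemma slope_zero_iso_closed: "iso_closed D (slope_zero v)"
  unfolding iso_closed_def
proof (intro allI impI)
  fix X Y assume X: "X \<in> slope_zero v" and i: "isomorphic D X Y"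
  show "Y \<in> slope_zero v"
  proof (rule slope_zeroI)
    show "Y \<in> H" using iso_closedD[OF iso_closed_H slope_zeroD(1)[OF X] i] .
    show "v Y = 0" using additive_iso[OF v i] slope_zeroD(2)[OF X] by simp
    fix a b f g h assume ab: "a \<in> H" "b \<in> H" "tri D a Y b f g h"
    obtain f g where "tri D a X b f g h" using tri_isomorphic2[OF ab(3) isomorphic_sym[OF i]] by blast
    then show "v a \<le> 0" using slope_zeroD(3)[OF X] ab by blast
  qed
qed

lemma slope_zero_zero:
  assumes X: "zero_object D X" shows "X \<in> slope_zero v"
proof (rule slope_zeroI[OF H_zero[OF X] additive_zero[OF v X]])
  fix a b f g h assume ab: "a \<in> H" "b \<in> H" "tri D a X b f g h"
  have "f \<cdot> idm D a = mzero D a X"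
    using zero_objectD(2)[OF X] cmp_in[OF idm_in tri_in(1)[OF ab(3)]] by blast
  then have "idm D a = mzero D a a" by (rule heart_mono[OF ab(3,1,2) idm_in])
  then show "v a \<le> 0" using additive_zero[OF v] by (simp add: zero_object_iff)
qed

text \<open>The image I is a quotient of A and a subobject of B, so v I is squeezed to 0. Subobjects
  of k are subobjects of A, and quotients of c are quotients of B.\<close>

lemma slope_zero_factor:
  assumes A: "A \<in> slope_zero v" and B: "B \<in> slope_zero v"
    and t: "tri D k A I i e x" "tri D I B c m p y" and H: "k \<in> H" "I \<in> H" "c \<in> H"
  shows "k \<in> slope_zero v" "c \<in> slope_zero v"
proof -
  have I: "v I = 0" using slope_zeroD(3)[OF B t(2) H(2,3)] slope_zeroD(4)[OF A t(1) H(1,2)] by simp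
  show "k \<in> slope_zero v"
  proof (rule slope_zeroI[OF H(1)])
    show "v k = 0" using tri_additiveD[OF v t(1)] I slope_zeroD(2)[OF A] by simp
    fix a b f g h assume ab: "a \<in> H" "b \<in> H" "tri D a k b f g h"
    obtain r f g h where "r \<in> H" "tri D a A r f g h" by (rule subobject_trans[OF ab(3) t(1) ab(2) H(2)])
    then show "v a \<le> 0" using slope_zeroD(3)[OF A] ab by blast
  qed
  show "c \<in> slope_zero v"
  proof (rule slope_zeroI[OF H(3)])
    show c: "v c = 0" using tri_additiveD[OF v t(2)] I slope_zeroD(2)[OF B] by simp
    fix a b f g h assume ab: "a \<in> H" "b \<in> H" "tri D a c b f g h"
    obtain r f g h where "r \<in> H" "tri D r B b f g h" by (rule quotient_trans[OF ab(3) t(2) ab(1) H(2)])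
    then have "0 \<le> v b" using slope_zeroD(4)[OF B] ab by blast
    then show "v a \<le> 0" using tri_additiveD[OF v ab(3)] c by simp
  qed
qed

text \<open>A subobject a of E is an extension of its image I in B by the kernel k of a -> B, and k
  embeds in A. Both summands of v a are therefore nonpositive.\<close>

lemma slope_zero_ext:
  assumes t: "tri D A E B j p x" and A: "A \<in> slope_zero v" and B: "B \<in> slope_zero v"
  shows "E \<in> slope_zero v"
proof (rule slope_zeroI)
  show E: "E \<in> H" using H_ext[OF t] slope_zeroD(1) A B by blast
  show "v E = 0" using tri_additiveD[OF v t] slope_zeroD(2) A B by simp
  fix a b f g h assume ab: "a \<in> H" "b \<in> H" "tri D a E b f g h"
  have BH: "B \<in> H" "A \<in> H" using slope_zeroD(1) A B by auto
  have f: "f \<in> Mor D a E" using tri_in[OF ab(3)] by blast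
  note jp = tri_in[OF t]
  obtain k I c i e x' m q y C j' c' where fac: "k \<in> H" "I \<in> H" "c \<in> H"
    "tri D k a I i e x'" "tri D I B c m q y" "p \<cdot> f = m \<cdot> e" "C \<in> {sh D k} \<star> {c}" "tri D a B C (p \<cdot> f) j' c'"
    using heart_factor[OF ab(1) BH(1) cmp_in[OF f jp(2)]] by metis
  have i: "i \<in> Mor D k a" using tri_in[OF fac(4)] by blast
  have "p \<cdot> (f \<cdot> i) = (m \<cdot> e) \<cdot> i" using cmp_assoc[OF i f jp(2)] fac(6) by simp
  also have "\<dots> = mzero D k B"
    using factor_kernel[OF fac(4,5) ab(1) BH(1) fac(1-3)] by (simp add: is_kernel_def)
  finally obtain l where l: "l \<in> Mor D k A" "j \<cdot> l = f \<cdot> i" using tri_lift[OF t cmp_in[OF i f]] by blast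
  have "is_mono D H k E (j \<cdot> l)"
    unfolding l(2) by (rule is_mono_comp[OF tri_is_mono[OF fac(4)] tri_is_mono[OF ab(3)]]) (use fac ab E in auto)
  then have "is_mono D H k A l" using l(1) jp(1) BH(2) by (rule is_mono_cancel)
  then obtain c2 f2 g2 h2 where "c2 \<in> H" "tri D k A c2 f2 g2 h2" by (rule mono_tri)
  then have "v k \<le> 0" using slope_zeroD(3)[OF A] fac(1) by blast
  moreover have "v I \<le> 0" using slope_zeroD(3)[OF B fac(5,2,3)] .
  ultimately show "v a \<le> 0" using tri_additiveD[OF v fac(4)] by simp
qed

lemma slope_zero_Wide: "slope_zero v \<in> Wide D H"
  unfolding Wide_def mem_Collect_eq
proof (intro conjI allI impI)
  show "slope_zero v \<subseteq> H" using slope_zeroD(1) by blast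
  show "\<exists>X\<in>slope_zero v. zero_object D X" using ex_zero_object slope_zero_zero by blast
  fix A B assume AB: "A \<in> slope_zero v" "B \<in> slope_zero v"
  then have H: "A \<in> H" "B \<in> H" using slope_zeroD(1) by auto
  have fac: "N \<in> slope_zero v" if "is_kernel D H A B f N i" for f N i
  proof -
    have f: "f \<in> Mor D A B" using that by (simp add: is_kernel_def)
    obtain k I c i' e x m p y where fac: "k \<in> H" "I \<in> H" "c \<in> H"
      "tri D k A I i' e x" "tri D I B c m p y" "f = m \<cdot> e" using heart_factor[OF H f] by metis
    have "isomorphic D k N"
      using kernels_isomorphic[OF _ that] factor_kernel[OF fac(4,5) H fac(1-3)] fac(6) by blast
    then show ?thesis
      using slope_zero_factor(1)[OF AB fac(4,5,1-3)] iso_closedD[OF slope_zero_iso_closed] by blast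
  qed
  then show "is_kernel D H A B f N i \<Longrightarrow> N \<in> slope_zero v" for f N i .
  show "Q \<in> slope_zero v" if "is_cokernel D H A B f Q p" for f Q p
  proof -
    have f: "f \<in> Mor D A B" using that by (simp add: is_cokernel_def)
    obtain k I c i' e x m p' y where fac: "k \<in> H" "I \<in> H" "c \<in> H"
      "tri D k A I i' e x" "tri D I B c m p' y" "f = m \<cdot> e" using heart_factor[OF H f] by metis
    have "isomorphic D c Q"
      using cokernels_isomorphic[OF _ that] factor_cokernel[OF fac(4,5) H fac(1-3)] fac(6) by blast
    then show ?thesis
      using slope_zero_factor(2)[OF AB fac(4,5,1-3)] iso_closedD[OF slope_zero_iso_closed] by blast
  qed
next
  fix A E B i p assume "A \<in> slope_zero v" "B \<in> slope_zero v" "short_exact D H A E B i p"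
  then show "E \<in> slope_zero v" using slope_zero_ext by (metis short_exact_tri)
qed

end

section \<open>Intermediate hearts\<close>

context
  fixes UK VK K
  assumes K: "bounded_t_category D UK VK K"
    and HK: "heart_ge D (H\<langle>1\<rangle>) K" and KH: "heart_ge D K H"
begin

interpretation K: bounded_t_category D UK VK K by (rule K)

text \<open>Shifted back, K >= H says that k has no nonzero maps to H[n] for n < 0. These shifts
  generate \<open>V\<langle>-1\<rangle>\<close>, whose left orthogonal is the aisle.\<close>

lemma intermediate_U: "K \<subseteq> U\<langle>0\<rangle>"
proof
  fix k assume k: "k \<in> K"
  let ?S = "{Y. orthogonal k Y}"
  have HS: "H\<langle>n\<rangle> \<subseteq> ?S" if "n \<le> -1" for n
  proof
    fix Y assume "Y \<in> H\<langle>n\<rangle>"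
    then have "(sh D ^^ nat (- n)) Y \<in> H\<langle>int (nat (- n)) + n\<rangle>" by (simp only: sh_funpow_shifted)
    then have "(sh D ^^ nat (- n)) Y \<in> H" using that iso_closed_H by simp
    then have "orthogonal ((sh D ^^ nat (- n)) k) ((sh D ^^ nat (- n)) Y)"
      using KH k that by (simp add: heart_ge_def)
    then show "Y \<in> ?S" by (simp add: sh_funpow_orthogonal)
  qed
  have S: "zeros \<subseteq> ?S" by (auto simp: zero_object_def)
  have SS: "?S \<star> ?S \<subseteq> ?S"
    by (rule subsetI, erule starE, unfold mem_Collect_eq) (rule tri_orthogonal_right)
  have "V\<langle>-1\<rangle> \<subseteq> ?S" by (rule coaisle_generated[OF S SS HS])
  then show "k \<in> U\<langle>0\<rangle>" by (intro U_I) auto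
qed

text \<open>Dually, H[1] >= K excludes nonzero maps from H[n] to k for n >= 2, and these shifts
  generate \<open>U\<langle>2\<rangle>\<close>.\<close>

lemma intermediate_V: "K \<subseteq> V\<langle>1\<rangle>"
proof
  fix k assume k: "k \<in> K"
  let ?S = "{Y. orthogonal Y k}"
  have HS: "H\<langle>n\<rangle> \<subseteq> ?S" if "n \<ge> 2" for n
  proof
    fix Y assume "Y \<in> H\<langle>n\<rangle>"
    then have "Y \<in> H\<langle>int (nat (n - 1)) + 1\<rangle>" using that by simp
    then obtain X where X: "X \<in> H\<langle>1\<rangle>" "isomorphic D Y ((sh D ^^ nat (n - 1)) X)"
      using shifted_unsh_funpow by blast
    have "orthogonal ((sh D ^^ nat (n - 1)) X) k"
      using HK k that X by (simp add: heart_ge_def)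
    then show "Y \<in> ?S" using isomorphic_orthogonal(2)[OF X(2)] by simp
  qed
  have S: "zeros \<subseteq> ?S" by (auto simp: zero_object_def)
  have SS: "?S \<star> ?S \<subseteq> ?S"
    by (rule subsetI, erule starE, unfold mem_Collect_eq) (rule tri_orthogonal_left)
  have "U\<langle>1 + 1\<rangle> \<subseteq> ?S" using aisle_generated[OF S SS HS] by simp
  then show "k \<in> V\<langle>1\<rangle>" by (intro V_I) auto
qed

text \<open>The first inclusion of each pair holds because the shifts of K generate its aisle and
  coaisle. The second is the first inclusion of the other pair, read through orthogonality.\<close>

lemma intermediate_aisle: "UK\<langle>n\<rangle> \<subseteq> U\<langle>n\<rangle>" "U\<langle>n + 1\<rangle> \<subseteq> UK\<langle>n\<rangle>"
  and intermediate_coaisle: "VK\<langle>n\<rangle> \<subseteq> V\<langle>n + 1\<rangle>" "V\<langle>n\<rangle> \<subseteq> VK\<langle>n\<rangle>"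
proof -
  have UU: "UK\<langle>n\<rangle> \<subseteq> U\<langle>n\<rangle>" for n
  proof (rule K.aisle_generated)
    fix m assume "n \<le> m"
    then have "U\<langle>0\<rangle>\<langle>m\<rangle> \<subseteq> U\<langle>n\<rangle>" using U_antimono by (simp add: shifted_shifted)
    then show "K\<langle>m\<rangle> \<subseteq> U\<langle>n\<rangle>" using shifted_mono[OF intermediate_U, of m] by blast
  qed (use U_zero U_star in auto)
  then show "UK\<langle>n\<rangle> \<subseteq> U\<langle>n\<rangle>" .
  have VV: "VK\<langle>n\<rangle> \<subseteq> V\<langle>n + 1\<rangle>" for n
  proof (rule K.coaisle_generated)
    fix m assume "m \<le> n"
    then have "V\<langle>1\<rangle>\<langle>m\<rangle> \<subseteq> V\<langle>n + 1\<rangle>" using V_mono by (simp add: shifted_shifted)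
    then show "K\<langle>m\<rangle> \<subseteq> V\<langle>n + 1\<rangle>" using shifted_mono[OF intermediate_V, of m] by blast
  qed (use V_zero V_star in auto)
  then show "VK\<langle>n\<rangle> \<subseteq> V\<langle>n + 1\<rangle>" .
  show "U\<langle>n + 1\<rangle> \<subseteq> UK\<langle>n\<rangle>"
  proof
    fix X assume X: "X \<in> U\<langle>n + 1\<rangle>"
    show "X \<in> UK\<langle>n\<rangle>"
    proof (rule K.U_I)
      fix Y assume "Y \<in> VK\<langle>n - 1\<rangle>"
      then have "Y \<in> V\<langle>n\<rangle>" using VV[of "n - 1"] by auto
      with X show "orthogonal X Y" by (rule orthogonal_UV) simp
    qed
  qed
  show "V\<langle>n\<rangle> \<subseteq> VK\<langle>n\<rangle>"
  proof
    fix X assume X: "X \<in> V\<langle>n\<rangle>"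
    show "X \<in> VK\<langle>n\<rangle>"
    proof (rule K.V_I)
      fix Y assume "Y \<in> UK\<langle>n + 1\<rangle>"
      then have "Y \<in> U\<langle>n + 1\<rangle>" using UU by blast
      from this X show "orthogonal Y X" by (rule orthogonal_UV) simp
    qed
  qed
qed

text \<open>The t-structure of H truncates k into two pieces, since k lies between the shifts 0 and
  1 of H; the nesting of aisles and coaisles keeps both pieces in K.\<close>

lemma intermediate_decomp:
  assumes k: "k \<in> K"
  obtains a b f g h where "a \<in> H" "b \<in> H" "sh D a \<in> K" "b \<in> K" "tri D (sh D a) k b f g h"
proof -
  obtain a' b f' g h' where t': "a' \<in> U\<langle>1\<rangle>" "b \<in> V\<langle>0\<rangle>" "tri D a' k b f' g h'"
    by (rule truncationE[of 0 1]) simp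
  obtain a where a: "isomorphic D a' (sh D a)" "a \<in> U\<langle>0\<rangle>"
    using shift_family_unsh[OF shift_family_shifted0, of a' U 0] t'(1) by auto
  obtain f h where t: "tri D (sh D a) k b f g h" using tri_isomorphic1[OF t'(3) a(1)] by blast
  have kK: "k \<in> UK\<langle>0\<rangle>" "k \<in> VK\<langle>0\<rangle>" and kH: "k \<in> U\<langle>0\<rangle>" "k \<in> V\<langle>1\<rangle>"
    using k intermediate_U intermediate_V by (auto simp: K.H_iff)
  have aU: "sh D a \<in> U\<langle>1\<rangle>" using a(2) sh_shifted[of a U 0] by simp
  have "sh D a \<in> V\<langle>1\<rangle>" by (rule V_fiber[OF t kH(2) t'(2)]) simp
  then have "a \<in> V\<langle>0\<rangle>" using sh_shifted[of a V 0] by simp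
  moreover have bU: "b \<in> U\<langle>0\<rangle>" by (rule U_cone[OF t kH(1) aU]) simp
  moreover have aUK: "sh D a \<in> UK\<langle>0\<rangle>" using aU intermediate_aisle(2)[of 0] by auto
  moreover have "b \<in> UK\<langle>0\<rangle>" by (rule K.U_cone[OF t kK(1) aUK]) simp
  moreover have bVK: "b \<in> VK\<langle>0\<rangle>" using t'(2) intermediate_coaisle(2) by blast
  moreover have "sh D a \<in> VK\<langle>0\<rangle>" by (rule K.V_fiber[OF t kK(2) bVK]) simp
  ultimately show thesis using that[OF _ _ _ _ t] a(2) t'(2) by (simp add: H_iff K.H_iff)
qed

text \<open>Here the t-structure of K truncates an object of H, and the same nesting forces both
  pieces back into H.\<close>

lemma heart_decomp:
  assumes h: "h \<in> H"
  obtains a b f g x where "a \<in> H" "b \<in> H" "a \<in> K" "sh D b \<in> K" "tri D a h b f g x"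
proof -
  obtain a b f g x where t: "a \<in> UK\<langle>0\<rangle>" "b \<in> VK\<langle>-1\<rangle>" "tri D a h b f g x"
    by (rule K.truncationE[of "-1" 0]) simp
  have hH: "h \<in> U\<langle>0\<rangle>" "h \<in> V\<langle>0\<rangle>" using h by (auto simp: H_iff)
  have aU: "a \<in> U\<langle>0\<rangle>" using t intermediate_aisle(1) by blast
  have bV: "b \<in> V\<langle>0\<rangle>" using t intermediate_coaisle(1)[of "-1"] by auto
  have bU: "b \<in> U\<langle>0\<rangle>" by (rule U_cone[OF t(3) hH(1) aU]) simp
  have aV: "a \<in> V\<langle>0\<rangle>" by (rule V_fiber[OF t(3) hH(2) bV]) simp
  have "a \<in> VK\<langle>0\<rangle>" using aV intermediate_coaisle(2) by blast
  moreover have "sh D b \<in> VK\<langle>0\<rangle>" using t(2) sh_shifted[of b VK "-1"] by simp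
  moreover have "sh D b \<in> U\<langle>0 + 1\<rangle>" using bU sh_shifted[of b U 0] by simp
  then have "sh D b \<in> UK\<langle>0\<rangle>" using intermediate_aisle(2) by blast
  ultimately show thesis using that[OF _ _ _ _ t(3)] t(1) aU aV bU bV by (simp add: H_iff K.H_iff)
qed

text \<open>This makes the thick label independent of the choice of \<open>K\<close>.\<close>

lemma thick_kernel:
  assumes v: "tri_additive v" and pos: "\<And>k. k \<in> K \<Longrightarrow> v k \<ge> 0"
  shows "thick D {k \<in> K. v k = 0} = thick D (slope_zero v)"
proof (intro equalityI thick_subset subsetI)
  fix T k assume T: "thick_subcategory D T" "slope_zero v \<subseteq> T" and "k \<in> {k \<in> K. v k = 0}"
  then have k: "k \<in> K" "v k = 0" by auto
  obtain a b f g h where t: "a \<in> H" "b \<in> H" "sh D a \<in> K" "b \<in> K" "tri D (sh D a) k b f g h"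
    using intermediate_decomp[OF k(1)] .
  \<comment> \<open>The values on a[1] and b are nonnegative and add up to v k = 0.\<close>
  have ab: "v a = 0" "v b = 0"
    using pos[OF t(3)] pos[OF t(4)] additive_sh[OF v, of a] tri_additiveD[OF v t(5)] k(2) by auto
  have aK: "sh D a \<in> VK\<langle>0\<rangle>" and bK: "b \<in> UK\<langle>0\<rangle>" using t by (auto simp: K.H_iff)
  have sub: "sh D x \<in> UK\<langle>0\<rangle>" if "x \<in> H" for x
    using that sh_shifted[of x U 0] intermediate_aisle(2)[of 0] by (auto simp: H_iff)
  have quot: "y \<in> VK\<langle>0\<rangle>" if "y \<in> H" for y
    using that intermediate_coaisle(2)[of 0] by (auto simp: H_iff)
  \<comment> \<open>A quotient y of b in H stays in K: it lies between b and x[1] in the aisle of K,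
    and H is contained in the coaisle. So v y >= 0, and v x = - v y.\<close>
  have "b \<in> slope_zero v"
  proof (rule slope_zeroI[OF v t(2) ab(2)])
    fix x y f g h assume xy: "x \<in> H" "y \<in> H" "tri D x b y f g h"
    have "y \<in> UK\<langle>0\<rangle>" using K.U_ext[OF tri_rotate[OF xy(3)] bK sub[OF xy(1)]] .
    then have "y \<in> K" using quot[OF xy(2)] by (simp add: K.H_iff)
    then show "v x \<le> 0" using pos tri_additiveD[OF v xy(3)] ab by fastforce
  qed
  \<comment> \<open>For a it is the shifted subobject x[1] that stays in K, whence - v x >=
    0.\<close>
  moreover have "a \<in> slope_zero v"
  proof (rule slope_zeroI[OF v t(1) ab(1)])
    fix x y f g h assume xy: "x \<in> H" "y \<in> H" "tri D x a y f g h"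
    have yx: "v (sh D x) = - v x" by (rule additive_sh[OF v])
    obtain f' g' h' where t': "tri D (sh D x) (sh D a) (sh D y) f' g' h'" using tri_sh[OF xy(3)] by blast
    have "sh D y \<in> VK\<langle>1\<rangle>" using quot[OF xy(2)] sh_shifted[of y VK 0] by simp
    then have "sh D x \<in> VK\<langle>0\<rangle>" by (rule K.V_fiber[OF t' aK]) simp
    then have "sh D x \<in> K" using sub[OF xy(1)] by (simp add: K.H_iff)
    then show "v x \<le> 0" using pos yx by fastforce
  qed
  ultimately have "sh D a \<in> T" "b \<in> T" using T thick_in_iff(2) by blast+
  then show "k \<in> T" by (rule thick_ext[OF T(1) t(5)])
next
  fix T h assume T: "thick_subcategory D T" "{k \<in> K. v k = 0} \<subseteq> T" and h: "h \<in> slope_zero v"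
  obtain a b f g x where t: "a \<in> H" "b \<in> H" "a \<in> K" "sh D b \<in> K" "tri D a h b f g x"
    using heart_decomp[OF slope_zeroD(1)[OF v h]] .
  \<comment> \<open>Positivity on K and semistability of h bound v a from both sides.\<close>
  have "v a = 0" using pos[OF t(3)] slope_zeroD(3)[OF v h t(5,1,2)] by simp
  moreover from this have "v (sh D b) = 0"
    using tri_additiveD[OF v t(5)] slope_zeroD(2)[OF v h] additive_sh[OF v, of b] by simp
  ultimately have "a \<in> T" "sh D b \<in> T" using T t by auto
  then show "h \<in> T" using thick_ext[OF T(1) t(5)] thick_in_iff(2)[OF T(1)] by blast
qed

end

end

section \<open>Tilting at a torsion pair\<close>

context bounded_t_category
begin

context
  fixes T F
  assumes T: "T \<subseteq> H" "iso_closed D T" "zeros \<subseteq> T" and F: "F \<subseteq> H" "iso_closed D F" "zeros \<subseteq> F"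
    and TF: "orth T F" "H \<subseteq> T \<star> F"
    and F_max: "\<And>f. f \<in> H \<Longrightarrow> (\<And>t. t \<in> T \<Longrightarrow> orthogonal t f) \<Longrightarrow> f \<in> F"
begin

lemma torsion_UV: "T \<subseteq> U\<langle>0\<rangle>" "T \<subseteq> V\<langle>0\<rangle>" "F \<subseteq> U\<langle>0\<rangle>" "F \<subseteq> V\<langle>0\<rangle>" "T\<langle>1\<rangle> \<subseteq> U\<langle>1\<rangle>" "F\<langle>1\<rangle> \<subseteq> V\<langle>1\<rangle>"
  using T F shifted_mono[OF T(1), of 1] shifted_mono[OF F(1), of 1] by (auto simp: H_iff heart_shifted)

lemma tilt_aisle: "U\<langle>1\<rangle> \<subseteq> U\<langle>1\<rangle> \<star> T" "U\<langle>1\<rangle> \<star> T \<subseteq> U\<langle>0\<rangle>"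
proof -
  show "U\<langle>1\<rangle> \<subseteq> U\<langle>1\<rangle> \<star> T"
    using star_mono[OF order_refl T(3), of "U\<langle>1\<rangle>"] by (simp add: star_zeros iso_closed_shifted)
  show "U\<langle>1\<rangle> \<star> T \<subseteq> U\<langle>0\<rangle>"
    by (rule order_trans[OF star_mono[OF U_antimono torsion_UV(1)] U_star]) simp
qed

lemma tilt_coaisle: "V\<langle>0\<rangle> \<subseteq> F\<langle>1\<rangle> \<star> V\<langle>0\<rangle>" "F\<langle>1\<rangle> \<star> V\<langle>0\<rangle> \<subseteq> V\<langle>1\<rangle>"
proof -
  have "zeros \<subseteq> F\<langle>1\<rangle>"
    by (rule shift_family_subset[OF shift_family_zeros shift_family_shifted0, where m = 0])
      (use F in simp)
  from star_mono[OF this order_refl, of "V\<langle>0\<rangle>"] show "V\<langle>0\<rangle> \<subseteq> F\<langle>1\<rangle> \<star> V\<langle>0\<rangle>"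
    by (simp only: zeros_star iso_closed_shifted)
  show "F\<langle>1\<rangle> \<star> V\<langle>0\<rangle> \<subseteq> V\<langle>1\<rangle>"
    by (rule order_trans[OF star_mono[OF torsion_UV(6) V_mono] V_star]) simp
qed

lemma tilt_coaisle_shifted: "(F\<langle>1\<rangle> \<star> V\<langle>0\<rangle>)\<langle>-1\<rangle> = F \<star> V\<langle>-1\<rangle>"
  by (simp add: shifted_star iso_closed_shifted shifted_shifted F iso_closed_UV)

lemma tilt_t_structure: "bounded_t_structure D (U\<langle>1\<rangle> \<star> T) (F\<langle>1\<rangle> \<star> V\<langle>0\<rangle>)"
  unfolding bounded_t_structure_def t_structure_def
proof (intro conjI ballI allI)
  show "U\<langle>1\<rangle> \<star> T \<subseteq> (U\<langle>1\<rangle> \<star> T)\<langle>-1\<rangle>"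
  proof
    fix X assume "X \<in> U\<langle>1\<rangle> \<star> T"
    then have "X \<in> U\<langle>0\<rangle>" using tilt_aisle by blast
    then have "sh D X \<in> U\<langle>1\<rangle> \<star> T" using tilt_aisle sh_shifted[of X U 0] by auto
    then show "X \<in> (U\<langle>1\<rangle> \<star> T)\<langle>-1\<rangle>" by (simp add: shifted_minus1 iso_closed_star)
  qed
  have "F \<star> V\<langle>-1\<rangle> \<subseteq> V\<langle>0\<rangle>"
    by (rule order_trans[OF star_mono[OF torsion_UV(4) V_mono] V_star]) simp
  then show "(F\<langle>1\<rangle> \<star> V\<langle>0\<rangle>)\<langle>-1\<rangle> \<subseteq> F\<langle>1\<rangle> \<star> V\<langle>0\<rangle>"
    unfolding tilt_coaisle_shifted using tilt_coaisle(1) by blast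
  have "orth (U\<langle>1\<rangle>) F" "orth (U\<langle>1\<rangle>) (V\<langle>-1\<rangle>)" "orth T (V\<langle>-1\<rangle>)"
    using orth_mono[OF orth_UV[of 0 1] order_refl torsion_UV(4)] orth_UV[of "-1" 1]
      orth_mono[OF orth_UV[of "-1" 0] torsion_UV(1) order_refl] by simp_all
  then have o: "orth (U\<langle>1\<rangle> \<star> T) (F \<star> V\<langle>-1\<rangle>)"
    using TF(1) by (intro orth_star_left orth_star_right)
  show "orthogonal X Y" if "X \<in> U\<langle>1\<rangle> \<star> T" "Y \<in> (F\<langle>1\<rangle> \<star> V\<langle>0\<rangle>)\<langle>-1\<rangle>" for X Y
    using orthD[OF o] that unfolding tilt_coaisle_shifted by blast
  have V: "V\<langle>0\<rangle> \<subseteq> (T \<star> F) \<star> V\<langle>-1\<rangle>"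
  proof
    fix X assume X: "X \<in> V\<langle>0\<rangle>"
    obtain a b f g h where t: "a \<in> U\<langle>0\<rangle>" "b \<in> V\<langle>-1\<rangle>" "tri D a X b f g h"
      by (rule truncationE[of "-1" 0]) simp
    have "a \<in> V\<langle>0\<rangle>" by (rule V_fiber[OF t(3) X t(2)]) simp
    with t(1) have "a \<in> T \<star> F" using TF(2) by (auto simp: H_iff)
    then show "X \<in> (T \<star> F) \<star> V\<langle>-1\<rangle>" using t starI by blast
  qed
  \<comment> \<open>The torsion pair splits the degree 0 part of the truncation in
    \<open>V\<langle>0\<rangle>\<close>; rebracketing then gives the new truncation.\<close>
  have "X \<in> (U\<langle>1\<rangle> \<star> T) \<star> (F \<star> V\<langle>-1\<rangle>)" for X
    using truncation[of X 1] star_mono[OF order_refl V, of "U\<langle>1\<rangle>"] by (auto simp: star_assoc)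
  then show "\<exists>A\<in>U\<langle>1\<rangle> \<star> T. \<exists>B\<in>(F\<langle>1\<rangle> \<star> V\<langle>0\<rangle>)\<langle>-1\<rangle>. \<exists>f g h. tri D A X B f g h" for X
    unfolding tilt_coaisle_shifted by (meson starE)
  show "\<exists>n. X \<in> (U\<langle>1\<rangle> \<star> T)\<langle>- int n\<rangle> \<and> X \<in> (F\<langle>1\<rangle> \<star> V\<langle>0\<rangle>)\<langle>int n\<rangle>" for X
  proof -
    obtain n :: nat where n: "X \<in> U\<langle>- int n\<rangle>" "X \<in> V\<langle>int n\<rangle>" using bounded by blast
    \<comment> \<open>Tilting moves the aisle by at most one degree, so the bound n grows to n +
      1.\<close>
    have "U\<langle>- int n\<rangle> \<subseteq> (U\<langle>1\<rangle> \<star> T)\<langle>- int (Suc n)\<rangle>"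
      using shifted_mono[OF tilt_aisle(1), of "- int (Suc n)"] by (simp add: shifted_shifted)
    moreover have "V\<langle>int (Suc n)\<rangle> \<subseteq> (F\<langle>1\<rangle> \<star> V\<langle>0\<rangle>)\<langle>int (Suc n)\<rangle>"
      using shifted_mono[OF tilt_coaisle(1), of "int (Suc n)"] by (simp add: shifted_shifted)
    moreover have "V\<langle>int n\<rangle> \<subseteq> V\<langle>int (Suc n)\<rangle>" by (rule V_mono) simp
    ultimately show ?thesis using n by blast
  qed
qed (simp_all add: iso_closed_star)

definition tilted_heart :: "'o set"
  where "tilted_heart = (U\<langle>1\<rangle> \<star> T) \<inter> (F\<langle>1\<rangle> \<star> V\<langle>0\<rangle>)"

lemma tilted_heart_intermediate: "tilted_heart \<in> intermediate_hearts D H"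
  unfolding intermediate_hearts_def mem_Collect_eq
proof (intro conjI)
  show "bounded_heart D tilted_heart"
    unfolding bounded_heart_def tilted_heart_def using tilt_t_structure by blast
  show "heart_ge D (H\<langle>1\<rangle>) tilted_heart"
    unfolding heart_ge_def
  proof (intro allI impI ballI)
    fix n :: nat and X Y assume n: "0 < n" and X: "X \<in> H\<langle>1\<rangle>" and Y: "Y \<in> tilted_heart"
    have "(sh D ^^ n) X \<in> U\<langle>int n + 1\<rangle>" using X by (simp add: sh_funpow_shifted heart_shifted)
    moreover have "Y \<in> V\<langle>1\<rangle>" using Y tilt_coaisle by (auto simp: tilted_heart_def)
    ultimately show "orthogonal ((sh D ^^ n) X) Y" by (rule orthogonal_UV) (use n in simp)
  qed
  show "heart_ge D tilted_heart H"
    unfolding heart_ge_def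
  proof (intro allI impI ballI)
    fix n :: nat and X Y assume n: "0 < n" and X: "X \<in> tilted_heart" and Y: "Y \<in> H"
    have "X \<in> U\<langle>0\<rangle>" using X tilt_aisle by (auto simp: tilted_heart_def)
    then have "(sh D ^^ n) X \<in> U\<langle>int n + 0\<rangle>" by (simp only: sh_funpow_shifted)
    moreover have "Y \<in> V\<langle>0\<rangle>" using Y by (simp add: H_iff)
    ultimately show "orthogonal ((sh D ^^ n) X) Y" by (rule orthogonal_UV) (use n in simp)
  qed
qed

lemma tilted_heart_decomp:
  assumes k: "k \<in> tilted_heart"
  obtains a t f g h where "a \<in> F" "t \<in> T" "tri D (sh D a) k t f g h"
proof -
  obtain u t f g h where ut: "u \<in> U\<langle>1\<rangle>" "t \<in> T" "tri D u k t f g h"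
    using k by (auto simp: tilted_heart_def elim: starE)
  obtain a where a: "isomorphic D u (sh D a)" "a \<in> U\<langle>0\<rangle>"
    using shift_family_unsh[OF shift_family_shifted0, of u U 0] ut(1) by auto
  obtain f h where tri: "tri D (sh D a) k t f g h" using tri_isomorphic1[OF ut(3) a(1)] by blast
  have kV: "k \<in> V\<langle>1\<rangle>" and kF: "k \<in> F\<langle>1\<rangle> \<star> V\<langle>0\<rangle>"
    using k tilt_coaisle(2) by (auto simp: tilted_heart_def)
  have tV: "t \<in> V\<langle>0\<rangle>" using ut(2) torsion_UV(2) by blast
  have "sh D a \<in> V\<langle>1\<rangle>" by (rule V_fiber[OF tri kV tV]) simp
  then have aH: "a \<in> H" using a(2) sh_shifted[of a V 0] by (simp add: H_iff)
  \<comment> \<open>Maps s -> a correspond to maps s[1] -> a[1], and a[1] lies between Q, which is t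
    shifted by -1, and k. Neither receives a nonzero map from s[1]: Q is in
    \<open>V\<langle>-1\<rangle>\<close> and k is in
    \<open>F\<langle>1\<rangle> \<star> V\<langle>0\<rangle>\<close>.\<close>
  have "a \<in> F"
  proof (rule F_max[OF aH])
    fix s assume s: "s \<in> T"
    have "orth (T\<langle>0 + 1\<rangle>) (F\<langle>0 + 1\<rangle>)" by (rule orth_shifted) (use TF(1) T F in simp)
    moreover have "orth (T\<langle>1\<rangle>) (V\<langle>0\<rangle>)" by (rule orth_mono[OF orth_UV torsion_UV(5) order_refl]) simp
    ultimately have o: "orth (T\<langle>1\<rangle>) (F\<langle>1\<rangle> \<star> V\<langle>0\<rangle>)" using orth_star_right by simp
    have sT: "sh D s \<in> T\<langle>1\<rangle>" using s T(2) by (simp add: sh_shifted1)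
    obtain Q e h' where Q: "isomorphic D (sh D Q) t" "tri D Q (sh D a) k e f h'"
      using tri_unrotate[OF tri] by blast
    have "sh D Q \<in> V\<langle>0\<rangle>" by (rule iso_closedD[OF iso_closed_shifted tV isomorphic_sym[OF Q(1)]])
    then have "Q \<in> V\<langle>-1\<rangle>" using sh_shifted[of Q V "-1"] by simp
    moreover have "sh D s \<in> U\<langle>1\<rangle>" using sT torsion_UV(5) by blast
    ultimately have "orthogonal (sh D s) Q" using orthogonal_UV[of _ 1 _ "-1"] by simp
    moreover have "orthogonal (sh D s) k" by (rule orthD[OF o sT kF])
    ultimately have "orthogonal (sh D s) (sh D a)" by (rule tri_orthogonal_right[OF Q(2)])
    then show "orthogonal s a" by (simp add: sh_orthogonal)
  qed
  then show thesis using that ut(2) tri by blast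
qed

end

end

section \<open>Stability functions\<close>

text \<open>The difference of two phases in (0,1] lies in (-1,1), where the sine determines its
  sign.\<close>

lemma sin_pi_sign:
  assumes "- 1 < x" "x < 1"
  shows "0 < sin (pi * x) \<longleftrightarrow> 0 < x" "sin (pi * x) = 0 \<longleftrightarrow> x = 0"
proof -
  have pos: "0 < sin (pi * y)" if "0 < y" "y < 1" for y :: real
    using that by (intro sin_gt_zero) auto
  have "sin (pi * x) = - sin (pi * (- x))" by simp
  then have "sin (pi * x) < 0" if "x < 0" using pos[of "- x"] that assms by linarith
  then show "0 < sin (pi * x) \<longleftrightarrow> 0 < x" "sin (pi * x) = 0 \<longleftrightarrow> x = 0"
    using pos[of x] assms by (cases x "0 :: real" rule: linorder_cases; force)+
qed

lemma Im_mult_cis: "Im (of_real m * cis (pi * \<phi>) * cis (- (pi * \<psi>))) = m * sin (pi * (\<phi> - \<psi>))"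
  by (simp add: mult.assoc cis_mult right_diff_distrib)

text \<open>Additivity of the charge on triangles stands in for the homomorphism from the
  Grothendieck group; \<open>central_charge_tri\<close> supplies it at the end.\<close>

locale stability = bounded_t_category D U V H for D :: "('o, 'm) tcat" (structure) and U V H +
  fixes lam :: "('o \<Rightarrow>\<^sub>0 int) set \<Rightarrow> 'l::ab_group_add" and Z :: "'l realification \<Rightarrow> complex"
  assumes stab: "stability_function D lam H Z"
    and charge_add: "tri D X Y Y' f g h \<Longrightarrow>
      central_charge D lam Z Y = central_charge D lam Z X + central_charge D lam Z Y'"
    and HN: "HN_property D lam H Z"
begin

definition height :: "real \<Rightarrow> 'o \<Rightarrow> real"
  where "height \<psi> X = Im (central_charge D lam Z X * cis (- (pi * \<psi>)))"

lemma height_additive: "tri_additive (height \<psi>)"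
  unfolding tri_additive_def height_def using charge_add by (auto simp: distrib_right simp del: times_complex.sel)

lemma phase_charge:
  assumes "X \<in> H" "\<not> zero_object D X"
  shows "phase D lam Z X \<in> {0<..1}"
    "\<exists>m>0. central_charge D lam Z X = of_real m * cis (pi * phase D lam Z X)"
proof -
  let ?P = "\<lambda>\<phi>. \<phi> \<in> {0<..1} \<and> (\<exists>m>0. central_charge D lam Z X = of_real m * cis (pi * \<phi>))"
  obtain m \<phi> where m: "m > 0" "\<phi> \<in> {0<..1}" "central_charge D lam Z X = of_real m * cis (pi * \<phi>)"
    using stab assms unfolding stability_function_def by blast
  have "?P (THE \<phi>. ?P \<phi>)"
  proof (rule theI[of ?P \<phi>])
    show "?P \<phi>" using m by blast
    fix \<psi> assume \<psi>: "?P \<psi>"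
    then obtain m' where "central_charge D lam Z X = of_real m' * cis (pi * \<psi>)" by blast
    \<comment> \<open>Rotation by -pi \<psi> makes the second expression for the charge
      real.\<close>
    then have "m * sin (pi * (\<phi> - \<psi>)) = m' * sin (pi * (\<psi> - \<psi>))"
      using m(3) Im_mult_cis[of m \<phi> \<psi>] Im_mult_cis[of m' \<psi> \<psi>] by simp
    then show "\<psi> = \<phi>" using m sin_pi_sign(2)[of "\<phi> - \<psi>"] \<psi> by auto
  qed
  then show "phase D lam Z X \<in> {0<..1}"
    "\<exists>m>0. central_charge D lam Z X = of_real m * cis (pi * phase D lam Z X)"
    unfolding phase_def by blast+
qed

lemma height_sign:
  assumes "X \<in> H" "\<not> zero_object D X" "\<psi> \<in> {0<..1}"
  shows "0 < height \<psi> X \<longleftrightarrow> \<psi> < phase D lam Z X" "height \<psi> X = 0 \<longleftrightarrow> phase D lam Z X = \<psi>"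
proof -
  obtain m where m: "m > 0" "central_charge D lam Z X = of_real m * cis (pi * phase D lam Z X)"
    using phase_charge(2)[OF assms(1,2)] by blast
  have "height \<psi> X = m * sin (pi * (phase D lam Z X - \<psi>))"
    unfolding height_def m(2) by (rule Im_mult_cis)
  moreover have "- 1 < phase D lam Z X - \<psi>" "phase D lam Z X - \<psi> < 1"
    using phase_charge(1)[OF assms(1,2)] assms(3) by auto
  ultimately show "0 < height \<psi> X \<longleftrightarrow> \<psi> < phase D lam Z X" "height \<psi> X = 0 \<longleftrightarrow> phase D lam Z X = \<psi>"
    using m(1) sin_pi_sign[of "phase D lam Z X - \<psi>"] by (auto simp: zero_less_mult_iff)
qed

lemma height_zero: "zero_object D X \<Longrightarrow> height \<psi> X = 0"
  by (rule additive_zero[OF height_additive])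

text \<open>Monomorphisms and triangles of H have the same subobjects (\<open>tri_is_mono\<close>,
  \<open>mono_tri\<close>), and the sign of the height compares phases.\<close>

lemma slice_eq:
  assumes \<psi>: "\<psi> \<in> {0<..1}"
  shows "slice D lam H Z \<psi> = slope_zero (height \<psi>)"
proof (intro equalityI subsetI)
  fix X assume X: "X \<in> slice D lam H Z \<psi>"
  show "X \<in> slope_zero (height \<psi>)"
  proof (cases "zero_object D X")
    case True then show ?thesis by (rule slope_zero_zero[OF height_additive])
  next
    case False
    with X have s: "X \<in> H" "semistable D lam H Z X" "phase D lam Z X = \<psi>" by (auto simp: slice_def)
    show ?thesis
    proof (rule slope_zeroI[OF height_additive s(1)])
      show "height \<psi> X = 0" using height_sign(2)[OF s(1) False \<psi>] s(3) by simp
      fix a b f g h assume ab: "a \<in> H" "b \<in> H" "tri D a X b f g h"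
      show "height \<psi> a \<le> 0"
      proof (cases "zero_object D a")
        case False
        then have "phase D lam Z a \<le> \<psi>"
          using s(2,3) tri_is_mono[OF ab(3,1) s(1) ab(2)] unfolding semistable_def by blast
        then show ?thesis using height_sign(1)[OF ab(1) False \<psi>] by linarith
      qed (simp add: height_zero)
    qed
  qed
next
  fix X assume X: "X \<in> slope_zero (height \<psi>)"
  note XH = slope_zeroD(1)[OF height_additive X]
  show "X \<in> slice D lam H Z \<psi>"
  proof (cases "zero_object D X")
    case True then show ?thesis using XH by (simp add: slice_def)
  next
    case False
    have ph: "phase D lam Z X = \<psi>"
      using height_sign(2)[OF XH False \<psi>] slope_zeroD(2)[OF height_additive X] by simp
    have "phase D lam Z a \<le> phase D lam Z X" if a: "is_mono D H a X i" "\<not> zero_object D a" for a i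
    proof -
      have aH: "a \<in> H" using a by (simp add: is_mono_def)
      obtain c f g h where "c \<in> H" "tri D a X c f g h" using a(1) by (rule mono_tri)
      then have "height \<psi> a \<le> 0" using slope_zeroD(3)[OF height_additive X] aH by blast
      then show ?thesis using height_sign(1)[OF aH a(2) \<psi>] ph by linarith
    qed
    then have "semistable D lam H Z X" unfolding semistable_def using XH False by blast
    then show ?thesis using XH ph by (simp add: slice_def)
  qed
qed

text \<open>A nonzero image I would be a quotient of A, hence of phase at least \<phi>, and a
  subobject of B, hence of phase at most \<psi> < \<phi>.\<close>

lemma slice_orthogonal:
  assumes A: "A \<in> slice D lam H Z \<phi>" and B: "B \<in> slice D lam H Z \<psi>"
    and "\<psi> < \<phi>" "\<phi> \<in> {0<..1}" "\<psi> \<in> {0<..1}"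
  shows "orthogonal A B"
proof (rule orthogonalI)
  have A': "A \<in> slope_zero (height \<phi>)" and B': "B \<in> slope_zero (height \<psi>)"
    using assms slice_eq by auto
  note H = slope_zeroD(1)[OF height_additive A'] slope_zeroD(1)[OF height_additive B']
  fix f assume "f \<in> Mor D A B"
  from H this obtain k I c i e x m p y where f: "k \<in> H" "I \<in> H" "c \<in> H"
    "tri D k A I i e x" "tri D I B c m p y" "f = m \<cdot> e" by (rule heart_factor)
  have "zero_object D I"
  proof (rule ccontr)
    assume nz: "\<not> zero_object D I"
    have "0 \<le> height \<phi> I" using slope_zeroD(4)[OF height_additive A' f(4,1,2)] .
    moreover have "height \<psi> I \<le> 0" using slope_zeroD(3)[OF height_additive B' f(5,2,3)] .
    ultimately show False
      using height_sign[OF f(2) nz assms(4)] height_sign[OF f(2) nz assms(5)] assms(3) by linarith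
  qed
  then have "e = mzero D A I" using zero_objectD(2) tri_in(2)[OF f(4)] by blast
  then show "f = mzero D A B" using f(6) tri_in(1)[OF f(5)] by simp
qed

section \<open>Harder-Narasimhan filtrations and the torsion pair at a phase\<close>

definition HN_filtration :: "'o \<Rightarrow> nat \<Rightarrow> (nat \<Rightarrow> 'o) \<Rightarrow> (nat \<Rightarrow> 'o) \<Rightarrow> (nat \<Rightarrow> real) \<Rightarrow> bool"
  where "HN_filtration h n hs qs \<phi> \<longleftrightarrow> zero_object D (hs 0) \<and> hs n = h \<and>
    (\<forall>k<n. \<exists>f g x. tri D (hs k) (hs (Suc k)) (qs k) f g x) \<and> (\<forall>k\<le>n. hs k \<in> H) \<and>
    (\<forall>k<n. qs k \<in> H \<and> \<not> zero_object D (qs k) \<and> qs k \<in> slice D lam H Z (\<phi> k)) \<and>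
    (\<forall>j k. j < k \<longrightarrow> k < n \<longrightarrow> \<phi> k < \<phi> j)"

lemma HN_filtrationD:
  assumes "HN_filtration h n hs qs \<phi>"
  shows "zero_object D (hs 0)" "hs n = h" "k \<le> n \<Longrightarrow> hs k \<in> H"
    "k < n \<Longrightarrow> \<exists>f g x. tri D (hs k) (hs (Suc k)) (qs k) f g x"
    "k < n \<Longrightarrow> qs k \<in> H \<and> \<not> zero_object D (qs k) \<and> phase D lam Z (qs k) = \<phi> k"
    "k < n \<Longrightarrow> qs k \<in> slice D lam H Z (\<phi> k)"
    "k < n \<Longrightarrow> \<phi> k \<in> {0<..1}" "j < k \<Longrightarrow> k < n \<Longrightarrow> \<phi> k < \<phi> j"
proof -
  show "qs k \<in> H \<and> \<not> zero_object D (qs k) \<and> phase D lam Z (qs k) = \<phi> k" if "k < n"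
    using assms that by (auto simp: HN_filtration_def slice_def)
  then show "k < n \<Longrightarrow> \<phi> k \<in> {0<..1}" using phase_charge(1) by metis
qed (use assms in \<open>simp_all add: HN_filtration_def\<close>)

lemma HN_filtration_ex:
  assumes "h \<in> H" obtains n hs qs \<phi> where "HN_filtration h n hs qs \<phi>"
proof -
  obtain n :: nat and hs "is" qs ps \<phi> where *: "zero_object D (hs 0)" "hs n = h"
    "\<forall>k\<le>n. hs k \<in> H"
    "\<forall>k<n. is_mono D H (hs k) (hs (Suc k)) (is k) \<and>
           is_cokernel D H (hs k) (hs (Suc k)) (is k) (qs k) (ps k) \<and>
           \<not> zero_object D (qs k) \<and> qs k \<in> slice D lam H Z (\<phi> k)"
    "\<forall>j k. j < k \<longrightarrow> k < n \<longrightarrow> \<phi> j > \<phi> k"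
    using bspec[OF HN[unfolded HN_property_def] assms] by (elim exE conjE) (rule that)
  have t: "\<exists>f g x. tri D (hs k) (hs (Suc k)) (qs k) f g x" if k: "k < n" for k
  proof -
    have "is_mono D H (hs k) (hs (Suc k)) (is k)" "is_cokernel D H (hs k) (hs (Suc k)) (is k) (qs k) (ps k)"
      using *(4) k by blast+
    then obtain f g x where "tri D (hs k) (hs (Suc k)) (qs k) f g x" by (rule mono_cokernel_tri)
    then show ?thesis by (intro exI)
  qed
  have "HN_filtration h n hs qs \<phi>"
    unfolding HN_filtration_def
  proof (intro conjI allI impI)
    fix k assume "k < n"
    then show "qs k \<in> H" using *(4) by (simp add: slice_def)
  qed (use * t in simp_all)
  then show thesis by (rule that)
qed

text \<open>Orthogonality, rather than the phases of Harder-Narasimhan factors, defines the pair.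
  Closure under isomorphism and extension and the maximality of the torsion-free part are then
  immediate; \<open>torsion_height\<close> recovers the link to phases.\<close>

definition torsion :: "real \<Rightarrow> 'o set"
  where "torsion \<phi> = {t \<in> H. \<forall>\<psi>\<in>{0<..1}. \<psi> < \<phi> \<longrightarrow> (\<forall>q\<in>slice D lam H Z \<psi>. orthogonal t q)}"

definition torsion_free :: "real \<Rightarrow> 'o set"
  where "torsion_free \<phi> = {f \<in> H. \<forall>t\<in>torsion \<phi>. orthogonal t f}"

lemma iso_closed_torsion: "iso_closed D (torsion \<phi>)"
  unfolding iso_closed_def torsion_def
  using iso_closedD[OF iso_closed_H] isomorphic_orthogonal(2)[OF isomorphic_sym] by auto

lemma iso_closed_torsion_free: "iso_closed D (torsion_free \<phi>)"
  unfolding iso_closed_def torsion_free_def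
  using iso_closedD[OF iso_closed_H] isomorphic_orthogonal(1)[OF isomorphic_sym] by auto

lemma zeros_torsion: "zeros \<subseteq> torsion \<phi>" "zeros \<subseteq> torsion_free \<phi>"
  using H_zero by (auto simp: torsion_def torsion_free_def zero_object_def)

lemma torsion_ext: "torsion \<phi> \<star> torsion \<phi> \<subseteq> torsion \<phi>"
proof
  fix X assume "X \<in> torsion \<phi> \<star> torsion \<phi>"
  then obtain a b f g h where t: "a \<in> torsion \<phi>" "b \<in> torsion \<phi>" "tri D a X b f g h" by (rule starE)
  have "X \<in> H" by (rule H_ext[OF t(3)]) (use t in \<open>simp_all add: torsion_def\<close>)
  then show "X \<in> torsion \<phi>" using t(1,2) tri_orthogonal_left[OF t(3)] by (simp add: torsion_def)
qed

lemma torsion_free_ext: "torsion_free \<phi> \<star> torsion_free \<phi> \<subseteq> torsion_free \<phi>"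
proof
  fix X assume "X \<in> torsion_free \<phi> \<star> torsion_free \<phi>"
  then obtain a b f g h where t: "a \<in> torsion_free \<phi>" "b \<in> torsion_free \<phi>" "tri D a X b f g h"
    by (rule starE)
  have "X \<in> H" by (rule H_ext[OF t(3)]) (use t in \<open>simp_all add: torsion_free_def\<close>)
  then show "X \<in> torsion_free \<phi>"
    using t(1,2) tri_orthogonal_right[OF t(3)] by (simp add: torsion_free_def)
qed

lemma slice_torsion:
  "\<psi> \<in> {0<..1} \<Longrightarrow> \<phi> \<le> \<psi> \<Longrightarrow> slice D lam H Z \<psi> \<subseteq> torsion \<phi>"
  "\<psi> \<in> {0<..1} \<Longrightarrow> \<psi> < \<phi> \<Longrightarrow> slice D lam H Z \<psi> \<subseteq> torsion_free \<phi>"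
proof -
  show "slice D lam H Z \<psi> \<subseteq> torsion \<phi>" if "\<psi> \<in> {0<..1}" "\<phi> \<le> \<psi>"
  proof
    fix X assume X: "X \<in> slice D lam H Z \<psi>"
    then have "X \<in> H" by (simp add: slice_def)
    then show "X \<in> torsion \<phi>"
      unfolding torsion_def using slice_orthogonal[OF X] that by fastforce
  qed
  show "slice D lam H Z \<psi> \<subseteq> torsion_free \<phi>" if "\<psi> \<in> {0<..1}" "\<psi> < \<phi>"
    using that by (auto simp: torsion_free_def torsion_def slice_def)
qed

lemma torsion_decomp: "H \<subseteq> torsion \<phi> \<star> torsion_free \<phi>"
proof
  fix X assume "X \<in> H"
  then obtain n hs qs \<psi> where "HN_filtration X n hs qs \<psi>" by (rule HN_filtration_ex)
  note * = HN_filtrationD[OF this]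
  let ?T = "torsion \<phi>" and ?F = "torsion_free \<phi>"
  have T: "?T \<subseteq> ?T \<star> ?F"
    using star_mono[OF order_refl zeros_torsion(2), of ?T] by (simp add: star_zeros iso_closed_torsion)
  \<comment> \<open>The second conjunct is needed since \<open>?T \<star> ?F\<close> need not absorb
    a torsion factor on the right. As phases decrease, a factor of phase at least \<phi> is preceded
    only by such factors, so \<open>hs k\<close> is then itself torsion.\<close>
  have "hs k \<in> ?T \<star> ?F \<and> ((\<forall>j<k. \<phi> \<le> \<psi> j) \<longrightarrow> hs k \<in> ?T)" if "k \<le> n" for k
    using that
  proof (induction k)
    case 0
    then show ?case using *(1) zeros_torsion(1) T by blast
  next
    case (Suc k)
    then have k: "k < n" by simp
    obtain f g x where t: "tri D (hs k) (hs (Suc k)) (qs k) f g x" using *(4)[OF k] by blast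
    show ?case
    proof (cases "\<phi> \<le> \<psi> k")
      case True
      then have "\<forall>j<k. \<phi> \<le> \<psi> j" using *(8) k by fastforce
      then have "hs k \<in> ?T" using Suc by simp
      moreover have "qs k \<in> ?T" using slice_torsion(1)[OF *(7)[OF k] True] *(6)[OF k] by blast
      ultimately have "hs (Suc k) \<in> ?T" using torsion_ext starI[OF t] by blast
      then show ?thesis using T by blast
    next
      case False
      then have "qs k \<in> ?F" using slice_torsion(2)[OF *(7)[OF k], of \<phi>] *(6)[OF k] by auto
      moreover have "hs k \<in> ?T \<star> ?F" using Suc by simp
      ultimately have "hs (Suc k) \<in> ?T \<star> (?F \<star> ?F)" using starI[OF t] by (simp add: star_assoc[symmetric])
      then have "hs (Suc k) \<in> ?T \<star> ?F" using star_mono[OF order_refl torsion_free_ext] by blast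
      then show ?thesis using False by blast
    qed
  qed
  then show "X \<in> ?T \<star> ?F" using *(2) by blast
qed

text \<open>The last factor is a nonzero quotient of X with the smallest phase; if X is torsion,
  this phase is at least \<phi>. The first factor is a nonzero subobject with the largest phase; if
  X is torsion-free, this phase is below \<phi>. All factors then have heights of one sign, and
  heights add.\<close>

lemma torsion_height:
  assumes \<phi>: "\<phi> \<in> {0<..1}"
  shows "X \<in> torsion \<phi> \<Longrightarrow> 0 \<le> height \<phi> X" "X \<in> torsion_free \<phi> \<Longrightarrow> height \<phi> X \<le> 0"
proof -
  have "X \<in> H" if "X \<in> torsion \<phi> \<or> X \<in> torsion_free \<phi>"
    using that by (auto simp: torsion_def torsion_free_def)
  then have "(X \<in> torsion \<phi> \<longrightarrow> 0 \<le> height \<phi> X) \<and> (X \<in> torsion_free \<phi> \<longrightarrow> height \<phi> X \<le> 0)"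
  proof (cases "X \<in> torsion \<phi> \<or> X \<in> torsion_free \<phi>")
    case True
    with \<open>X \<in> torsion \<phi> \<or> X \<in> torsion_free \<phi> \<Longrightarrow> X \<in> H\<close> have "X \<in> H" .
    then obtain n hs qs \<psi> where "HN_filtration X n hs qs \<psi>" by (rule HN_filtration_ex)
    note * = HN_filtrationD[OF this]
    have step: "height \<phi> (hs (Suc k)) = height \<phi> (hs k) + height \<phi> (qs k)" if "k < n" for k
      using *(4)[OF that] tri_additiveD[OF height_additive] by blast
    have 0: "height \<phi> (hs 0) = 0" using *(1) by (rule height_zero)
    have pos: "0 \<le> height \<phi> X" if T: "X \<in> torsion \<phi>"
    proof -
      have ge: "\<phi> \<le> \<psi> k" if k: "k < n" for k
      proof -
        obtain m where m: "n = Suc m" using k by (cases n) auto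
        obtain f g x where t: "tri D (hs m) X (qs m) f g x" using *(4)[of m] *(2) m by auto
        have "\<phi> \<le> \<psi> m"
        proof (rule ccontr)
          assume "\<not> \<phi> \<le> \<psi> m"
          then have "orthogonal X (qs m)" using T *(6,7)[of m] m by (auto simp: torsion_def)
          then have "idm D (qs m) \<cdot> g = mzero D X (qs m)"
            using cmp_in[OF tri_in(2)[OF t] idm_in] by blast
          then have "idm D (qs m) = mzero D (qs m) (qs m)"
            by (rule heart_epi[OF t _ _ idm_in, rotated 2]) (use *(3,5)[of m] m in auto)
          then show False using *(5)[of m] m by (simp add: zero_object_iff)
        qed
        then show ?thesis using *(8)[of k m] k m by (cases "k = m") force+
      qed
      have "0 \<le> height \<phi> (hs k)" if "k \<le> n" for k
        using that
      proof (induction k)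
        case (Suc k)
        then have k: "k < n" by simp
        then show ?case
          using step[OF k] Suc.IH ge[OF k] height_sign[of "qs k" \<phi>] *(5)[OF k] \<phi> by force
      qed (simp add: 0)
      then show ?thesis using *(2) by blast
    qed
    have neg: "height \<phi> X \<le> 0" if F: "X \<in> torsion_free \<phi>"
    proof -
      \<comment> \<open>Orthogonality descends along the filtration because its inclusions are left
        cancellable on the heart.\<close>
      have orth: "\<forall>t\<in>torsion \<phi>. orthogonal t (hs k)" if "k \<le> n" for k
        using that
      proof (induction rule: inc_induct)
        case base
        then show ?case using F *(2) by (simp add: torsion_free_def)
      next
        case (step k)
        obtain f g x where t: "tri D (hs k) (hs (Suc k)) (qs k) f g x" using *(4) step by blast
        show ?case
        proof (intro ballI orthogonalI)
          fix s d assume s: "s \<in> torsion \<phi>" and d: "d \<in> Mor D s (hs k)"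
          have "f \<cdot> d = mzero D s (hs (Suc k))" using step.IH s cmp_in[OF d tri_in(1)[OF t]] by blast
          then show "d = mzero D s (hs k)"
            by (rule heart_mono[OF t _ _ d, rotated 2]) (use s *(5) step in \<open>auto simp: torsion_def\<close>)
        qed
      qed
      have lt: "\<psi> k < \<phi>" if k: "k < n" for k
      proof -
        have n: "0 < n" using k by simp
        obtain f g x where t: "tri D (hs 0) (hs (Suc 0)) (qs 0) f g x" using *(4)[OF n] by blast
        \<comment> \<open>As \<open>hs 0\<close> is zero, \<open>hs (Suc 0)\<close> is isomorphic to
          the first factor; were that torsion, it would be orthogonal to itself.\<close>
        have "\<psi> 0 < \<phi>"
        proof (rule ccontr)
          assume "\<not> \<psi> 0 < \<phi>"
          then have "qs 0 \<in> torsion \<phi>"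
            using slice_torsion(1)[OF *(7)[OF n], of \<phi>] *(6)[OF n] by auto
          then have "orthogonal (qs 0) (hs (Suc 0))" using orth[of "Suc 0"] n by simp
          then have "orthogonal (qs 0) (qs 0)"
            by (rule isomorphic_orthogonal(1)[OF isomorphic_sym[OF tri_first_zero[OF t *(1)]]])
          then show False using orthogonal_self *(5)[OF n] by blast
        qed
        then show ?thesis using *(8)[of 0 k] k by (cases "k = 0") force+
      qed
      have "height \<phi> (hs k) \<le> 0" if "k \<le> n" for k
        using that
      proof (induction k)
        case (Suc k)
        then have k: "k < n" by simp
        then show ?case
          using step[OF k] Suc.IH lt[OF k] height_sign[of "qs k" \<phi>] *(5)[OF k] \<phi> by force
      qed (simp add: 0)
      then show ?thesis using *(2) by blast
    qed
    show ?thesis using pos neg by blast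
  qed simp
  then show "X \<in> torsion \<phi> \<Longrightarrow> 0 \<le> height \<phi> X" "X \<in> torsion_free \<phi> \<Longrightarrow> height \<phi> X \<le> 0"
    by blast+
qed

text \<open>Each object of the tilt lies between a[1] and t, and the shift turns the nonpositive
  height of a into a nonnegative one.\<close>

lemma ex_intermediate_heart:
  assumes \<phi>: "\<phi> \<in> {0<..1}"
  shows "\<exists>K\<in>intermediate_hearts D H. \<forall>k\<in>K. 0 \<le> height \<phi> k"
proof -
  have TF: "torsion \<phi> \<subseteq> H" "torsion_free \<phi> \<subseteq> H" "orth (torsion \<phi>) (torsion_free \<phi>)"
    by (auto simp: torsion_def torsion_free_def orth_def)
  have max: "f \<in> torsion_free \<phi>" if "f \<in> H" "\<And>t. t \<in> torsion \<phi> \<Longrightarrow> orthogonal t f" for f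
    using that by (simp add: torsion_free_def)
  note tp = TF(1) iso_closed_torsion zeros_torsion(1) TF(2) iso_closed_torsion_free zeros_torsion(2)
    TF(3) torsion_decomp max
  have "0 \<le> height \<phi> k" if k: "k \<in> tilted_heart (torsion \<phi>) (torsion_free \<phi>)" for k
  proof -
    obtain a t f g h where t: "a \<in> torsion_free \<phi>" "t \<in> torsion \<phi>" "tri D (sh D a) k t f g h"
      using tilted_heart_decomp[OF tp k] by metis
    then show ?thesis
      using torsion_height[OF \<phi>] tri_additiveD[OF height_additive t(3)] additive_sh[OF height_additive, of \<phi> a]
      by fastforce
  qed
  then show ?thesis using tilted_heart_intermediate[OF tp] by blast
qed

lemma thick_heart_ker:
  assumes \<phi>: "\<phi> \<in> {0<..1}" and K: "K \<in> intermediate_hearts D H" and pos: "\<And>k. k \<in> K \<Longrightarrow> 0 \<le> height \<phi> k"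
  shows "thick D {k \<in> K. height \<phi> k = 0} \<inter> H = slice D lam H Z \<phi>"
proof -
  obtain UK VK where "bounded_t_structure D UK VK" "K = UK \<inter> VK"
    using K by (auto simp: intermediate_hearts_def bounded_heart_def)
  then have "bounded_t_category D UK VK K"
    using triangulated_category_axioms by (simp add: bounded_t_category_def bounded_t_category_axioms_def)
  from thick_kernel[OF this _ _ height_additive pos] K
  have "thick D {k \<in> K. height \<phi> k = 0} = thick D (slope_zero (height \<phi>))"
    by (simp add: intermediate_hearts_def)
  then show ?thesis
    using thick_wide_Int_heart[OF slope_zero_Wide[OF height_additive]] slice_eq[OF \<phi>] by simp
qed

end

section \<open>The Grothendieck group and functionals on the complex plane\<close>

lemma K0_class_tri:
  assumes "tri D X Y Y' f g h"
  shows "K0_class D Y = K0_class D X \<otimes>\<^bsub>K0 D\<^esub> K0_class D Y'"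
proof -
  let ?A = "free_Abelian_group (UNIV :: 'a set)" and ?N = "K0_relations D"
  interpret A: comm_group ?A by (rule abelian_free_Abelian_group)
  have sub: "subgroup ?N ?A"
    unfolding K0_relations_def by (rule A.generate_is_subgroup) (simp add: free_Abelian_group_def)
  then have normal: "?N \<lhd> ?A" by (rule A.subgroup_imp_normal)
  have "frag_of Y - frag_of X - frag_of Y' \<in> ?N"
    unfolding K0_relations_def by (rule generate.incl) (use assms in blast)
  then have "frag_of Y \<in> ?N #>\<^bsub>?A\<^esub> (frag_of X + frag_of Y')"
    unfolding r_coset_def by (auto intro!: bexI)
  then have "?N #>\<^bsub>?A\<^esub> (frag_of X + frag_of Y') = ?N #>\<^bsub>?A\<^esub> frag_of Y"
    by (rule A.repr_independence) (use sub in simp_all)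
  then show ?thesis
    using normal.rcos_sum[OF normal, of "frag_of X" "frag_of Y'"]
    by (simp add: K0_class_def K0_def FactGroup_def)
qed

lemma K0_class_carrier: "K0_class D X \<in> carrier (K0 D)"
  by (auto simp: K0_class_def K0_def FactGroup_def RCOSETS_def)

lemma tensor_add: "tensor (x + y) r = tensor x r + tensor y r"
  by transfer (use tensor_relations_left in \<open>simp add: tensor_eq_def diff_diff_eq\<close>)

lemma central_charge_tri:
  assumes lam: "lam \<in> hom (K0 D) additive_group" and Z: "linear Z" and t: "tri D X Y Y' f g h"
  shows "central_charge D lam Z Y = central_charge D lam Z X + central_charge D lam Z Y'"
  using hom_mult[OF lam K0_class_carrier K0_class_carrier] linear_add[OF Z] K0_class_tri[OF t]
  by (simp add: central_charge_def additive_group_def tensor_add)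

lemma additive_dual_map:
  assumes "linear Z" "linear w" shows "additive (dual_map Z w)"
  by (rule additive.intro) (simp add: dual_map_def tensor_add linear_add[OF assms(1)] linear_add[OF assms(2)])

text \<open>In the real basis cis(pi \<phi>), i cis(pi \<phi>) the functional w vanishes on the
  first vector, so it is the second coordinate times c = w(i cis(pi \<phi>)) > 0.\<close>

lemma upper_dualE:
  assumes "w \<in> upper_dual"
  obtains c \<phi> where "linear w" "c > 0" "\<phi> \<in> {0<..1}" "theta w = \<phi>"
    "\<And>z. w z = c * Im (z * cis (- (pi * \<phi>)))"
proof -
  obtain \<phi> where w: "linear w" "\<phi> \<in> {0<..1}" "w (cis (pi * \<phi>)) = 0" "w (\<i> * cis (pi * \<phi>)) > 0"
    using assms by (auto simp: upper_dual_def)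
  define c where "c = w (\<i> * cis (pi * \<phi>))"
  have eq: "w z = c * Im (z * cis (- (pi * \<phi>)))" for z
  proof -
    define u where "u = z * cis (- (pi * \<phi>))"
    have "z = u * cis (pi * \<phi>)" by (simp add: u_def mult.assoc cis_mult)
    also have "\<dots> = Re u *\<^sub>R cis (pi * \<phi>) + Im u *\<^sub>R (\<i> * cis (pi * \<phi>))"
      by (simp add: complex_eq_iff algebra_simps)
    finally have "w z = Re u * w (cis (pi * \<phi>)) + Im u * w (\<i> * cis (pi * \<phi>))"
      using w(1) by (simp add: linear_add linear_scale)
    then show ?thesis using w(3) by (simp add: c_def u_def)
  qed
  have "theta w = \<phi>"
    unfolding theta_def
  proof (rule the_equality)
    fix \<psi> assume \<psi>: "\<psi> \<in> {0<..1} \<and> w (cis (pi * \<psi>)) = 0"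
    then have "sin (pi * (\<psi> - \<phi>)) = 0"
      using eq[of "cis (pi * \<psi>)"] Im_mult_cis[of 1 \<psi> \<phi>] w(4) by (simp add: c_def)
    then show "\<psi> = \<phi>" using sin_pi_sign(2)[of "\<psi> - \<phi>"] \<psi> w(2) by auto
  qed (use w in simp)
  moreover have "c > 0" using w(4) by (simp add: c_def)
  ultimately show thesis using that[OF w(1) _ w(2) _ eq] by blast
qed

theorem proposition6p5:
  fixes D :: "('o, 'm) tcat"
    and H :: "'o set"
    and lam :: "('o \<Rightarrow>\<^sub>0 int) set \<Rightarrow> 'l::ab_group_add"
    and Z :: "'l realification \<Rightarrow> complex"
  assumes "triangulated_category D"
    and "bounded_heart D H"
    and "free_of_finite_rank TYPE('l)"
    and "lam \<in> epi (K0 D) additive_group"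
    and "stability_function D lam H Z"
    and "HN_property D lam H Z"
  shows "\<forall>w \<in> upper_dual.
    phase_diagram D lam H Z w \<in> Wide D H \<and>
    dual_map Z w \<in> heart_fan_support D lam H \<and>
    phase_diagram D lam H Z w = thick_label D lam H (dual_map Z w) \<inter> H"
proof
  fix w assume "w \<in> upper_dual"
  then obtain c \<phi> where w: "linear w" "c > 0" "\<phi> \<in> {0<..1}" "theta w = \<phi>"
    "\<And>z. w z = c * Im (z * cis (- (pi * \<phi>)))" by (rule upper_dualE) blast
  have Z: "linear Z" using assms(5) by (simp add: stability_function_def)
  have lam: "lam \<in> hom (K0 D) additive_group" using assms(4) by (simp add: epi_def)
  obtain U V where UV: "bounded_t_structure D U V" "H = U \<inter> V"
    using assms(2) by (auto simp: bounded_heart_def)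
  interpret stability D U V H lam Z
    using assms(1,5,6) UV central_charge_tri[OF lam Z]
    by (intro stability.intro bounded_t_category.intro)
      (simp_all add: bounded_t_category_axioms_def stability_axioms_def)
  have val: "dual_map Z w (lam (K0_class D k)) = c * height \<phi> k" for k
    by (simp add: dual_map_def height_def central_charge_def w(5))
  have cone: "dual_map Z w \<in> heart_cone D lam K \<longleftrightarrow> (\<forall>k\<in>K. 0 \<le> height \<phi> k)" for K
    using additive_dual_map[OF Z w(1)] w(2) by (simp add: heart_cone_def val zero_le_mult_iff)
  have ker: "heart_ker D lam K (dual_map Z w) = {k \<in> K. height \<phi> k = 0}" for K
    using w(2) by (simp add: heart_ker_def val)
  have diagram: "phase_diagram D lam H Z w = slice D lam H Z \<phi>"
    by (simp add: phase_diagram_def w(4))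
  have ex: "\<exists>K. K \<in> intermediate_hearts D H \<and> dual_map Z w \<in> heart_cone D lam K"
    using ex_intermediate_heart[OF w(3)] cone by blast
  show "phase_diagram D lam H Z w \<in> Wide D H \<and>
    dual_map Z w \<in> heart_fan_support D lam H \<and>
    phase_diagram D lam H Z w = thick_label D lam H (dual_map Z w) \<inter> H"
  proof (intro conjI)
    show "phase_diagram D lam H Z w \<in> Wide D H"
      using slope_zero_Wide[OF height_additive] by (simp add: diagram slice_eq[OF w(3)])
    show "dual_map Z w \<in> heart_fan_support D lam H"
      using ex by (auto simp: heart_fan_support_def)
    \<comment> \<open>The label selects its heart by \<open>SOME\<close>; \<open>ex\<close> makes
      the selection admissible, and \<open>thick_heart_ker\<close> holds for every admissible
      heart.\<close>
    show "phase_diagram D lam H Z w = thick_label D lam H (dual_map Z w) \<inter> H"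
      using thick_heart_ker[OF w(3)] someI_ex[OF ex] unfolding thick_label_def ker diagram
      by (simp add: cone)
  qed
qed

end
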